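(* Let $n\ge 2$, let $G=\mathrm{SL}_n(\mathbb{C})$, let $V=n\mathbb{C}^n\oplus n(\mathbb{C}^n)^*$ and let $Z=V/\!\!/G$. Then $Z_m$ is normal and $p_m^*\colon\mathcal{O}(Z_m)\to\mathcal{O}(V_m)^{G_m}$ is an isomorphism for $m=0,1,\dots,\infty$.
   Context: $n\mathbb{C}^n$ denotes the direct sum of $n$ copies of the standard representation $\mathbb{C}^n$, and $(\mathbb{C}^n)^*$ its dual. For a scheme $X$ of finite type over $\mathbb{C}$ and an integer $m\ge 0$, the jet scheme $X_m$ is characterized by functorial bijections $\mathrm{Hom}(\mathrm{Spec}\,A,X_m)\cong\mathrm{Hom}(\mathrm{Spec}\,A[t]/\langle t^{m+1}\rangle,X)$ for $\mathbb{C}$-algebras $A$; the arc space is $X_\infty=\varprojlim X_m$. $V/\!\!/G=\mathrm{Spec}(\mathcal{O}(V)^G)$ with canonical map $p\colon V\to V/\!\!/G$. By functoriality $G_m$ acts on $V_m$, and $p$ induces $p_m\colon V_m\to(V/\!\!/G)_m$ and $p_m^*\colon\mathcal{O}((V/\!\!/G)_m)\to\mathcal{O}(V_m)^{G_m}$. *)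

theory Defs
  imports
    Jordan_Normal_Form.Determinant
    "HOL-Library.Poly_Mapping"
    "HOL-Library.Extended_Nat"
    "HOL-Algebra.QuotRing"
    "HOL-Algebra.Algebraic_Closure_Type"
begin

section \<open>Algebras over the complex numbers\<close>

abbreviation C_field :: "complex ring" where
  "C_field \<equiv> ring_of_type_algebra"

abbreviation C_algebra :: "(complex, 'a, 'm) module_scheme \<Rightarrow> bool" where
  "C_algebra A \<equiv> algebra C_field A"

definition alg_hom ::
  "(complex, 'a, 'm) module_scheme \<Rightarrow> (complex, 'b, 'n) module_scheme \<Rightarrow> ('a \<Rightarrow> 'b) set" where
  "alg_hom A B =
     {h \<in> ring_hom A B. \<forall>c. \<forall>x \<in> carrier A. h (c \<odot>\<^bsub>A\<^esub> x) = c \<odot>\<^bsub>B\<^esub> h x}"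

definition alg_iso ::
  "(complex, 'a, 'm) module_scheme \<Rightarrow> (complex, 'b, 'n) module_scheme \<Rightarrow> ('a \<Rightarrow> 'b) set" where
  "alg_iso A B = {h \<in> alg_hom A B. bij_betw h (carrier A) (carrier B)}"

definition complex_alg :: "(complex, complex) module" where
  "complex_alg =
     \<lparr>carrier = UNIV, monoid.mult = (*), one = 1, ring.zero = 0, add = (+), module.smult = (*)\<rparr>"

text \<open>The scalars of a quotient algebra act through the images of \<open>c \<odot> \<one>\<close>.\<close>

definition quot_alg ::
  "(complex, 'a, 'm) module_scheme \<Rightarrow> 'a set \<Rightarrow> (complex, 'a set) module" where
  "quot_alg A I =
     \<lparr>carrier = carrier (A Quot I), monoid.mult = monoid.mult (A Quot I), one = one (A Quot I),
      ring.zero = ring.zero (A Quot I), add = add (A Quot I),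
      module.smult = (\<lambda>c U. (I +>\<^bsub>A\<^esub> (c \<odot>\<^bsub>A\<^esub> \<one>\<^bsub>A\<^esub>)) \<otimes>\<^bsub>A Quot I\<^esub> U)\<rparr>"


section \<open>Polynomial algebras\<close>

type_synonym 'v cpoly = "('v \<Rightarrow>\<^sub>0 nat) \<Rightarrow>\<^sub>0 complex"

definition pvar :: "'v \<Rightarrow> 'v cpoly" where
  "pvar v = Poly_Mapping.single (Poly_Mapping.single v 1) 1"

definition pconst :: "complex \<Rightarrow> 'v cpoly" where
  "pconst c = Poly_Mapping.single 0 c"

definition mpoly_alg :: "'v set \<Rightarrow> (complex, 'v cpoly) module" where
  "mpoly_alg I =
     \<lparr>carrier = {p. \<forall>\<mu> \<in> Poly_Mapping.keys p. Poly_Mapping.keys \<mu> \<subseteq> I},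
      monoid.mult = (*), one = 1, ring.zero = 0, add = (+), module.smult = (\<lambda>c p. pconst c * p)\<rparr>"

definition aeval :: "(complex, 'b, 'm) module_scheme \<Rightarrow> ('v \<Rightarrow> 'b) \<Rightarrow> 'v cpoly \<Rightarrow> 'b" where
  "aeval B \<phi> p =
     (\<Oplus>\<^bsub>B\<^esub>\<mu> \<in> Poly_Mapping.keys p. Poly_Mapping.lookup p \<mu> \<odot>\<^bsub>B\<^esub>
        (\<Otimes>\<^bsub>B\<^esub>v \<in> Poly_Mapping.keys \<mu>. \<phi> v [^]\<^bsub>B\<^esub> Poly_Mapping.lookup \<mu> v))"


section \<open>Jet schemes of affine schemes\<close>

text \<open>
  \<open>trunc_alg m B\<close> is \<open>B[t]/(t^(m+1))\<close>, and \<open>B[[t]]\<close> for \<open>m = \<infinity>\<close>; its elements are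
  the coefficient sequences.
\<close>

definition trunc_alg ::
  "enat \<Rightarrow> (complex, 'b, 'm) module_scheme \<Rightarrow> (complex, nat \<Rightarrow> 'b) module" where
  "trunc_alg m B =
     \<lparr>carrier = {f. \<forall>k. if enat k \<le> m then f k \<in> carrier B else f k = \<zero>\<^bsub>B\<^esub>},
      monoid.mult = (\<lambda>f g k. if enat k \<le> m then \<Oplus>\<^bsub>B\<^esub>i\<in>{..k}. f i \<otimes>\<^bsub>B\<^esub> g (k - i) else \<zero>\<^bsub>B\<^esub>),
      one = (\<lambda>k. if k = 0 then \<one>\<^bsub>B\<^esub> else \<zero>\<^bsub>B\<^esub>),
      ring.zero = (\<lambda>k. \<zero>\<^bsub>B\<^esub>),
      add = (\<lambda>f g k. if enat k \<le> m then f k \<oplus>\<^bsub>B\<^esub> g k else \<zero>\<^bsub>B\<^esub>),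
      module.smult = (\<lambda>c f k. if enat k \<le> m then c \<odot>\<^bsub>B\<^esub> f k else \<zero>\<^bsub>B\<^esub>)\<rparr>"

text \<open>
  For \<open>X = Spec A\<close> the coordinate algebra of \<open>X\<^sub>m\<close> (\<open>m = \<infinity>\<close> being the arc space) is generated by
  symbols \<open>(k, a)\<close>, standing for the coefficient of \<open>t^k\<close> of the image of \<open>a\<close> under the
  universal homomorphism \<open>A \<rightarrow> \<O>(X\<^sub>m)[t]/(t^(m+1))\<close>; the relations say that the latter is a
  homomorphism of algebras. Theorem \<open>jet_universal\<close> below is the characterization of
  \<open>X\<^sub>m\<close> by its functor of points.
\<close>

definition jet_vars :: "enat \<Rightarrow> (complex, 'a, 'm) module_scheme \<Rightarrow> (nat \<times> 'a) set" where
  "jet_vars m A = {k. enat k \<le> m} \<times> carrier A"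

definition jet_rels :: "enat \<Rightarrow> (complex, 'a, 'm) module_scheme \<Rightarrow> (nat \<times> 'a) cpoly set" where
  "jet_rels m A =
     {pvar (k, a \<oplus>\<^bsub>A\<^esub> b) - (pvar (k, a) + pvar (k, b)) | k a b.
        enat k \<le> m \<and> a \<in> carrier A \<and> b \<in> carrier A} \<union>
     {pvar (k, a \<otimes>\<^bsub>A\<^esub> b) - (\<Sum>i\<le>k. pvar (i, a) * pvar (k - i, b)) | k a b.
        enat k \<le> m \<and> a \<in> carrier A \<and> b \<in> carrier A} \<union>
     {pvar (k, c \<odot>\<^bsub>A\<^esub> a) - pconst c * pvar (k, a) | k c a.
        enat k \<le> m \<and> a \<in> carrier A} \<union>
     {pvar (k, \<one>\<^bsub>A\<^esub>) - (if k = 0 then 1 else 0) | k. enat k \<le> m}"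

definition jet_ideal :: "enat \<Rightarrow> (complex, 'a, 'm) module_scheme \<Rightarrow> (nat \<times> 'a) cpoly set" where
  "jet_ideal m A = Idl\<^bsub>mpoly_alg (jet_vars m A)\<^esub> (jet_rels m A)"

definition jet_alg ::
  "enat \<Rightarrow> (complex, 'a, 'm) module_scheme \<Rightarrow> (complex, (nat \<times> 'a) cpoly set) module" where
  "jet_alg m A = quot_alg (mpoly_alg (jet_vars m A)) (jet_ideal m A)"

definition jet_gen ::
  "enat \<Rightarrow> (complex, 'a, 'm) module_scheme \<Rightarrow> nat \<Rightarrow> 'a \<Rightarrow> (nat \<times> 'a) cpoly set" where
  "jet_gen m A k a = jet_ideal m A +>\<^bsub>mpoly_alg (jet_vars m A)\<^esub> pvar (k, a)"

text \<open>
  \<open>jet_map m A B h\<close> is the comorphism of \<open>(Spec B)\<^sub>m \<rightarrow> (Spec A)\<^sub>m\<close> induced by \<open>h : A \<rightarrow> B\<close>; it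
  evaluates any representative of its argument at \<open>(k, a) \<mapsto> [(k, h a)]\<close>.
\<close>

definition jet_map ::
  "enat \<Rightarrow> (complex, 'a, 'm) module_scheme \<Rightarrow> (complex, 'b, 'n) module_scheme \<Rightarrow>
   ('a \<Rightarrow> 'b) \<Rightarrow> (nat \<times> 'a) cpoly set \<Rightarrow> (nat \<times> 'b) cpoly set" where
  "jet_map m A B h U = the_elem (aeval (jet_alg m B) (\<lambda>(k, a). jet_gen m B k (h a)) ` U)"


section \<open>Normality\<close>

definition loc_rel :: "('a, 'm) ring_scheme \<Rightarrow> 'a set \<Rightarrow> (('a \<times> 'a) \<times> ('a \<times> 'a)) set" where
  "loc_rel A S =
     {((a, s), (b, t)). a \<in> carrier A \<and> b \<in> carrier A \<and> s \<in> S \<and> t \<in> S \<and>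
        (\<exists>u \<in> S. u \<otimes>\<^bsub>A\<^esub> (a \<otimes>\<^bsub>A\<^esub> t) = u \<otimes>\<^bsub>A\<^esub> (b \<otimes>\<^bsub>A\<^esub> s))}"

definition loc_frac :: "('a, 'm) ring_scheme \<Rightarrow> 'a set \<Rightarrow> 'a \<Rightarrow> 'a \<Rightarrow> ('a \<times> 'a) set" where
  "loc_frac A S a s = loc_rel A S `` {(a, s)}"

definition localization :: "('a, 'm) ring_scheme \<Rightarrow> 'a set \<Rightarrow> ('a \<times> 'a) set ring" where
  "localization A S =
     \<lparr>carrier = (carrier A \<times> S) // loc_rel A S,
      monoid.mult = (\<lambda>U W. \<Union>(a, s)\<in>U. \<Union>(b, t)\<in>W. loc_frac A S (a \<otimes>\<^bsub>A\<^esub> b) (s \<otimes>\<^bsub>A\<^esub> t)),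
      one = loc_frac A S \<one>\<^bsub>A\<^esub> \<one>\<^bsub>A\<^esub>,
      ring.zero = loc_frac A S \<zero>\<^bsub>A\<^esub> \<one>\<^bsub>A\<^esub>,
      add = (\<lambda>U W. \<Union>(a, s)\<in>U. \<Union>(b, t)\<in>W.
               loc_frac A S ((a \<otimes>\<^bsub>A\<^esub> t) \<oplus>\<^bsub>A\<^esub> (b \<otimes>\<^bsub>A\<^esub> s)) (s \<otimes>\<^bsub>A\<^esub> t))\<rparr>"

definition integral_over :: "('a, 'm) ring_scheme \<Rightarrow> ('b, 'n) ring_scheme \<Rightarrow> ('a \<Rightarrow> 'b) \<Rightarrow> 'b \<Rightarrow> bool"
  where
  "integral_over D K \<iota> x \<longleftrightarrow>
     (\<exists>(d :: nat) c. (\<forall>i < d. c i \<in> carrier D) \<and>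
        x [^]\<^bsub>K\<^esub> d \<oplus>\<^bsub>K\<^esub> (\<Oplus>\<^bsub>K\<^esub>i\<in>{..<d}. \<iota> (c i) \<otimes>\<^bsub>K\<^esub> x [^]\<^bsub>K\<^esub> i) = \<zero>\<^bsub>K\<^esub>)"

definition integrally_closed_domain :: "('a, 'm) ring_scheme \<Rightarrow> bool" where
  "integrally_closed_domain D \<longleftrightarrow>
     domain D \<and>
     (let S = carrier D - {\<zero>\<^bsub>D\<^esub>}; K = localization D S; \<iota> = (\<lambda>a. loc_frac D S a \<one>\<^bsub>D\<^esub>) in
       \<forall>x \<in> carrier K. integral_over D K \<iota> x \<longrightarrow> x \<in> \<iota> ` carrier D)"

text \<open>\<open>Spec A\<close> is a normal scheme: all its local rings are integrally closed domains.\<close>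

definition normal_ring :: "('a, 'm) ring_scheme \<Rightarrow> bool" where
  "normal_ring A \<longleftrightarrow>
     cring A \<and>
     (\<forall>P. primeideal P A \<longrightarrow> integrally_closed_domain (localization A (carrier A - P)))"


section \<open>The representation of \<open>SL\<^sub>n\<close> on \<open>n\<close> vectors and \<open>n\<close> covectors\<close>

text \<open>
  A point of \<open>V\<close> is a pair \<open>(v, \<xi>)\<close> of \<open>n \<times> n\<close> matrices: the columns of \<open>v\<close> are the vectors and the
  rows of \<open>\<xi>\<close> are the covectors. On \<open>SL\<^sub>n\<close> the adjugate is the inverse, so \<open>SL_act\<close> is
  \<open>g (v, \<xi>) = (g v, \<xi> g\<^sup>-\<^sup>1)\<close>.
\<close>

definition SL_act :: "'a :: comm_ring_1 mat \<Rightarrow> 'a mat \<times> 'a mat \<Rightarrow> 'a mat \<times> 'a mat" where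
  "SL_act g w = (g * fst w, snd w * adj_mat g)"

datatype V_coord = Vect nat nat | Covect nat nat

fun coord :: "'a mat \<times> 'a mat \<Rightarrow> V_coord \<Rightarrow> 'a" where
  "coord (v, \<xi>) (Vect i j) = v $$ (i, j)"
| "coord (v, \<xi>) (Covect i j) = \<xi> $$ (i, j)"

definition V_coords :: "nat \<Rightarrow> V_coord set" where
  "V_coords n = (\<Union>i<n. \<Union>j<n. {Vect i j, Covect i j})"

definition O_V :: "nat \<Rightarrow> (complex, V_coord cpoly) module" where
  "O_V n = mpoly_alg (V_coords n)"

definition SL :: "nat \<Rightarrow> complex mat set" where
  "SL n = {g \<in> carrier_mat n n. det g = 1}"

text \<open>\<open>\<O>(Z) = \<O>(V)\<^sup>G\<close>.\<close>

definition O_Z :: "nat \<Rightarrow> (complex, V_coord cpoly) module" where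
  "O_Z n = (O_V n)\<lparr>carrier := {f \<in> carrier (O_V n).
     \<forall>g \<in> SL n. \<forall>w \<in> carrier_mat n n \<times> carrier_mat n n.
       aeval complex_alg (coord (SL_act g w)) f = aeval complex_alg (coord w) f}\<rparr>"

text \<open>
  \<open>O_GV n\<close> is \<open>\<O>(G \<times> V) = \<O>(V)[g\<^sub>i\<^sub>j]/(det g - 1)\<close>. The maps \<open>act_star\<close> and \<open>proj_star\<close> are the
  comorphisms of the action \<open>G \<times> V \<rightarrow> V\<close> and of the projection \<open>G \<times> V \<rightarrow> V\<close>.
\<close>

datatype GV_coord = Grp nat nat | Rep V_coord

definition GV_coords :: "nat \<Rightarrow> GV_coord set" where
  "GV_coords n = (\<Union>i<n. \<Union>j<n. {Grp i j}) \<union> Rep ` V_coords n"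

definition generic_g :: "nat \<Rightarrow> GV_coord cpoly mat" where
  "generic_g n = mat n n (\<lambda>(i, j). pvar (Grp i j))"

definition generic_w :: "nat \<Rightarrow> GV_coord cpoly mat \<times> GV_coord cpoly mat" where
  "generic_w n = (mat n n (\<lambda>(i, j). pvar (Rep (Vect i j))), mat n n (\<lambda>(i, j). pvar (Rep (Covect i j))))"

definition GV_ideal :: "nat \<Rightarrow> GV_coord cpoly set" where
  "GV_ideal n = Idl\<^bsub>mpoly_alg (GV_coords n)\<^esub> {det (generic_g n) - 1}"

definition O_GV :: "nat \<Rightarrow> (complex, GV_coord cpoly set) module" where
  "O_GV n = quot_alg (mpoly_alg (GV_coords n)) (GV_ideal n)"

definition act_star :: "nat \<Rightarrow> V_coord cpoly \<Rightarrow> GV_coord cpoly set" where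
  "act_star n f = GV_ideal n +>\<^bsub>mpoly_alg (GV_coords n)\<^esub>
     aeval (mpoly_alg (GV_coords n)) (coord (SL_act (generic_g n) (generic_w n))) f"

definition proj_star :: "nat \<Rightarrow> V_coord cpoly \<Rightarrow> GV_coord cpoly set" where
  "proj_star n f = GV_ideal n +>\<^bsub>mpoly_alg (GV_coords n)\<^esub>
     aeval (mpoly_alg (GV_coords n)) (coord (generic_w n)) f"

text \<open>
  The functor of points shows \<open>(G \<times> V)\<^sub>m = G\<^sub>m \<times> V\<^sub>m\<close>, so that the action of \<open>G\<^sub>m\<close> on \<open>V\<^sub>m\<close> obtained by
  functoriality has the comorphism \<open>jet_map m (O_V n) (O_GV n) (act_star n)\<close>. A regular
  function on \<open>V\<^sub>m\<close> is \<open>G\<^sub>m\<close>-invariant if its pullbacks to \<open>G\<^sub>m \<times> V\<^sub>m\<close> along the action and along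
  the projection agree.
\<close>

definition O_Vm_inv :: "enat \<Rightarrow> nat \<Rightarrow> (complex, (nat \<times> V_coord cpoly) cpoly set) module" where
  "O_Vm_inv m n = (jet_alg m (O_V n))\<lparr>carrier := {F \<in> carrier (jet_alg m (O_V n)).
     jet_map m (O_V n) (O_GV n) (act_star n) F = jet_map m (O_V n) (O_GV n) (proj_star n) F}\<rparr>"

definition p_star ::
  "enat \<Rightarrow> nat \<Rightarrow> (nat \<times> V_coord cpoly) cpoly set \<Rightarrow> (nat \<times> V_coord cpoly) cpoly set" where
  "p_star m n = jet_map m (O_Z n) (O_V n) (\<lambda>f. f)"


section \<open>Polynomial and quotient algebras: basic facts\<close>

lemma C_field_simps [simp]:
  "carrier C_field = UNIV" "a \<otimes>\<^bsub>C_field\<^esub> b = a * b" "\<one>\<^bsub>C_field\<^esub> = 1"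
  "\<zero>\<^bsub>C_field\<^esub> = 0" "a \<oplus>\<^bsub>C_field\<^esub> b = a + b"
  by (simp_all add: ring_of_type_algebra_def)

lemma cring_C_field: "cring C_field"
  by (rule cring_from_type_algebra)

lemma mpoly_alg_simps [simp]:
  "p \<otimes>\<^bsub>mpoly_alg I\<^esub> q = p * q" "\<one>\<^bsub>mpoly_alg I\<^esub> = 1" "\<zero>\<^bsub>mpoly_alg I\<^esub> = 0"
  "p \<oplus>\<^bsub>mpoly_alg I\<^esub> q = p + q" "c \<odot>\<^bsub>mpoly_alg I\<^esub> p = pconst c * p"
  by (simp_all add: mpoly_alg_def)

lemma mem_mpoly_alg:
  "p \<in> carrier (mpoly_alg I) \<longleftrightarrow>
     (\<forall>\<mu> \<in> Poly_Mapping.keys p. Poly_Mapping.keys \<mu> \<subseteq> I)"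
  by (simp add: mpoly_alg_def)

lemma pconst_simps [simp]:
  "pconst 0 = 0" "pconst 1 = 1" "pconst (a + b) = pconst a + pconst b"
  "pconst (a * b) = pconst a * pconst b"
  by (simp_all add: pconst_def single_add mult_single)

lemma mpoly_closed [simp, intro]:
  "0 \<in> carrier (mpoly_alg I)" "1 \<in> carrier (mpoly_alg I)" "pconst c \<in> carrier (mpoly_alg I)"
  "p \<in> carrier (mpoly_alg I) \<Longrightarrow> q \<in> carrier (mpoly_alg I) \<Longrightarrow> p + q \<in> carrier (mpoly_alg I)"
  "p \<in> carrier (mpoly_alg I) \<Longrightarrow> q \<in> carrier (mpoly_alg I) \<Longrightarrow> p * q \<in> carrier (mpoly_alg I)"
  "p \<in> carrier (mpoly_alg I) \<Longrightarrow> - p \<in> carrier (mpoly_alg I)"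
proof -
  show "0 \<in> carrier (mpoly_alg I)" "1 \<in> carrier (mpoly_alg I)" "pconst c \<in> carrier (mpoly_alg I)"
    by (auto simp: mem_mpoly_alg pconst_def split: if_splits)
  show "p \<in> carrier (mpoly_alg I) \<Longrightarrow> q \<in> carrier (mpoly_alg I) \<Longrightarrow> p + q \<in> carrier (mpoly_alg I)"
    using Poly_Mapping.keys_add[of p q] unfolding mem_mpoly_alg by blast
  show "p \<in> carrier (mpoly_alg I) \<Longrightarrow> q \<in> carrier (mpoly_alg I) \<Longrightarrow> p * q \<in> carrier (mpoly_alg I)"
  proof -
    assume p: "p \<in> carrier (mpoly_alg I)" and q: "q \<in> carrier (mpoly_alg I)"
    show ?thesis unfolding mem_mpoly_alg
    proof
      fix \<mu> assume "\<mu> \<in> Poly_Mapping.keys (p * q)"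
      from subsetD[OF Poly_Mapping.keys_mult this]
      obtain a b where ab: "a \<in> Poly_Mapping.keys p" "b \<in> Poly_Mapping.keys q" "\<mu> = a + b"
        by (elim CollectE exE conjE)
      have "Poly_Mapping.keys \<mu> \<subseteq> Poly_Mapping.keys a \<union> Poly_Mapping.keys b"
        unfolding ab(3) by (rule Poly_Mapping.keys_add)
      moreover have "Poly_Mapping.keys a \<subseteq> I" "Poly_Mapping.keys b \<subseteq> I"
        using ab(1,2) p q by (simp_all add: mem_mpoly_alg)
      ultimately show "Poly_Mapping.keys \<mu> \<subseteq> I" by (meson Un_least order_trans)
    qed
  qed
  show "p \<in> carrier (mpoly_alg I) \<Longrightarrow> - p \<in> carrier (mpoly_alg I)"
    unfolding mem_mpoly_alg by (simp add: in_keys_iff)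
qed

lemma mpoly_closed_diff [simp, intro]:
  "p \<in> carrier (mpoly_alg I) \<Longrightarrow> q \<in> carrier (mpoly_alg I) \<Longrightarrow> p - q \<in> carrier (mpoly_alg I)"
  using mpoly_closed(4)[of p I "- q"] mpoly_closed(6)[of q I] by simp

lemma mpoly_closed_pvar [simp]: "v \<in> I \<Longrightarrow> pvar v \<in> carrier (mpoly_alg I)"
  by (simp add: mem_mpoly_alg pvar_def)

lemma mpoly_closed_sum:
  "(\<And>i. i \<in> S \<Longrightarrow> f i \<in> carrier (mpoly_alg I)) \<Longrightarrow> sum f S \<in> carrier (mpoly_alg I)"
  by (induction S rule: infinite_finite_induct) auto

lemma cring_mpoly: "cring (mpoly_alg I)"
proof (rule cringI)
  show "abelian_group (mpoly_alg I)"
    by (rule abelian_groupI) (auto simp: add.assoc add.commute intro: bexI[of _ "- _"])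
  show "comm_monoid (mpoly_alg I)"
    by (rule comm_monoidI) (auto simp: mult.assoc mult.commute)
qed (auto simp: algebra_simps)

lemma algebra_mpoly: "C_algebra (mpoly_alg I)"
  by (rule algebraI) (auto simp: cring_C_field cring_mpoly algebra_simps)

lemma mpoly_a_inv [simp]:
  assumes "p \<in> carrier (mpoly_alg I)" shows "\<ominus>\<^bsub>mpoly_alg I\<^esub> p = - p"
proof -
  interpret cring "mpoly_alg I" by (rule cring_mpoly)
  show ?thesis by (rule minus_equality) (simp_all add: assms)
qed

lemma poly_as_sum:
  "(p :: 'v cpoly) = (\<Sum>\<mu>\<in>Poly_Mapping.keys p. Poly_Mapping.single \<mu> (Poly_Mapping.lookup p \<mu>))"
proof (rule poly_mapping_eqI)
  fix \<nu>
  have "(\<Sum>\<mu>\<in>Poly_Mapping.keys p. Poly_Mapping.lookup (Poly_Mapping.single \<mu> (Poly_Mapping.lookup p \<mu>)) \<nu>)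
      = (\<Sum>\<mu>\<in>Poly_Mapping.keys p. if \<mu> = \<nu> then Poly_Mapping.lookup p \<mu> else 0)"
    by (rule sum.cong) (simp_all add: lookup_single when_def)
  also have "\<dots> = Poly_Mapping.lookup p \<nu>"
    by (simp add: in_keys_iff)
  finally show "Poly_Mapping.lookup p \<nu> =
      Poly_Mapping.lookup (\<Sum>\<mu>\<in>Poly_Mapping.keys p. Poly_Mapping.single \<mu> (Poly_Mapping.lookup p \<mu>)) \<nu>"
    by (simp add: lookup_sum)
qed

lemma mpoly_induct [consumes 1, case_names single add]:
  assumes p: "p \<in> carrier (mpoly_alg I)"
    and single: "\<And>\<mu> c. Poly_Mapping.keys \<mu> \<subseteq> I \<Longrightarrow> P (Poly_Mapping.single \<mu> c)"
    and add: "\<And>p q. p \<in> carrier (mpoly_alg I) \<Longrightarrow> q \<in> carrier (mpoly_alg I) \<Longrightarrow> P p \<Longrightarrow> P q \<Longrightarrow> P (p + q)"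
  shows "P p"
proof -
  let ?f = "\<lambda>\<mu>. Poly_Mapping.single \<mu> (Poly_Mapping.lookup p \<mu>)"
  have main: "finite S \<Longrightarrow> S \<subseteq> Poly_Mapping.keys p \<Longrightarrow> sum ?f S \<in> carrier (mpoly_alg I) \<and> P (sum ?f S)" for S
  proof (induction S rule: finite_induct)
    case empty
    then show ?case using single[of 0 0] by simp
  next
    case (insert \<mu> S)
    have k: "Poly_Mapping.keys \<mu> \<subseteq> I" using p insert unfolding mem_mpoly_alg by blast
    then have f: "?f \<mu> \<in> carrier (mpoly_alg I)" by (simp add: mem_mpoly_alg)
    have IH: "sum ?f S \<in> carrier (mpoly_alg I)" "P (sum ?f S)"
      using insert.IH insert.prems by simp_all
    have e: "sum ?f (insert \<mu> S) = ?f \<mu> + sum ?f S" using insert by (simp del: single_add)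
    show ?case unfolding e using mpoly_closed(4)[OF f IH(1)] add[OF f IH(1) single[OF k] IH(2)] by blast
  qed
  have "P (sum ?f (Poly_Mapping.keys p))"
    using main[OF finite_keys subset_refl] by (rule conjunct2)
  then show ?thesis by (subst poly_as_sum)
qed

lemma alg_homD:
  assumes "h \<in> alg_hom A B"
  shows "h \<in> ring_hom A B" "x \<in> carrier A \<Longrightarrow> h (c \<odot>\<^bsub>A\<^esub> x) = c \<odot>\<^bsub>B\<^esub> h x"
  using assms by (auto simp: alg_hom_def)

context
  fixes B :: "(complex, 'b, 'm) module_scheme" (structure) and I :: "'v set" and \<phi> :: "'v \<Rightarrow> 'b"
  assumes B: "C_algebra B" and \<phi>: "\<phi> \<in> I \<rightarrow> carrier B"
begin

interpretation algebra C_field B by (rule B)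

definition mono_val :: "('v \<Rightarrow>\<^sub>0 nat) \<Rightarrow> 'b" where
  "mono_val \<mu> = (\<Otimes>v \<in> Poly_Mapping.keys \<mu>. \<phi> v [^] Poly_Mapping.lookup \<mu> v)"

lemma smult_0: "x \<in> carrier B \<Longrightarrow> 0 \<odot> x = \<zero>"
  using smult_l_null by simp

lemma smult_1: "x \<in> carrier B \<Longrightarrow> 1 \<odot> x = x"
  using smult_one by simp

lemma phi_closed: "v \<in> I \<Longrightarrow> \<phi> v \<in> carrier B"
  using \<phi> by blast

lemma mono_val_superset:
  assumes "finite S" "Poly_Mapping.keys \<mu> \<subseteq> S" "S \<subseteq> I"
  shows "mono_val \<mu> = (\<Otimes>v \<in> S. \<phi> v [^] Poly_Mapping.lookup \<mu> v)"
  unfolding mono_val_def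
  by (rule finprod_mono_neutral_cong_left) (use assms \<phi> in \<open>auto simp: in_keys_iff\<close>)

lemma mono_val_closed [simp]: "Poly_Mapping.keys \<mu> \<subseteq> I \<Longrightarrow> mono_val \<mu> \<in> carrier B"
  unfolding mono_val_def using \<phi> by (intro finprod_closed) auto

lemma mono_val_0: "mono_val 0 = \<one>"
  by (simp add: mono_val_def)

lemma mono_val_add:
  assumes "Poly_Mapping.keys \<mu> \<subseteq> I" "Poly_Mapping.keys \<nu> \<subseteq> I"
  shows "mono_val (\<mu> + \<nu>) = mono_val \<mu> \<otimes> mono_val \<nu>"
proof -
  let ?S = "Poly_Mapping.keys \<mu> \<union> Poly_Mapping.keys \<nu>"
  have S: "?S \<subseteq> I" using assms by auto
  have "mono_val (\<mu> + \<nu>) = (\<Otimes>v \<in> ?S. \<phi> v [^] Poly_Mapping.lookup (\<mu> + \<nu>) v)"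
    by (rule mono_val_superset) (use S Poly_Mapping.keys_add[of \<mu> \<nu>] in auto)
  also have "\<dots> = (\<Otimes>v \<in> ?S. \<phi> v [^] Poly_Mapping.lookup \<mu> v \<otimes> \<phi> v [^] Poly_Mapping.lookup \<nu> v)"
  proof (rule finprod_cong')
    show "(\<lambda>v. \<phi> v [^] Poly_Mapping.lookup \<mu> v \<otimes> \<phi> v [^] Poly_Mapping.lookup \<nu> v) \<in> ?S \<rightarrow> carrier B"
      using S phi_closed by auto
    fix v assume "v \<in> ?S"
    then have "\<phi> v \<in> carrier B" using S phi_closed by blast
    then show "\<phi> v [^] Poly_Mapping.lookup (\<mu> + \<nu>) v =
        \<phi> v [^] Poly_Mapping.lookup \<mu> v \<otimes> \<phi> v [^] Poly_Mapping.lookup \<nu> v"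
      by (simp add: lookup_add nat_pow_mult)
  qed simp
  also have "\<dots> = (\<Otimes>v \<in> ?S. \<phi> v [^] Poly_Mapping.lookup \<mu> v) \<otimes> (\<Otimes>v \<in> ?S. \<phi> v [^] Poly_Mapping.lookup \<nu> v)"
    by (rule finprod_multf) (use S phi_closed in auto)
  also have "\<dots> = mono_val \<mu> \<otimes> mono_val \<nu>"
    using mono_val_superset[of ?S \<mu>] mono_val_superset[of ?S \<nu>] S by simp
  finally show ?thesis .
qed

lemma aeval_superset:
  assumes "finite S" "Poly_Mapping.keys p \<subseteq> S" "\<And>\<mu>. \<mu> \<in> S \<Longrightarrow> Poly_Mapping.keys \<mu> \<subseteq> I"
  shows "aeval B \<phi> p = (\<Oplus>\<mu> \<in> S. Poly_Mapping.lookup p \<mu> \<odot> mono_val \<mu>)"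
  unfolding aeval_def mono_val_def[symmetric]
  by (rule add.finprod_mono_neutral_cong_left) (use assms in \<open>auto simp: in_keys_iff smult_0\<close>)

lemma aeval_single:
  assumes "Poly_Mapping.keys \<mu> \<subseteq> I"
  shows "aeval B \<phi> (Poly_Mapping.single \<mu> c) = c \<odot> mono_val \<mu>"
  using aeval_superset[of "{\<mu>}" "Poly_Mapping.single \<mu> c"] assms by (simp add: smult_0 split: if_splits)

lemma aeval_closed [simp]: "p \<in> carrier (mpoly_alg I) \<Longrightarrow> aeval B \<phi> p \<in> carrier B"
  using aeval_superset[of "Poly_Mapping.keys p" p]
  by (auto simp: mem_mpoly_alg intro!: finsum_closed)

lemma aeval_add:
  assumes "p \<in> carrier (mpoly_alg I)" "q \<in> carrier (mpoly_alg I)"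
  shows "aeval B \<phi> (p + q) = aeval B \<phi> p \<oplus> aeval B \<phi> q"
proof -
  let ?S = "Poly_Mapping.keys p \<union> Poly_Mapping.keys q"
  have S: "finite ?S" "\<And>\<mu>. \<mu> \<in> ?S \<Longrightarrow> Poly_Mapping.keys \<mu> \<subseteq> I"
    using assms by (auto simp: mem_mpoly_alg)
  have "aeval B \<phi> (p + q) = (\<Oplus>\<mu> \<in> ?S. Poly_Mapping.lookup (p + q) \<mu> \<odot> mono_val \<mu>)"
    by (rule aeval_superset) (use S Poly_Mapping.keys_add[of p q] in auto)
  also have "\<dots> = (\<Oplus>\<mu> \<in> ?S. Poly_Mapping.lookup p \<mu> \<odot> mono_val \<mu> \<oplus> Poly_Mapping.lookup q \<mu> \<odot> mono_val \<mu>)"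
  proof (rule add.finprod_cong')
    fix \<mu> assume "\<mu> \<in> ?S"
    then have "mono_val \<mu> \<in> carrier B" using S by simp
    then show "Poly_Mapping.lookup (p + q) \<mu> \<odot> mono_val \<mu> =
        Poly_Mapping.lookup p \<mu> \<odot> mono_val \<mu> \<oplus> Poly_Mapping.lookup q \<mu> \<odot> mono_val \<mu>"
      using smult_l_distr[of "Poly_Mapping.lookup p \<mu>" "Poly_Mapping.lookup q \<mu>" "mono_val \<mu>"]
      by (simp add: lookup_add)
  qed (use S in auto)
  also have "\<dots> = (\<Oplus>\<mu> \<in> ?S. Poly_Mapping.lookup p \<mu> \<odot> mono_val \<mu>) \<oplus> (\<Oplus>\<mu> \<in> ?S. Poly_Mapping.lookup q \<mu> \<odot> mono_val \<mu>)"
    by (rule add.finprod_multf) (use S in auto)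
  also have "\<dots> = aeval B \<phi> p \<oplus> aeval B \<phi> q"
    using aeval_superset[of ?S p] aeval_superset[of ?S q] S by simp
  finally show ?thesis .
qed

lemma aeval_mult:
  assumes "p \<in> carrier (mpoly_alg I)" "q \<in> carrier (mpoly_alg I)"
  shows "aeval B \<phi> (p * q) = aeval B \<phi> p \<otimes> aeval B \<phi> q"
  using assms(1)
proof (induction p rule: mpoly_induct)
  case (single \<mu> c)
  have s: "Poly_Mapping.single \<mu> c \<in> carrier (mpoly_alg I)" using single by (simp add: mem_mpoly_alg)
  from assms(2) show ?case
  proof (induction q rule: mpoly_induct)
    case (single \<nu> d)
    have "Poly_Mapping.keys (\<mu> + \<nu>) \<subseteq> I"
      using Poly_Mapping.keys_add[of \<mu> \<nu>] single \<open>Poly_Mapping.keys \<mu> \<subseteq> I\<close> by blast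
    then have "aeval B \<phi> (Poly_Mapping.single \<mu> c * Poly_Mapping.single \<nu> d) = (c * d) \<odot> (mono_val \<mu> \<otimes> mono_val \<nu>)"
      using single \<open>Poly_Mapping.keys \<mu> \<subseteq> I\<close> by (simp add: mult_single aeval_single mono_val_add)
    also have "\<dots> = c \<odot> (d \<odot> (mono_val \<mu> \<otimes> mono_val \<nu>))"
      using smult_assoc1[of c d "mono_val \<mu> \<otimes> mono_val \<nu>"] single \<open>Poly_Mapping.keys \<mu> \<subseteq> I\<close> by simp
    also have "\<dots> = (c \<odot> mono_val \<mu>) \<otimes> (d \<odot> mono_val \<nu>)"
      using single \<open>Poly_Mapping.keys \<mu> \<subseteq> I\<close> by (simp add: smult_assoc2 m_comm[of "mono_val \<mu>"])
    finally show ?case using single \<open>Poly_Mapping.keys \<mu> \<subseteq> I\<close> by (simp add: aeval_single)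
  next
    case (add p q)
    then show ?case using s by (simp add: distrib_left aeval_add r_distr)
  qed
next
  case (add p p')
  then show ?case using assms(2) by (simp add: distrib_right aeval_add l_distr)
qed

lemma aeval_pconst: "aeval B \<phi> (pconst c) = c \<odot> \<one>"
  by (simp add: pconst_def aeval_single mono_val_0)

lemma aeval_pvar: "v \<in> I \<Longrightarrow> aeval B \<phi> (pvar v) = \<phi> v"
  using \<phi> by (auto simp: pvar_def aeval_single mono_val_def Pi_iff finprod_insert smult_1)

lemma aeval_alg_hom: "aeval B \<phi> \<in> alg_hom (mpoly_alg I) B"
proof -
  have "aeval B \<phi> 1 = \<one>" using aeval_pconst[of 1] by (simp add: smult_1)
  moreover have "aeval B \<phi> (pconst c * p) = c \<odot> aeval B \<phi> p" if "p \<in> carrier (mpoly_alg I)" for c p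
    using that by (simp add: aeval_mult aeval_pconst smult_assoc2)
  ultimately show ?thesis
    unfolding alg_hom_def by (auto intro!: ring_hom_memI simp: aeval_add aeval_mult)
qed

lemma alg_hom_mpoly_unique:
  assumes f: "f \<in> alg_hom (mpoly_alg I) B" and v: "\<And>v. v \<in> I \<Longrightarrow> f (pvar v) = \<phi> v"
    and p: "p \<in> carrier (mpoly_alg I)"
  shows "f p = aeval B \<phi> p"
proof -
  interpret P: cring "mpoly_alg I" by (rule cring_mpoly)
  interpret f: ring_hom_ring "mpoly_alg I" B f
    by (rule ring_hom_ringI2) (use f in \<open>auto simp: alg_hom_def P.ring_axioms cring.axioms(1)[OF M_cring]\<close>)
  have fc: "f (pconst c * q) = c \<odot> f q" if "q \<in> carrier (mpoly_alg I)" for c q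
    using alg_homD(2)[OF f that] by simp
  have 1: "f (Poly_Mapping.single \<mu> 1) = mono_val \<mu>" if "Poly_Mapping.keys \<mu> \<subseteq> I" for \<mu>
    using that
  proof (induction "\<Sum>v\<in>Poly_Mapping.keys \<mu>. Poly_Mapping.lookup \<mu> v" arbitrary: \<mu> rule: less_induct)
    case less
    show ?case
    proof (cases "Poly_Mapping.keys \<mu> = {}")
      case True
      then have "\<mu> = 0" by simp
      then show ?thesis using f.hom_one by (simp add: mono_val_0)
    next
      case False
      then obtain v where v': "v \<in> Poly_Mapping.keys \<mu>" by (meson ex_in_conv)
      define \<nu> where "\<nu> = \<mu> - Poly_Mapping.single v 1"
      have \<mu>: "\<mu> = Poly_Mapping.single v 1 + \<nu>"
        using v' unfolding \<nu>_def
        by (intro poly_mapping_eqI) (auto simp: lookup_add lookup_minus lookup_single when_def in_keys_iff)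
      have lk: "Poly_Mapping.lookup \<mu> w = (if w = v then 1 else 0) + Poly_Mapping.lookup \<nu> w" for w
        by (subst \<mu>) (simp add: lookup_add lookup_single when_def)
      have k: "Poly_Mapping.keys \<nu> \<subseteq> Poly_Mapping.keys \<mu>"
        by (auto simp: in_keys_iff lk)
      have "(\<Sum>v\<in>Poly_Mapping.keys \<nu>. Poly_Mapping.lookup \<nu> v) = (\<Sum>v\<in>Poly_Mapping.keys \<mu>. Poly_Mapping.lookup \<nu> v)"
        by (rule sum.mono_neutral_left) (use k in \<open>auto simp: in_keys_iff\<close>)
      also have "\<dots> < (\<Sum>v\<in>Poly_Mapping.keys \<mu>. Poly_Mapping.lookup \<mu> v)"
      proof (rule sum_strict_mono_ex1)
        show "\<exists>a\<in>Poly_Mapping.keys \<mu>. Poly_Mapping.lookup \<nu> a < Poly_Mapping.lookup \<mu> a"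
          by (rule bexI[OF _ v']) (simp add: lk)
        show "\<forall>x\<in>Poly_Mapping.keys \<mu>. Poly_Mapping.lookup \<nu> x \<le> Poly_Mapping.lookup \<mu> x"
          by (simp add: lk)
      qed simp
      finally have IH: "f (Poly_Mapping.single \<nu> 1) = mono_val \<nu>"
        using less k by blast
      have vI: "v \<in> I" using v' less by auto
      have kI: "Poly_Mapping.keys \<nu> \<subseteq> I" using k less by auto
      have "Poly_Mapping.single \<mu> 1 = pvar v * (Poly_Mapping.single \<nu> 1 :: 'v cpoly)"
        using arg_cong[OF \<mu>, of "\<lambda>\<mu>. Poly_Mapping.single \<mu> (1 :: complex)"] by (simp add: pvar_def mult_single)
      also have "f \<dots> = f (pvar v) \<otimes> f (Poly_Mapping.single \<nu> 1)"
      proof -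
        have "pvar v \<in> carrier (mpoly_alg I)" "Poly_Mapping.single \<nu> 1 \<in> carrier (mpoly_alg I)"
          using vI kI by (simp_all add: mem_mpoly_alg pvar_def)
        from f.hom_mult[OF this] show ?thesis by simp
      qed
      also have "\<dots> = mono_val (Poly_Mapping.single v 1) \<otimes> mono_val \<nu>"
        using v[OF vI] IH phi_closed[OF vI] by (simp add: mono_val_def[of "Poly_Mapping.single v (Suc 0)"] finprod_insert)
      also have "\<dots> = mono_val \<mu>"
        using mono_val_add[of "Poly_Mapping.single v 1" \<nu>] vI kI \<mu> by simp
      finally show ?thesis .
    qed
  qed
  from p show ?thesis
  proof (induction p rule: mpoly_induct)
    case (single \<mu> c)
    have "Poly_Mapping.single \<mu> c = pconst c * (Poly_Mapping.single \<mu> 1 :: 'v cpoly)"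
      by (simp add: pconst_def mult_single)
    then have "f (Poly_Mapping.single \<mu> c) = c \<odot> mono_val \<mu>"
      using fc[of "Poly_Mapping.single \<mu> 1" c] 1 single by (simp add: mem_mpoly_alg)
    then show ?case using single by (simp add: aeval_single)
  next
    case (add p q)
    then show ?case using f.hom_add[of p q] by (simp add: aeval_add)
  qed
qed

end

lemma ring_hom_cringI2:
  "cring R \<Longrightarrow> cring S \<Longrightarrow> h \<in> ring_hom R S \<Longrightarrow> ring_hom_cring R S h"
  by (simp add: ring_hom_cring_def ring_hom_cring_axioms_def)

lemma quot_alg_simps:
  "carrier (quot_alg A I) = carrier (A Quot I)" "x \<otimes>\<^bsub>quot_alg A I\<^esub> y = x \<otimes>\<^bsub>A Quot I\<^esub> y"
  "\<one>\<^bsub>quot_alg A I\<^esub> = \<one>\<^bsub>A Quot I\<^esub>" "\<zero>\<^bsub>quot_alg A I\<^esub> = \<zero>\<^bsub>A Quot I\<^esub>"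
  "x \<oplus>\<^bsub>quot_alg A I\<^esub> y = x \<oplus>\<^bsub>A Quot I\<^esub> y"
  by (simp_all add: quot_alg_def)

context
  fixes A :: "(complex, 'a, 'm) module_scheme" (structure) and I :: "'a set"
  assumes A: "C_algebra A" and I: "ideal I A"
begin

interpretation algebra C_field A by (rule A)
interpretation I: ideal I A by (rule I)

lemma coset_hom: "(+>) I \<in> ring_hom A (A Quot I)"
  by (rule I.rcos_ring_hom)

lemma quot_alg_elem:
  "U \<in> carrier (quot_alg A I) \<longleftrightarrow> (\<exists>a \<in> carrier A. U = I +> a)"
  by (auto simp: quot_alg_simps FactRing_def A_RCOSETS_def')

lemma quot_alg_coset [simp]:
  assumes "a \<in> carrier A" "b \<in> carrier A"
  shows "I +> a \<in> carrier (quot_alg A I)"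
    "(I +> a) \<otimes>\<^bsub>quot_alg A I\<^esub> (I +> b) = I +> (a \<otimes> b)"
    "(I +> a) \<oplus>\<^bsub>quot_alg A I\<^esub> (I +> b) = I +> (a \<oplus> b)"
    "c \<odot>\<^bsub>quot_alg A I\<^esub> (I +> a) = I +> (c \<odot> a)"
proof -
  show "I +> a \<in> carrier (quot_alg A I)" using assms quot_alg_elem by blast
  show "(I +> a) \<otimes>\<^bsub>quot_alg A I\<^esub> (I +> b) = I +> (a \<otimes> b)"
    "(I +> a) \<oplus>\<^bsub>quot_alg A I\<^esub> (I +> b) = I +> (a \<oplus> b)"
    using ring_hom_mult[OF coset_hom] ring_hom_add[OF coset_hom] assms by (simp_all add: quot_alg_simps)
  have "c \<odot>\<^bsub>quot_alg A I\<^esub> (I +> a) = (I +> (c \<odot> \<one>)) \<otimes>\<^bsub>A Quot I\<^esub> (I +> a)"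
    by (simp add: quot_alg_def)
  also have "\<dots> = I +> ((c \<odot> \<one>) \<otimes> a)"
    using ring_hom_mult[OF coset_hom, of "c \<odot> \<one>" a] assms by simp
  also have "(c \<odot> \<one>) \<otimes> a = c \<odot> a"
    using assms by (simp add: smult_assoc2)
  finally show "c \<odot>\<^bsub>quot_alg A I\<^esub> (I +> a) = I +> (c \<odot> a)" .
qed

lemma quot_alg_one: "\<one>\<^bsub>quot_alg A I\<^esub> = I +> \<one>"
  using ring_hom_one[OF coset_hom] by (simp add: quot_alg_simps)

lemma quot_alg_zero: "\<zero>\<^bsub>quot_alg A I\<^esub> = I +> \<zero>"
proof -
  have "i \<oplus> \<zero> = i" if "i \<in> I" for i using that I.a_subset by (meson r_zero subsetD)
  then have "I +> \<zero> = I" unfolding a_r_coset_def' by auto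
  then show ?thesis by (simp add: quot_alg_simps FactRing_def)
qed

lemma cring_quot_alg: "cring (quot_alg A I)"
proof (rule cringI)
  interpret Q: cring "A Quot I" by (rule I.quotient_is_cring) (rule M_cring)
  show "abelian_group (quot_alg A I)"
  proof (rule abelian_groupI)
    fix x assume "x \<in> carrier (quot_alg A I)"
    then show "\<exists>y \<in> carrier (quot_alg A I). y \<oplus>\<^bsub>quot_alg A I\<^esub> x = \<zero>\<^bsub>quot_alg A I\<^esub>"
      by (intro bexI[of _ "\<ominus>\<^bsub>A Quot I\<^esub> x"]) (simp_all add: quot_alg_simps Q.l_neg)
  qed (simp_all add: quot_alg_simps Q.a_ac)
  show "comm_monoid (quot_alg A I)"
    by (rule comm_monoidI) (simp_all add: quot_alg_simps Q.m_ac)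
qed (auto simp: quot_alg_simps cring.cring_simprules(13)[OF I.quotient_is_cring[OF M_cring]])

lemma algebra_quot_alg: "C_algebra (quot_alg A I)"
proof (rule algebraI)
  show "\<And>a x. a \<in> carrier C_field \<Longrightarrow> x \<in> carrier (quot_alg A I) \<Longrightarrow> a \<odot>\<^bsub>quot_alg A I\<^esub> x \<in> carrier (quot_alg A I)"
    by (auto simp: quot_alg_elem)
  show "(a \<oplus>\<^bsub>C_field\<^esub> b) \<odot>\<^bsub>quot_alg A I\<^esub> x = a \<odot>\<^bsub>quot_alg A I\<^esub> x \<oplus>\<^bsub>quot_alg A I\<^esub> b \<odot>\<^bsub>quot_alg A I\<^esub> x"
    if "a \<in> carrier C_field" "b \<in> carrier C_field" "x \<in> carrier (quot_alg A I)" for a b x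
    using that smult_l_distr[of a b] by (auto simp: quot_alg_elem)
  show "a \<odot>\<^bsub>quot_alg A I\<^esub> (x \<oplus>\<^bsub>quot_alg A I\<^esub> y) = a \<odot>\<^bsub>quot_alg A I\<^esub> x \<oplus>\<^bsub>quot_alg A I\<^esub> a \<odot>\<^bsub>quot_alg A I\<^esub> y"
    if "a \<in> carrier C_field" "x \<in> carrier (quot_alg A I)" "y \<in> carrier (quot_alg A I)" for a x y
    using that smult_r_distr[of a] by (auto simp: quot_alg_elem)
  show "a \<otimes>\<^bsub>C_field\<^esub> b \<odot>\<^bsub>quot_alg A I\<^esub> x = a \<odot>\<^bsub>quot_alg A I\<^esub> (b \<odot>\<^bsub>quot_alg A I\<^esub> x)"
    if "a \<in> carrier C_field" "b \<in> carrier C_field" "x \<in> carrier (quot_alg A I)" for a b x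
    using that smult_assoc1[of a b] by (auto simp: quot_alg_elem)
  show "\<one>\<^bsub>C_field\<^esub> \<odot>\<^bsub>quot_alg A I\<^esub> x = x" if "x \<in> carrier (quot_alg A I)" for x
    using that smult_one by (auto simp: quot_alg_elem)
  show "a \<odot>\<^bsub>quot_alg A I\<^esub> x \<otimes>\<^bsub>quot_alg A I\<^esub> y = a \<odot>\<^bsub>quot_alg A I\<^esub> (x \<otimes>\<^bsub>quot_alg A I\<^esub> y)"
    if "a \<in> carrier C_field" "x \<in> carrier (quot_alg A I)" "y \<in> carrier (quot_alg A I)" for a x y
    using that smult_assoc2[of a] by (auto simp: quot_alg_elem)
qed (rule cring_C_field cring_quot_alg)+

lemma coset_alg_hom: "(+>) I \<in> alg_hom A (quot_alg A I)"
  unfolding alg_hom_def by (auto intro!: ring_hom_memI simp: quot_alg_one)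

lemma coset_eqI:
  assumes "a \<in> carrier A" "b \<in> carrier A" "a \<ominus> b \<in> I" shows "I +> a = I +> b"
  using quotient_eq_iff_same_a_r_cos[OF I assms(1,2)] assms(3) by blast

context
  fixes B :: "(complex, 'b, 'n) module_scheme" and f :: "'a \<Rightarrow> 'b"
  assumes B: "C_algebra B" and f: "f \<in> alg_hom A B" and kill: "\<And>x. x \<in> I \<Longrightarrow> f x = \<zero>\<^bsub>B\<^esub>"
begin

interpretation B: algebra C_field B by (rule B)

lemma image_coset:
  assumes a: "a \<in> carrier A" shows "f ` (I +> a) = {f a}"
proof -
  have "f (i \<oplus> a) = f a" if "i \<in> I" for i
  proof -
    have i: "i \<in> carrier A" using that I.a_subset by blast
    have fa: "f a \<in> carrier B" using ring_hom_closed[OF alg_homD(1)[OF f] a] .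
    show ?thesis using ring_hom_add[OF alg_homD(1)[OF f] i a] kill[OF that] fa
      by (simp add: B.M.l_zero)
  qed
  moreover have "f ` (I +> a) = (\<lambda>i. f (i \<oplus> a)) ` I" unfolding a_r_coset_def' by auto
  ultimately have "f ` (I +> a) = (\<lambda>_. f a) ` I" by (simp cong: image_cong)
  moreover have "\<zero> \<in> I" by (rule additive_subgroup.zero_closed[OF ideal.axioms(1)[OF I]])
  then have "(\<lambda>_. f a) ` I = {f a}" by (rule image_constant)
  ultimately show ?thesis by (rule trans)
qed

lemma the_elem_coset: "a \<in> carrier A \<Longrightarrow> the_elem (f ` (I +> a)) = f a"
  by (simp add: image_coset)

lemma lift_alg_hom: "(\<lambda>U. the_elem (f ` U)) \<in> alg_hom (quot_alg A I) B"
  unfolding alg_hom_def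
proof (intro CollectI conjI allI ballI ring_hom_memI)
  note fh = alg_homD(1)[OF f]
  fix U W c
  assume "U \<in> carrier (quot_alg A I)"
  then obtain a where a: "a \<in> carrier A" "U = I +> a" unfolding quot_alg_elem by blast
  show "the_elem (f ` U) \<in> carrier B"
    using a ring_hom_closed[OF fh] by (simp add: the_elem_coset)
  show "the_elem (f ` (c \<odot>\<^bsub>quot_alg A I\<^esub> U)) = c \<odot>\<^bsub>B\<^esub> the_elem (f ` U)"
    using a alg_homD(2)[OF f] by (simp add: the_elem_coset)
  assume "W \<in> carrier (quot_alg A I)"
  then obtain b where b: "b \<in> carrier A" "W = I +> b" unfolding quot_alg_elem by blast
  show "the_elem (f ` (U \<otimes>\<^bsub>quot_alg A I\<^esub> W)) = the_elem (f ` U) \<otimes>\<^bsub>B\<^esub> the_elem (f ` W)"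
    using a b ring_hom_mult[OF fh] by (simp add: the_elem_coset)
  show "the_elem (f ` (U \<oplus>\<^bsub>quot_alg A I\<^esub> W)) = the_elem (f ` U) \<oplus>\<^bsub>B\<^esub> the_elem (f ` W)"
    using a b ring_hom_add[OF fh] by (simp add: the_elem_coset)
next
  show "the_elem (f ` \<one>\<^bsub>quot_alg A I\<^esub>) = \<one>\<^bsub>B\<^esub>"
    using ring_hom_one[OF alg_homD(1)[OF f]] by (simp add: the_elem_coset quot_alg_one)
qed

end

end

lemma alg_hom_comp:
  "f \<in> alg_hom A B \<Longrightarrow> g \<in> alg_hom B C \<Longrightarrow> (\<lambda>x. g (f x)) \<in> alg_hom A C"
  unfolding alg_hom_def
  using ring_hom_trans[of f A B g C] by (auto simp: comp_def dest: ring_hom_closed)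


section \<open>The universal property of jet algebras\<close>

lemma jet_rels_subset:
  assumes A: "C_algebra A" shows "jet_rels m A \<subseteq> carrier (mpoly_alg (jet_vars m A))"
proof -
  interpret algebra C_field A by (rule A)
  have v: "pvar (i, a) \<in> carrier (mpoly_alg (jet_vars m A))" if "enat k \<le> m" "i \<le> k" "a \<in> carrier A" for i k a
    using that order_trans[of "enat i" "enat k" m] by (auto intro!: mpoly_closed_pvar simp: jet_vars_def)
  show ?thesis
    unfolding jet_rels_def
    by (auto intro!: mpoly_closed mpoly_closed_diff mpoly_closed_sum smult_closed intro: v)
qed

lemma jet_relsI:
  assumes "enat k \<le> m"
  shows "a \<in> carrier A \<Longrightarrow> b \<in> carrier A \<Longrightarrow>
      pvar (k, a \<oplus>\<^bsub>A\<^esub> b) - (pvar (k, a) + pvar (k, b)) \<in> jet_rels m A"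
    and "a \<in> carrier A \<Longrightarrow> b \<in> carrier A \<Longrightarrow>
      pvar (k, a \<otimes>\<^bsub>A\<^esub> b) - (\<Sum>i\<le>k. pvar (i, a) * pvar (k - i, b)) \<in> jet_rels m A"
    and "a \<in> carrier A \<Longrightarrow> pvar (k, c \<odot>\<^bsub>A\<^esub> a) - pconst c * pvar (k, a) \<in> jet_rels m A"
    and "pvar (k, \<one>\<^bsub>A\<^esub>) - (if k = 0 then 1 else 0) \<in> jet_rels m A"
  unfolding jet_rels_def using assms by blast+

lemma jet_ideal: "C_algebra A \<Longrightarrow> ideal (jet_ideal m A) (mpoly_alg (jet_vars m A))"
  unfolding jet_ideal_def
  by (rule ring.genideal_ideal[OF cring.axioms(1)[OF cring_mpoly] jet_rels_subset])

lemma algebra_jet: "C_algebra A \<Longrightarrow> C_algebra (jet_alg m A)"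
  unfolding jet_alg_def by (rule algebra_quot_alg[OF algebra_mpoly jet_ideal])

definition arc :: "enat \<Rightarrow> (complex, 'b, 'n) module_scheme \<Rightarrow> (nat \<Rightarrow> 'a \<Rightarrow> 'b) \<Rightarrow> 'a \<Rightarrow> nat \<Rightarrow> 'b" where
  "arc m B \<delta> a k = (if enat k \<le> m then \<delta> k a else \<zero>\<^bsub>B\<^esub>)"

lemma arc_hom_iff:
  assumes A: "C_algebra A" and B: "C_algebra B"
  shows "arc m B \<delta> \<in> alg_hom A (trunc_alg m B) \<longleftrightarrow>
    (\<forall>k. enat k \<le> m \<longrightarrow>
       (\<forall>a \<in> carrier A. \<delta> k a \<in> carrier B) \<and>
       (\<forall>a \<in> carrier A. \<forall>b \<in> carrier A. \<delta> k (a \<oplus>\<^bsub>A\<^esub> b) = \<delta> k a \<oplus>\<^bsub>B\<^esub> \<delta> k b) \<and>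
       (\<forall>a \<in> carrier A. \<forall>b \<in> carrier A. \<delta> k (a \<otimes>\<^bsub>A\<^esub> b) = (\<Oplus>\<^bsub>B\<^esub>i\<in>{..k}. \<delta> i a \<otimes>\<^bsub>B\<^esub> \<delta> (k - i) b)) \<and>
       (\<forall>c. \<forall>a \<in> carrier A. \<delta> k (c \<odot>\<^bsub>A\<^esub> a) = c \<odot>\<^bsub>B\<^esub> \<delta> k a) \<and>
       \<delta> k \<one>\<^bsub>A\<^esub> = (if k = 0 then \<one>\<^bsub>B\<^esub> else \<zero>\<^bsub>B\<^esub>))" (is "?L \<longleftrightarrow> ?R")
proof -
  interpret A: algebra C_field A by (rule A)
  interpret B: algebra C_field B by (rule B)
  have le: "enat i \<le> m" if "enat k \<le> m" "i \<le> k" for i k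
    using that order_trans[of "enat i" "enat k" m] by simp
  have sum: "(\<Oplus>\<^bsub>B\<^esub>i\<in>{..k}. arc m B \<delta> a i \<otimes>\<^bsub>B\<^esub> arc m B \<delta> b (k - i)) = (\<Oplus>\<^bsub>B\<^esub>i\<in>{..k}. \<delta> i a \<otimes>\<^bsub>B\<^esub> \<delta> (k - i) b)"
    if "enat k \<le> m" "\<forall>k. enat k \<le> m \<longrightarrow> (\<forall>a \<in> carrier A. \<delta> k a \<in> carrier B)" "a \<in> carrier A" "b \<in> carrier A"
    for k a b
  proof (rule B.add.finprod_cong')
    show "(\<lambda>i. \<delta> i a \<otimes>\<^bsub>B\<^esub> \<delta> (k - i) b) \<in> {..k} \<rightarrow> carrier B"
      using that le[OF that(1)] by auto
    show "arc m B \<delta> a i \<otimes>\<^bsub>B\<^esub> arc m B \<delta> b (k - i) = \<delta> i a \<otimes>\<^bsub>B\<^esub> \<delta> (k - i) b" if "i \<in> {..k}" for i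
      using that le[OF \<open>enat k \<le> m\<close>] by (simp add: arc_def)
  qed simp
  show ?thesis
  proof
    assume L: ?L
    note h = alg_homD(1)[OF L]
    have cl: "\<delta> k a \<in> carrier B" if "enat k \<le> m" "a \<in> carrier A" for k a
      using ring_hom_closed[OF h that(2)] that(1) by (auto simp: trunc_alg_def arc_def dest: spec[of _ k])
    show ?R
    proof (intro allI impI conjI ballI)
      fix k a b c assume k: "enat k \<le> m"
      show "\<delta> k \<one>\<^bsub>A\<^esub> = (if k = 0 then \<one>\<^bsub>B\<^esub> else \<zero>\<^bsub>B\<^esub>)"
        using fun_cong[OF ring_hom_one[OF h], of k] k by (simp add: trunc_alg_def arc_def)
      assume a: "a \<in> carrier A"
      show "\<delta> k a \<in> carrier B" by (rule cl[OF k a])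
      show "\<delta> k (c \<odot>\<^bsub>A\<^esub> a) = c \<odot>\<^bsub>B\<^esub> \<delta> k a"
        using fun_cong[OF alg_homD(2)[OF L a, of c], of k] k by (simp add: trunc_alg_def arc_def)
      assume b: "b \<in> carrier A"
      show "\<delta> k (a \<oplus>\<^bsub>A\<^esub> b) = \<delta> k a \<oplus>\<^bsub>B\<^esub> \<delta> k b"
        using fun_cong[OF ring_hom_add[OF h a b], of k] k by (simp add: trunc_alg_def arc_def)
      have "arc m B \<delta> (a \<otimes>\<^bsub>A\<^esub> b) k = (\<Oplus>\<^bsub>B\<^esub>i\<in>{..k}. arc m B \<delta> a i \<otimes>\<^bsub>B\<^esub> arc m B \<delta> b (k - i))"
        using fun_cong[OF ring_hom_mult[OF h a b], of k] k by (simp add: trunc_alg_def)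
      then show "\<delta> k (a \<otimes>\<^bsub>A\<^esub> b) = (\<Oplus>\<^bsub>B\<^esub>i\<in>{..k}. \<delta> i a \<otimes>\<^bsub>B\<^esub> \<delta> (k - i) b)"
        using sum[OF k _ a b] cl k by (simp add: arc_def)
    qed
  next
    assume R: ?R
    show ?L
      unfolding alg_hom_def
    proof (intro CollectI conjI allI ballI ring_hom_memI)
      fix a b c
      assume a: "a \<in> carrier A"
      show "arc m B \<delta> a \<in> carrier (trunc_alg m B)"
        using R a by (auto simp: trunc_alg_def arc_def)
      show "arc m B \<delta> (c \<odot>\<^bsub>A\<^esub> a) = c \<odot>\<^bsub>trunc_alg m B\<^esub> arc m B \<delta> a"
        using R a by (auto simp: trunc_alg_def arc_def fun_eq_iff)
      assume b: "b \<in> carrier A"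
      show "arc m B \<delta> (a \<oplus>\<^bsub>A\<^esub> b) = arc m B \<delta> a \<oplus>\<^bsub>trunc_alg m B\<^esub> arc m B \<delta> b"
        using R a b by (auto simp: trunc_alg_def arc_def fun_eq_iff)
      show "arc m B \<delta> (a \<otimes>\<^bsub>A\<^esub> b) = arc m B \<delta> a \<otimes>\<^bsub>trunc_alg m B\<^esub> arc m B \<delta> b"
      proof
        fix k
        show "arc m B \<delta> (a \<otimes>\<^bsub>A\<^esub> b) k = (arc m B \<delta> a \<otimes>\<^bsub>trunc_alg m B\<^esub> arc m B \<delta> b) k"
        proof (cases "enat k \<le> m")
          case True
          then show ?thesis using R a b sum[OF True _ a b] by (simp add: trunc_alg_def arc_def[of m B \<delta> "a \<otimes>\<^bsub>A\<^esub> b"])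
        next
          case False
          then show ?thesis by (simp add: trunc_alg_def arc_def)
        qed
      qed
    next
      show "arc m B \<delta> \<one>\<^bsub>A\<^esub> = \<one>\<^bsub>trunc_alg m B\<^esub>"
      proof
        fix k
        have "enat 0 \<le> m" by (simp add: zero_enat_def[symmetric])
        then show "arc m B \<delta> \<one>\<^bsub>A\<^esub> k = \<one>\<^bsub>trunc_alg m B\<^esub> k"
          using R by (auto simp: trunc_alg_def arc_def)
      qed
    qed
  qed
qed

lemma jet_arc_hom:
  assumes A: "C_algebra A"
  shows "arc m (jet_alg m A) (jet_gen m A) \<in> alg_hom A (trunc_alg m (jet_alg m A))"
proof -
  interpret A: algebra C_field A by (rule A)
  let ?P = "mpoly_alg (jet_vars m A)"
  let ?J = "jet_alg m A"
  interpret P: cring ?P by (rule cring_mpoly)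
  note I = jet_ideal[OF A, of m]
  interpret I: ideal "jet_ideal m A" ?P by (rule I)
  note co = quot_alg_coset[OF algebra_mpoly I, folded jet_alg_def]
  interpret q: ring_hom_cring ?P ?J "(+>\<^bsub>?P\<^esub>) (jet_ideal m A)"
    by (rule ring_hom_cringI2)
      (use coset_alg_hom[OF algebra_mpoly I] cring_quot_alg[OF algebra_mpoly I] in
        \<open>auto simp: alg_hom_def jet_alg_def P.is_cring\<close>)
  have le: "enat i \<le> m" if "enat k \<le> m" "i \<le> k" for i k
    using that order_trans[of "enat i" "enat k" m] by simp
  have v: "pvar (k, a) \<in> carrier ?P" if "enat k \<le> m" "a \<in> carrier A" for k a
    using that by (simp add: jet_vars_def)
  have rel: "jet_ideal m A +>\<^bsub>?P\<^esub> p = jet_ideal m A +>\<^bsub>?P\<^esub> r"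
    if "p - r \<in> jet_rels m A" "p \<in> carrier ?P" "r \<in> carrier ?P" for p r
  proof (rule coset_eqI[OF algebra_mpoly I that(2,3)])
    have "p \<ominus>\<^bsub>?P\<^esub> r = p - r" using that by (simp add: a_minus_def)
    then show "p \<ominus>\<^bsub>?P\<^esub> r \<in> jet_ideal m A"
      using P.genideal_self[OF jet_rels_subset[OF A, of m]] that(1) by (auto simp: jet_ideal_def)
  qed
  show ?thesis
    unfolding arc_hom_iff[OF A algebra_jet[OF A]]
  proof (intro allI impI conjI ballI)
    fix k a b c assume k: "enat k \<le> m"
    have "jet_gen m A k \<one>\<^bsub>A\<^esub> = jet_ideal m A +>\<^bsub>?P\<^esub> (if k = 0 then 1 else 0)"
      unfolding jet_gen_def by (rule rel[OF jet_relsI(4)[OF k]]) (simp_all add: v[OF k])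
    then show "jet_gen m A k \<one>\<^bsub>A\<^esub> = (if k = 0 then \<one>\<^bsub>?J\<^esub> else \<zero>\<^bsub>?J\<^esub>)"
      using q.hom_one q.hom_zero by simp
    assume a: "a \<in> carrier A"
    show "jet_gen m A k a \<in> carrier ?J"
      unfolding jet_gen_def by (rule q.hom_closed[OF v[OF k a]])
    have "jet_gen m A k (c \<odot>\<^bsub>A\<^esub> a) = jet_ideal m A +>\<^bsub>?P\<^esub> (pconst c * pvar (k, a))"
      unfolding jet_gen_def
      by (rule rel[OF jet_relsI(3)[OF k a]]) (use A.smult_closed[of c a] in \<open>simp_all add: v[OF k] a\<close>)
    then show "jet_gen m A k (c \<odot>\<^bsub>A\<^esub> a) = c \<odot>\<^bsub>?J\<^esub> jet_gen m A k a"
      using co(4)[OF v[OF k a] v[OF k a], of c] by (simp add: jet_gen_def)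
    assume b: "b \<in> carrier A"
    have "jet_gen m A k (a \<oplus>\<^bsub>A\<^esub> b) = jet_ideal m A +>\<^bsub>?P\<^esub> (pvar (k, a) + pvar (k, b))"
      unfolding jet_gen_def
      by (rule rel[OF jet_relsI(1)[OF k a b]]) (simp_all add: v[OF k] a b)
    then show "jet_gen m A k (a \<oplus>\<^bsub>A\<^esub> b) = jet_gen m A k a \<oplus>\<^bsub>?J\<^esub> jet_gen m A k b"
      using co(3)[OF v[OF k a] v[OF k b]] by (simp add: jet_gen_def)
    have w: "pvar (i, a) * pvar (k - i, b) \<in> carrier ?P" if "i \<le> k" for i
      using v[OF le[OF k that] a] v[OF le[OF k, of "k - i"] b] by simp
    have fs: "(\<Sum>i\<in>S. pvar (i, a) * pvar (k - i, b)) = (\<Oplus>\<^bsub>?P\<^esub>i\<in>S. pvar (i, a) * pvar (k - i, b))"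
      if "finite S" "S \<subseteq> {..k}" for S
      using that
    proof (induction S rule: finite_induct)
      case (insert i S)
      then have "(\<lambda>i. pvar (i, a) * pvar (k - i, b)) \<in> S \<rightarrow> carrier ?P" "pvar (i, a) * pvar (k - i, b) \<in> carrier ?P"
        using w by auto
      then show ?case using insert by (simp add: P.finsum_insert)
    qed simp
    have "jet_gen m A k (a \<otimes>\<^bsub>A\<^esub> b) = jet_ideal m A +>\<^bsub>?P\<^esub> (\<Sum>i\<le>k. pvar (i, a) * pvar (k - i, b))"
      unfolding jet_gen_def
    proof (rule rel[OF jet_relsI(2)[OF k a b]])
      show "pvar (k, a \<otimes>\<^bsub>A\<^esub> b) \<in> carrier ?P" using v[OF k] a b by simp
      show "(\<Sum>i\<le>k. pvar (i, a) * pvar (k - i, b)) \<in> carrier ?P"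
        by (rule mpoly_closed_sum) (use w in auto)
    qed
    also have "\<dots> = (\<Oplus>\<^bsub>?J\<^esub>i\<in>{..k}. jet_ideal m A +>\<^bsub>?P\<^esub> (pvar (i, a) * pvar (k - i, b)))"
      unfolding fs[OF finite_atMost subset_refl]
      by (subst q.hom_finsum) (use w in \<open>auto simp: comp_def\<close>)
    also have "\<dots> = (\<Oplus>\<^bsub>?J\<^esub>i\<in>{..k}. jet_gen m A i a \<otimes>\<^bsub>?J\<^esub> jet_gen m A (k - i) b)"
    proof (rule q.S.add.finprod_cong')
      show "(\<lambda>i. jet_gen m A i a \<otimes>\<^bsub>?J\<^esub> jet_gen m A (k - i) b) \<in> {..k} \<rightarrow> carrier ?J"
        using v le[OF k] a b by (auto simp: jet_gen_def intro!: q.S.m_closed q.hom_closed)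
      show "jet_ideal m A +>\<^bsub>?P\<^esub> (pvar (i, a) * pvar (k - i, b)) = jet_gen m A i a \<otimes>\<^bsub>?J\<^esub> jet_gen m A (k - i) b"
        if "i \<in> {..k}" for i
        using co(2)[OF v[OF _ a] v[OF _ b], of i "k - i"] le[OF k] that by (simp add: jet_gen_def)
    qed simp
    finally show "jet_gen m A k (a \<otimes>\<^bsub>A\<^esub> b) = (\<Oplus>\<^bsub>?J\<^esub>i\<in>{..k}. jet_gen m A i a \<otimes>\<^bsub>?J\<^esub> jet_gen m A (k - i) b)" .
  qed
qed

text \<open>Extension of a jet to the jet algebra.\<close>

lemma jet_lift:
  assumes A: "C_algebra A" and B: "C_algebra B" and d: "arc m B \<delta> \<in> alg_hom A (trunc_alg m B)"
  defines "L \<equiv> (\<lambda>U. the_elem (aeval B (\<lambda>(k, a). \<delta> k a) ` U))"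
  shows "L \<in> alg_hom (jet_alg m A) B"
    and "\<And>k a. enat k \<le> m \<Longrightarrow> a \<in> carrier A \<Longrightarrow> L (jet_gen m A k a) = \<delta> k a"
proof -
  interpret A: algebra C_field A by (rule A)
  interpret B: algebra C_field B by (rule B)
  let ?P = "mpoly_alg (jet_vars m A)"
  let ?e = "aeval B (\<lambda>(k, a). \<delta> k a)"
  interpret P: cring ?P by (rule cring_mpoly)
  note I = jet_ideal[OF A, of m]
  note R = d[unfolded arc_hom_iff[OF A B], rule_format]
  have le: "enat i \<le> m" if "enat k \<le> m" "i \<le> k" for i k
    using that order_trans[of "enat i" "enat k" m] by simp
  have \<phi>: "(\<lambda>(k, a). \<delta> k a) \<in> jet_vars m A \<rightarrow> carrier B"
    using R by (auto simp: jet_vars_def)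
  have e: "?e \<in> alg_hom ?P B" by (rule aeval_alg_hom[OF B \<phi>])
  interpret e: ring_hom_cring ?P B ?e
    by (rule ring_hom_cringI2) (use e B.M_cring in \<open>auto simp: alg_hom_def P.is_cring\<close>)
  have v: "pvar (k, a) \<in> carrier ?P" "?e (pvar (k, a)) = \<delta> k a" if "enat k \<le> m" "a \<in> carrier A" for k a
    using that aeval_pvar[OF B \<phi>, of "(k, a)"] by (simp_all add: jet_vars_def)
  have minus: "?e (p - r) = \<zero>\<^bsub>B\<^esub>" if "p \<in> carrier ?P" "r \<in> carrier ?P" "?e p = ?e r" for p r
  proof -
    have "?e (p - r) = ?e p \<oplus>\<^bsub>B\<^esub> ?e (- r)"
      using e.hom_add[of p "- r"] that by simp
    also have "?e (- r) = \<ominus>\<^bsub>B\<^esub> ?e r" using e.hom_a_inv[of r] that by simp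
    finally show ?thesis using that e.hom_closed[of r] by (simp add: B.M.r_neg)
  qed
  have sum: "?e (\<Sum>i\<in>S. f i) = (\<Oplus>\<^bsub>B\<^esub>i\<in>S. ?e (f i))"
    if "finite S" "\<And>i. i \<in> S \<Longrightarrow> f i \<in> carrier ?P" for S and f :: "nat \<Rightarrow> _"
    using that
  proof (induction S rule: finite_induct)
    case empty
    then show ?case using e.hom_zero by simp
  next
    case (insert i S)
    then have "(\<lambda>i. ?e (f i)) \<in> S \<rightarrow> carrier B" "?e (f i) \<in> carrier B" by auto
    moreover have "?e (f i + sum f S) = ?e (f i) \<oplus>\<^bsub>B\<^esub> ?e (sum f S)"
      using e.hom_add[of "f i" "sum f S"] insert mpoly_closed_sum[of S f] by simp
    ultimately show ?case using insert by (simp add: B.M.finsum_insert)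
  qed
  have rels0: "?e r = \<zero>\<^bsub>B\<^esub>" if "r \<in> jet_rels m A" for r
    using that unfolding jet_rels_def
  proof (elim UnE CollectE exE conjE)
    fix k a b assume r: "r = pvar (k, a \<oplus>\<^bsub>A\<^esub> b) - (pvar (k, a) + pvar (k, b))"
      and k: "enat k \<le> m" and a: "a \<in> carrier A" and b: "b \<in> carrier A"
    show ?thesis unfolding r
      using R[OF k] e.hom_add[of "pvar (k, a)" "pvar (k, b)"] v[OF k] a b by (intro minus) auto
  next
    fix k c a assume r: "r = pvar (k, c \<odot>\<^bsub>A\<^esub> a) - pconst c * pvar (k, a)"
      and k: "enat k \<le> m" and a: "a \<in> carrier A"
    show ?thesis unfolding r
      using R[OF k] alg_homD(2)[OF e, of "pvar (k, a)" c] v[OF k] a A.smult_closed[of c a]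
      by (intro minus) auto
  next
    fix k assume r: "r = pvar (k, \<one>\<^bsub>A\<^esub>) - (if k = 0 then 1 else 0)" and k: "enat k \<le> m"
    show ?thesis unfolding r
      using R[OF k] e.hom_one e.hom_zero v[OF k] by (intro minus) auto
  next
    fix k a b assume r: "r = pvar (k, a \<otimes>\<^bsub>A\<^esub> b) - (\<Sum>i\<le>k. pvar (i, a) * pvar (k - i, b))"
      and k: "enat k \<le> m" and a: "a \<in> carrier A" and b: "b \<in> carrier A"
    have w: "pvar (i, a) * pvar (k - i, b) \<in> carrier ?P"
      "?e (pvar (i, a) * pvar (k - i, b)) = \<delta> i a \<otimes>\<^bsub>B\<^esub> \<delta> (k - i) b"
      "\<delta> i a \<otimes>\<^bsub>B\<^esub> \<delta> (k - i) b \<in> carrier B" if "i \<le> k" for i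
    proof -
      have i: "enat i \<le> m" "enat (k - i) \<le> m" using le[OF k] that by auto
      show "pvar (i, a) * pvar (k - i, b) \<in> carrier ?P"
        using v(1)[OF i(1) a] v(1)[OF i(2) b] by simp
      show "?e (pvar (i, a) * pvar (k - i, b)) = \<delta> i a \<otimes>\<^bsub>B\<^esub> \<delta> (k - i) b"
        using e.hom_mult[OF v(1)[OF i(1) a] v(1)[OF i(2) b]] v(2)[OF i(1) a] v(2)[OF i(2) b] by simp
      show "\<delta> i a \<otimes>\<^bsub>B\<^esub> \<delta> (k - i) b \<in> carrier B"
        using R[OF i(1)] R[OF i(2)] a b by simp
    qed
    show ?thesis unfolding r
    proof (rule minus)
      show "pvar (k, a \<otimes>\<^bsub>A\<^esub> b) \<in> carrier ?P" using v[OF k] a b by simp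
      show "(\<Sum>i\<le>k. pvar (i, a) * pvar (k - i, b)) \<in> carrier ?P"
        by (rule mpoly_closed_sum) (use w in auto)
      have "?e (\<Sum>i\<le>k. pvar (i, a) * pvar (k - i, b)) = (\<Oplus>\<^bsub>B\<^esub>i\<in>{..k}. ?e (pvar (i, a) * pvar (k - i, b)))"
        by (rule sum) (use w in auto)
      also have "\<dots> = (\<Oplus>\<^bsub>B\<^esub>i\<in>{..k}. \<delta> i a \<otimes>\<^bsub>B\<^esub> \<delta> (k - i) b)"
        by (rule B.add.finprod_cong') (use w in auto)
      also have "\<dots> = ?e (pvar (k, a \<otimes>\<^bsub>A\<^esub> b))"
        using R[OF k] v[OF k] a b by simp
      finally show "?e (pvar (k, a \<otimes>\<^bsub>A\<^esub> b)) = ?e (\<Sum>i\<le>k. pvar (i, a) * pvar (k - i, b))" by simp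
    qed
  qed
  have "jet_rels m A \<subseteq> a_kernel ?P B ?e"
  proof
    fix r assume r: "r \<in> jet_rels m A"
    show "r \<in> a_kernel ?P B ?e"
      unfolding a_kernel_def' using rels0[OF r] subsetD[OF jet_rels_subset[OF A] r] by simp
  qed
  then have "jet_ideal m A \<subseteq> a_kernel ?P B ?e"
    unfolding jet_ideal_def by (rule P.genideal_minimal[OF ring_hom_ring.kernel_is_ideal[OF
      ring_hom_ringI2[OF P.ring_axioms cring.axioms(1)[OF B.M_cring] alg_homD(1)[OF e]]]])
  then have kill: "?e x = \<zero>\<^bsub>B\<^esub>" if "x \<in> jet_ideal m A" for x
    using that subsetD unfolding a_kernel_def' by blast
  show "L \<in> alg_hom (jet_alg m A) B"
    unfolding L_def jet_alg_def by (rule lift_alg_hom[OF algebra_mpoly I B e kill])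
  show "L (jet_gen m A k a) = \<delta> k a" if "enat k \<le> m" "a \<in> carrier A" for k a
    unfolding L_def jet_gen_def
    using the_elem_coset[OF algebra_mpoly I B e kill v(1)[OF that]] v(2)[OF that] by simp
qed

lemma jet_hom_eq:
  assumes A: "C_algebra A" and B: "C_algebra B"
    and f: "f \<in> alg_hom (jet_alg m A) B" and g: "g \<in> alg_hom (jet_alg m A) B"
    and eq: "\<And>k a. enat k \<le> m \<Longrightarrow> a \<in> carrier A \<Longrightarrow> f (jet_gen m A k a) = g (jet_gen m A k a)"
    and U: "U \<in> carrier (jet_alg m A)"
  shows "f U = g U"
proof -
  let ?P = "mpoly_alg (jet_vars m A)"
  note I = jet_ideal[OF A, of m]
  let ?q = "(+>\<^bsub>?P\<^esub>) (jet_ideal m A)"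
  obtain p where p: "p \<in> carrier ?P" "U = ?q p"
    using U unfolding jet_alg_def quot_alg_elem[OF algebra_mpoly I] by blast
  have q: "?q \<in> alg_hom ?P (jet_alg m A)"
    unfolding jet_alg_def by (rule coset_alg_hom[OF algebra_mpoly I])
  let ?\<phi> = "\<lambda>v. g (?q (pvar v))"
  have gq: "(\<lambda>p. g (?q p)) \<in> alg_hom ?P B" and fq: "(\<lambda>p. f (?q p)) \<in> alg_hom ?P B"
    using alg_hom_comp[OF q] f g by auto
  have \<phi>: "?\<phi> \<in> jet_vars m A \<rightarrow> carrier B"
    using ring_hom_closed[OF alg_homD(1)[OF gq]] by auto
  have "f (?q p) = aeval B ?\<phi> p"
    by (rule alg_hom_mpoly_unique[OF B \<phi> fq _ p(1)]) (use eq in \<open>auto simp: jet_vars_def jet_gen_def\<close>)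
  moreover have "g (?q p) = aeval B ?\<phi> p"
    by (rule alg_hom_mpoly_unique[OF B \<phi> gq _ p(1)]) simp
  ultimately show ?thesis using p by simp
qed

text \<open>
  The jet scheme of \<open>Spec A\<close> represents \<open>B \<mapsto> Hom(A, B[t]/(t^(m+1)))\<close>. Homomorphisms are made
  extensional so that they are determined by their values on the carrier.
\<close>

theorem jet_universal:
  assumes A: "C_algebra A" and B: "C_algebra B"
  shows "bij_betw (\<lambda>\<phi>. \<lambda>a \<in> carrier A. \<lambda>k. if enat k \<le> m then \<phi> (jet_gen m A k a) else \<zero>\<^bsub>B\<^esub>)
     (alg_hom (jet_alg m A) B \<inter> extensional (carrier (jet_alg m A)))
     (alg_hom A (trunc_alg m B) \<inter> extensional (carrier A))"
proof -
  interpret A: algebra C_field A by (rule A)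
  interpret B: algebra C_field B by (rule B)
  let ?J = "jet_alg m A"
  interpret J: algebra C_field ?J by (rule algebra_jet[OF A])
  have restr: "restrict h (carrier C) \<in> alg_hom C D"
    if "h \<in> alg_hom C D" "C_algebra C" for h and C :: "(complex, 'x, 'p) module_scheme" and D :: "(complex, 'y, 'q) module_scheme"
  proof -
    interpret C: algebra C_field C by (rule that(2))
    show ?thesis using that(1) C.smult_closed
      by (auto simp: alg_hom_def ring_hom_def)
  qed
  let ?F = "\<lambda>\<phi>. \<lambda>a \<in> carrier A. \<lambda>k. if enat k \<le> m then \<phi> (jet_gen m A k a) else \<zero>\<^bsub>B\<^esub>"
  have F: "?F \<phi> = restrict (arc m B (\<lambda>k a. \<phi> (jet_gen m A k a))) (carrier A)" for \<phi>
    by (auto simp: restrict_def arc_def fun_eq_iff)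
  have gen: "jet_gen m A k a \<in> carrier ?J" if "enat k \<le> m" "a \<in> carrier A" for k a
    using jet_arc_hom[OF A, of m, unfolded arc_hom_iff[OF A algebra_jet[OF A]]] that by blast
  show ?thesis
  proof (rule bij_betw_imageI)
    show "inj_on ?F (alg_hom ?J B \<inter> extensional (carrier ?J))"
    proof (rule inj_onI)
      fix f g assume f: "f \<in> alg_hom ?J B \<inter> extensional (carrier ?J)"
        and g: "g \<in> alg_hom ?J B \<inter> extensional (carrier ?J)" and eq: "?F f = ?F g"
      have "f (jet_gen m A k a) = g (jet_gen m A k a)" if "enat k \<le> m" "a \<in> carrier A" for k a
        using fun_cong[OF fun_cong[OF eq, of a], of k] that by simp
      then have "f U = g U" if "U \<in> carrier ?J" for U
        using jet_hom_eq[OF A B _ _ _ that, of f g] f g by blast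
      then show "f = g" using f g by (auto intro: extensionalityI)
    qed
    show "?F ` (alg_hom ?J B \<inter> extensional (carrier ?J)) = alg_hom A (trunc_alg m B) \<inter> extensional (carrier A)"
    proof (intro equalityI subsetI)
      fix h assume "h \<in> ?F ` (alg_hom ?J B \<inter> extensional (carrier ?J))"
      then obtain f where f: "f \<in> alg_hom ?J B" and h: "h = ?F f" by blast
      interpret f: ring_hom_cring ?J B f
        by (rule ring_hom_cringI2) (use f B.M_cring J.M_cring in \<open>auto simp: alg_hom_def\<close>)
      note R = jet_arc_hom[OF A, of m, unfolded arc_hom_iff[OF A algebra_jet[OF A]], rule_format]
      have "arc m B (\<lambda>k a. f (jet_gen m A k a)) \<in> alg_hom A (trunc_alg m B)"
        unfolding arc_hom_iff[OF A B]
      proof (intro allI impI conjI ballI)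
        fix k a b c assume k: "enat k \<le> m"
        show "f (jet_gen m A k \<one>\<^bsub>A\<^esub>) = (if k = 0 then \<one>\<^bsub>B\<^esub> else \<zero>\<^bsub>B\<^esub>)"
          using R[OF k] by simp
        assume a: "a \<in> carrier A"
        show "f (jet_gen m A k a) \<in> carrier B" using gen[OF k a] by simp
        show "f (jet_gen m A k (c \<odot>\<^bsub>A\<^esub> a)) = c \<odot>\<^bsub>B\<^esub> f (jet_gen m A k a)"
          using R[OF k] gen[OF k a] a alg_homD(2)[OF f] by simp
        assume b: "b \<in> carrier A"
        show "f (jet_gen m A k (a \<oplus>\<^bsub>A\<^esub> b)) = f (jet_gen m A k a) \<oplus>\<^bsub>B\<^esub> f (jet_gen m A k b)"
          using R[OF k] gen[OF k] a b by simp
        have g: "jet_gen m A i a \<in> carrier ?J" "jet_gen m A (k - i) b \<in> carrier ?J" if "i \<le> k" for i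
          using gen a b k that order_trans[of "enat i" "enat k" m] order_trans[of "enat (k - i)" "enat k" m]
          by auto
        have "f (jet_gen m A k (a \<otimes>\<^bsub>A\<^esub> b)) = f (\<Oplus>\<^bsub>?J\<^esub>i\<in>{..k}. jet_gen m A i a \<otimes>\<^bsub>?J\<^esub> jet_gen m A (k - i) b)"
          using R[OF k] a b by simp
        also have "\<dots> = (\<Oplus>\<^bsub>B\<^esub>i\<in>{..k}. f (jet_gen m A i a \<otimes>\<^bsub>?J\<^esub> jet_gen m A (k - i) b))"
          by (subst f.hom_finsum) (use g in \<open>auto simp: comp_def\<close>)
        also have "\<dots> = (\<Oplus>\<^bsub>B\<^esub>i\<in>{..k}. f (jet_gen m A i a) \<otimes>\<^bsub>B\<^esub> f (jet_gen m A (k - i) b))"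
          by (rule B.add.finprod_cong') (use g in auto)
        finally show "f (jet_gen m A k (a \<otimes>\<^bsub>A\<^esub> b)) = (\<Oplus>\<^bsub>B\<^esub>i\<in>{..k}. f (jet_gen m A i a) \<otimes>\<^bsub>B\<^esub> f (jet_gen m A (k - i) b))" .
      qed
      then show "h \<in> alg_hom A (trunc_alg m B) \<inter> extensional (carrier A)"
        unfolding h F using restr[OF _ A] by simp
    next
      fix h assume h: "h \<in> alg_hom A (trunc_alg m B) \<inter> extensional (carrier A)"
      let ?\<delta> = "\<lambda>k a. h a k"
      have arc: "arc m B ?\<delta> a = h a" if "a \<in> carrier A" for a
        using ring_hom_closed[OF alg_homD(1) that, of h "trunc_alg m B"] h
        by (auto simp: arc_def fun_eq_iff trunc_alg_def)
      have d: "arc m B ?\<delta> \<in> alg_hom A (trunc_alg m B)"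
        using h arc A.smult_closed by (auto simp: alg_hom_def ring_hom_def)
      define L where "L = (\<lambda>U. the_elem (aeval B (\<lambda>(k, a). ?\<delta> k a) ` U))"
      have L1: "L \<in> alg_hom ?J B" unfolding L_def by (rule jet_lift(1)[OF A B d])
      have L2: "L (jet_gen m A k a) = h a k" if "enat k \<le> m" "a \<in> carrier A" for k a
        unfolding L_def by (rule jet_lift(2)[OF A B d that])
      let ?L = "restrict L (carrier ?J)"
      have "?F ?L = h"
      proof (rule extensionalityI[of _ "carrier A"])
        show "h \<in> extensional (carrier A)" using h by simp
        fix a assume a: "a \<in> carrier A"
        show "?F ?L a = h a"
        proof
          fix k
          show "?F ?L a k = h a k"
            using fun_cong[OF arc[OF a], of k] gen[OF _ a, of k] L2[OF _ a, of k] a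
            by (cases "enat k \<le> m") (simp_all add: arc_def)
        qed
      qed simp
      then show "h \<in> ?F ` (alg_hom ?J B \<inter> extensional (carrier ?J))"
        using restr[OF L1 algebra_jet[OF A]] by (intro image_eqI[of _ _ ?L]) auto
    qed
  qed
qed

lemma jet_map:
  assumes A: "C_algebra A" and B: "C_algebra B" and h: "h \<in> alg_hom A B"
  shows "jet_map m A B h \<in> alg_hom (jet_alg m A) (jet_alg m B)"
    and "\<And>k a. enat k \<le> m \<Longrightarrow> a \<in> carrier A \<Longrightarrow>
           jet_map m A B h (jet_gen m A k a) = jet_gen m B k (h a)"
proof -
  have "arc m (jet_alg m B) (\<lambda>k a. jet_gen m B k (h a)) = (\<lambda>a. arc m (jet_alg m B) (jet_gen m B) (h a))"
    by (auto simp: arc_def fun_eq_iff)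
  then have d: "arc m (jet_alg m B) (\<lambda>k a. jet_gen m B k (h a)) \<in> alg_hom A (trunc_alg m (jet_alg m B))"
    using alg_hom_comp[OF h jet_arc_hom[OF B, of m]] by simp
  note L = jet_lift[OF A algebra_jet[OF B] d]
  have e: "jet_map m A B h = (\<lambda>U. the_elem (aeval (jet_alg m B) (\<lambda>(k, a). jet_gen m B k (h a)) ` U))"
    by (auto simp: jet_map_def fun_eq_iff)
  show "jet_map m A B h \<in> alg_hom (jet_alg m A) (jet_alg m B)" unfolding e by (rule L(1))
  show "jet_map m A B h (jet_gen m A k a) = jet_gen m B k (h a)" if "enat k \<le> m" "a \<in> carrier A" for k a
    unfolding e by (rule L(2)[OF that])
qed


section \<open>Localizations are rings\<close>

context
  fixes A :: "('a, 'm) ring_scheme" (structure) and S :: "'a set"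
  assumes A: "cring A" and S: "S \<subseteq> carrier A" and S_one: "\<one> \<in> S"
    and S_mult: "\<And>s t. s \<in> S \<Longrightarrow> t \<in> S \<Longrightarrow> s \<otimes> t \<in> S"
begin

interpretation cring A by (rule A)

lemma equiv_loc_rel: "equiv (carrier A \<times> S) (loc_rel A S)"
proof (rule equivI)
  show "loc_rel A S \<subseteq> (carrier A \<times> S) \<times> carrier A \<times> S" by (auto simp: loc_rel_def)
  show "refl_on (carrier A \<times> S) (loc_rel A S)"
    using S_one by (auto simp: refl_on_def loc_rel_def)
  show "sym (loc_rel A S)"
    by (auto simp: sym_def loc_rel_def) metis
  show "trans (loc_rel A S)"
  proof (rule transI)
    fix x y z assume "(x, y) \<in> loc_rel A S" "(y, z) \<in> loc_rel A S"
    then obtain a s b t c r u w where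
      xyz: "x = (a, s)" "y = (b, t)" "z = (c, r)" and
      S': "s \<in> S" "t \<in> S" "r \<in> S" "u \<in> S" "w \<in> S" and
      C: "a \<in> carrier A" "b \<in> carrier A" "c \<in> carrier A" and
      1: "u \<otimes> (a \<otimes> t) = u \<otimes> (b \<otimes> s)" and 2: "w \<otimes> (b \<otimes> r) = w \<otimes> (c \<otimes> t)"
      unfolding loc_rel_def by blast
    have C': "s \<in> carrier A" "t \<in> carrier A" "r \<in> carrier A" "u \<in> carrier A" "w \<in> carrier A"
      using S S' by auto
    note C = C C'
    have "(u \<otimes> w \<otimes> t) \<otimes> (a \<otimes> r) = (w \<otimes> r) \<otimes> (u \<otimes> (a \<otimes> t))"
      using C by (simp add: m_ac)
    also have "\<dots> = (u \<otimes> s) \<otimes> (w \<otimes> (b \<otimes> r))"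
      unfolding 1 using C by (simp add: m_ac)
    also have "\<dots> = (u \<otimes> w \<otimes> t) \<otimes> (c \<otimes> s)"
      unfolding 2 using C by (simp add: m_ac)
    finally have "(u \<otimes> w \<otimes> t) \<otimes> (a \<otimes> r) = (u \<otimes> w \<otimes> t) \<otimes> (c \<otimes> s)" .
    moreover have "u \<otimes> w \<otimes> t \<in> S" using S' S_mult by blast
    ultimately show "(x, z) \<in> loc_rel A S"
      using C S' unfolding xyz loc_rel_def by blast
  qed
qed

lemma loc_frac_eq_iff:
  assumes "a \<in> carrier A" "s \<in> S" "b \<in> carrier A" "t \<in> S"
  shows "loc_frac A S a s = loc_frac A S b t \<longleftrightarrow> (\<exists>u \<in> S. u \<otimes> (a \<otimes> t) = u \<otimes> (b \<otimes> s))"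
  unfolding loc_frac_def
  using eq_equiv_class_iff[OF equiv_loc_rel, of "(a, s)" "(b, t)"] assms
  by (simp add: loc_rel_def)

lemma localization_elem:
  "U \<in> carrier (localization A S) \<longleftrightarrow> (\<exists>a \<in> carrier A. \<exists>s \<in> S. U = loc_frac A S a s)"
  by (auto simp: localization_def loc_frac_def quotient_def)

lemma loc_frac_Union:
  assumes f: "\<And>a s b t a' s' b' t'. ((a, s), (a', s')) \<in> loc_rel A S \<Longrightarrow> ((b, t), (b', t')) \<in> loc_rel A S \<Longrightarrow>
      f a s b t = f a' s' b' t'"
    and C: "a \<in> carrier A" "s \<in> S" "b \<in> carrier A" "t \<in> S"
  shows "(\<Union>(a, s)\<in>loc_frac A S a s. \<Union>(b, t)\<in>loc_frac A S b t. f a s b t) = f a s b t"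
proof -
  have m: "(a, s) \<in> loc_frac A S a s" "(b, t) \<in> loc_frac A S b t"
    using equiv_class_self[OF equiv_loc_rel] C by (auto simp: loc_frac_def)
  have "f a' s' b' t' = f a s b t" if "(a', s') \<in> loc_frac A S a s" "(b', t') \<in> loc_frac A S b t" for a' s' b' t'
    using f that by (auto simp: loc_frac_def)
  then have "(\<Union>(b', t')\<in>loc_frac A S b t. f a' s' b' t') = f a s b t"
    if "(a', s') \<in> loc_frac A S a s" for a' s'
    using m that by blast
  then show ?thesis using m by blast
qed

lemma loc_frac_simps:
  assumes C: "a \<in> carrier A" "s \<in> S" "b \<in> carrier A" "t \<in> S"
  shows "loc_frac A S a s \<otimes>\<^bsub>localization A S\<^esub> loc_frac A S b t = loc_frac A S (a \<otimes> b) (s \<otimes> t)"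
    and "loc_frac A S a s \<oplus>\<^bsub>localization A S\<^esub> loc_frac A S b t =
           loc_frac A S ((a \<otimes> t) \<oplus> (b \<otimes> s)) (s \<otimes> t)"
proof -
  have D: thesis if "((a, s), (a', s')) \<in> loc_rel A S" "((b, t), (b', t')) \<in> loc_rel A S"
    "\<And>u w. \<lbrakk>a \<in> carrier A; a' \<in> carrier A; b \<in> carrier A; b' \<in> carrier A; s \<in> S; s' \<in> S; t \<in> S; t' \<in> S;
      u \<in> S; w \<in> S; s \<in> carrier A; s' \<in> carrier A; t \<in> carrier A; t' \<in> carrier A; u \<in> carrier A; w \<in> carrier A;
      u \<otimes> (a \<otimes> s') = u \<otimes> (a' \<otimes> s); w \<otimes> (b \<otimes> t') = w \<otimes> (b' \<otimes> t)\<rbrakk> \<Longrightarrow> thesis"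
    for a s a' s' b t b' t' thesis
    using that S unfolding loc_rel_def by blast
  show "loc_frac A S a s \<otimes>\<^bsub>localization A S\<^esub> loc_frac A S b t = loc_frac A S (a \<otimes> b) (s \<otimes> t)"
    unfolding localization_def monoid.simps
  proof (rule loc_frac_Union[OF _ C])
    fix a s b t a' s' b' t'
    assume "((a, s), (a', s')) \<in> loc_rel A S" "((b, t), (b', t')) \<in> loc_rel A S"
    then show "loc_frac A S (a \<otimes> b) (s \<otimes> t) = loc_frac A S (a' \<otimes> b') (s' \<otimes> t')"
    proof (rule D)
      fix u w assume C: "a \<in> carrier A" "a' \<in> carrier A" "b \<in> carrier A" "b' \<in> carrier A"
        "s \<in> carrier A" "s' \<in> carrier A" "t \<in> carrier A" "t' \<in> carrier A" "u \<in> carrier A" "w \<in> carrier A"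
        and T: "s \<in> S" "s' \<in> S" "t \<in> S" "t' \<in> S" "u \<in> S" "w \<in> S"
        and 1: "u \<otimes> (a \<otimes> s') = u \<otimes> (a' \<otimes> s)" and 2: "w \<otimes> (b \<otimes> t') = w \<otimes> (b' \<otimes> t)"
      have "(u \<otimes> w) \<otimes> (a \<otimes> b \<otimes> (s' \<otimes> t')) = (u \<otimes> (a \<otimes> s')) \<otimes> (w \<otimes> (b \<otimes> t'))"
        using C by (simp add: m_ac)
      also have "\<dots> = (u \<otimes> w) \<otimes> (a' \<otimes> b' \<otimes> (s \<otimes> t))"
        unfolding 1 2 using C by (simp add: m_ac)
      finally show ?thesis
        using C T S_mult by (subst loc_frac_eq_iff) auto
    qed
  qed
  show "loc_frac A S a s \<oplus>\<^bsub>localization A S\<^esub> loc_frac A S b t =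
           loc_frac A S ((a \<otimes> t) \<oplus> (b \<otimes> s)) (s \<otimes> t)"
    unfolding localization_def ring.simps
  proof (rule loc_frac_Union[OF _ C])
    fix a s b t a' s' b' t'
    assume "((a, s), (a', s')) \<in> loc_rel A S" "((b, t), (b', t')) \<in> loc_rel A S"
    then show "loc_frac A S ((a \<otimes> t) \<oplus> (b \<otimes> s)) (s \<otimes> t) = loc_frac A S ((a' \<otimes> t') \<oplus> (b' \<otimes> s')) (s' \<otimes> t')"
    proof (rule D)
      fix u w assume C: "a \<in> carrier A" "a' \<in> carrier A" "b \<in> carrier A" "b' \<in> carrier A"
        "s \<in> carrier A" "s' \<in> carrier A" "t \<in> carrier A" "t' \<in> carrier A" "u \<in> carrier A" "w \<in> carrier A"
        and T: "s \<in> S" "s' \<in> S" "t \<in> S" "t' \<in> S" "u \<in> S" "w \<in> S"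
        and 1: "u \<otimes> (a \<otimes> s') = u \<otimes> (a' \<otimes> s)" and 2: "w \<otimes> (b \<otimes> t') = w \<otimes> (b' \<otimes> t)"
      have "(u \<otimes> w) \<otimes> ((a \<otimes> t \<oplus> b \<otimes> s) \<otimes> (s' \<otimes> t'))
          = (w \<otimes> t \<otimes> t') \<otimes> (u \<otimes> (a \<otimes> s')) \<oplus> (u \<otimes> s \<otimes> s') \<otimes> (w \<otimes> (b \<otimes> t'))"
        using C by (simp add: m_ac r_distr l_distr)
      also have "\<dots> = (u \<otimes> w) \<otimes> ((a' \<otimes> t' \<oplus> b' \<otimes> s') \<otimes> (s \<otimes> t))"
        unfolding 1 2 using C by (simp add: m_ac r_distr l_distr)
      finally show ?thesis
        using C T S_mult by (subst loc_frac_eq_iff) auto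
    qed
  qed
qed

lemma loc_frac_cancel:
  assumes "a \<in> carrier A" "s \<in> S" "t \<in> S"
  shows "loc_frac A S (a \<otimes> t) (s \<otimes> t) = loc_frac A S a s"
proof -
  have "s \<in> carrier A" "t \<in> carrier A" using assms S by auto
  then have "\<one> \<otimes> (a \<otimes> t \<otimes> s) = \<one> \<otimes> (a \<otimes> (s \<otimes> t))"
    using assms by (simp add: m_ac)
  then show ?thesis using assms S_one S_mult \<open>t \<in> carrier A\<close> by (subst loc_frac_eq_iff) auto
qed

lemma cring_localization: "cring (localization A S)"
proof -
  let ?L = "localization A S"
  let ?f = "loc_frac A S"
  have z: "\<zero>\<^bsub>?L\<^esub> = ?f \<zero> \<one>" and o: "\<one>\<^bsub>?L\<^esub> = ?f \<one> \<one>" by (simp_all add: localization_def)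
  have c: "?f a s \<in> carrier ?L" if "a \<in> carrier A" "s \<in> S" for a s
    using that localization_elem by blast
  have SC: "s \<in> carrier A" if "s \<in> S" for s using S that by blast
  note f = loc_frac_simps S_mult SC S_one
  show ?thesis
  proof (rule cringI)
    show "abelian_group ?L"
    proof (rule abelian_groupI)
      fix x assume "x \<in> carrier ?L"
      then obtain a s where x: "a \<in> carrier A" "s \<in> S" "x = ?f a s" unfolding localization_elem by blast
      show "\<zero>\<^bsub>?L\<^esub> \<oplus>\<^bsub>?L\<^esub> x = x" unfolding z using x by (simp add: f)
      have "?f (\<ominus> a) s \<oplus>\<^bsub>?L\<^esub> x = ?f (\<zero> \<otimes> (s \<otimes> s)) (\<one> \<otimes> (s \<otimes> s))"
        using x by (simp add: f l_distr[symmetric] l_neg)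
      also have "\<dots> = \<zero>\<^bsub>?L\<^esub>" unfolding z by (rule loc_frac_cancel) (use x in \<open>simp_all add: f\<close>)
      finally show "\<exists>y \<in> carrier ?L. y \<oplus>\<^bsub>?L\<^esub> x = \<zero>\<^bsub>?L\<^esub>"
        using c[of "\<ominus> a" s] x by blast
      fix y assume "y \<in> carrier ?L"
      then obtain b t where y: "b \<in> carrier A" "t \<in> S" "y = ?f b t" unfolding localization_elem by blast
      show "x \<oplus>\<^bsub>?L\<^esub> y \<in> carrier ?L" using x y by (simp add: f c)
      show "x \<oplus>\<^bsub>?L\<^esub> y = y \<oplus>\<^bsub>?L\<^esub> x" using x y by (simp add: f a_comm m_comm)
      fix z assume "z \<in> carrier ?L"
      then obtain d r where z: "d \<in> carrier A" "r \<in> S" "z = ?f d r" unfolding localization_elem by blast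
      show "x \<oplus>\<^bsub>?L\<^esub> y \<oplus>\<^bsub>?L\<^esub> z = x \<oplus>\<^bsub>?L\<^esub> (y \<oplus>\<^bsub>?L\<^esub> z)"
        using x y z by (simp add: f l_distr r_distr a_assoc m_ac)
    qed (use z c S_one in auto)
    show "comm_monoid ?L"
    proof (rule comm_monoidI)
      fix x assume "x \<in> carrier ?L"
      then obtain a s where x: "a \<in> carrier A" "s \<in> S" "x = ?f a s" unfolding localization_elem by blast
      show "\<one>\<^bsub>?L\<^esub> \<otimes>\<^bsub>?L\<^esub> x = x" unfolding o using x by (simp add: f)
      fix y assume "y \<in> carrier ?L"
      then obtain b t where y: "b \<in> carrier A" "t \<in> S" "y = ?f b t" unfolding localization_elem by blast
      show "x \<otimes>\<^bsub>?L\<^esub> y \<in> carrier ?L" using x y by (simp add: f c)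
      show "x \<otimes>\<^bsub>?L\<^esub> y = y \<otimes>\<^bsub>?L\<^esub> x" using x y by (simp add: f m_comm)
      fix z assume "z \<in> carrier ?L"
      then obtain d r where z: "d \<in> carrier A" "r \<in> S" "z = ?f d r" unfolding localization_elem by blast
      show "x \<otimes>\<^bsub>?L\<^esub> y \<otimes>\<^bsub>?L\<^esub> z = x \<otimes>\<^bsub>?L\<^esub> (y \<otimes>\<^bsub>?L\<^esub> z)"
        using x y z by (simp add: f m_assoc)
    qed (use o c S_one in auto)
    fix x y z assume "x \<in> carrier ?L" "y \<in> carrier ?L" "z \<in> carrier ?L"
    then obtain a s b t d r where x: "a \<in> carrier A" "s \<in> S" "x = ?f a s"
      and y: "b \<in> carrier A" "t \<in> S" "y = ?f b t" and z: "d \<in> carrier A" "r \<in> S" "z = ?f d r"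
      unfolding localization_elem by blast
    have "(x \<oplus>\<^bsub>?L\<^esub> y) \<otimes>\<^bsub>?L\<^esub> z = ?f ((a \<otimes> t \<oplus> b \<otimes> s) \<otimes> d) (s \<otimes> t \<otimes> r)"
      using x y z by (simp add: f)
    also have "\<dots> = ?f ((a \<otimes> t \<oplus> b \<otimes> s) \<otimes> d \<otimes> r) (s \<otimes> t \<otimes> r \<otimes> r)"
      by (rule loc_frac_cancel[symmetric]) (use x y z in \<open>simp_all add: f\<close>)
    also have "\<dots> = x \<otimes>\<^bsub>?L\<^esub> z \<oplus>\<^bsub>?L\<^esub> y \<otimes>\<^bsub>?L\<^esub> z"
      using x y z by (simp add: f l_distr r_distr m_ac)
    finally show "(x \<oplus>\<^bsub>?L\<^esub> y) \<otimes>\<^bsub>?L\<^esub> z = x \<otimes>\<^bsub>?L\<^esub> z \<oplus>\<^bsub>?L\<^esub> y \<otimes>\<^bsub>?L\<^esub> z" .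
  qed
qed

end


section \<open>The algebras and homomorphisms of the representation\<close>

lemma algebra_complex: "C_algebra complex_alg"
proof (rule algebraI)
  show "cring complex_alg"
  proof (rule cringI)
    show "abelian_group complex_alg"
    proof (rule abelian_groupI)
      fix x assume "x \<in> carrier complex_alg"
      show "\<exists>y \<in> carrier complex_alg. y \<oplus>\<^bsub>complex_alg\<^esub> x = \<zero>\<^bsub>complex_alg\<^esub>"
        by (rule bexI[of _ "- x"]) (simp_all add: complex_alg_def)
    qed (simp_all add: complex_alg_def)
    show "comm_monoid complex_alg"
      by (rule comm_monoidI) (simp_all add: complex_alg_def)
  qed (simp_all add: complex_alg_def algebra_simps)
qed (simp_all add: cring_C_field, simp_all add: complex_alg_def algebra_simps)

lemma coord_closed:
  assumes "\<And>i j. i < n \<Longrightarrow> j < n \<Longrightarrow> v $$ (i, j) \<in> C" "\<And>i j. i < n \<Longrightarrow> j < n \<Longrightarrow> \<xi> $$ (i, j) \<in> C"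
  shows "coord (v, \<xi>) \<in> V_coords n \<rightarrow> C"
  using assms by (auto simp: V_coords_def)

lemma subalgebra:
  assumes A: "C_algebra A" and C: "C \<subseteq> carrier A" "\<one>\<^bsub>A\<^esub> \<in> C"
    and closed: "\<And>x y. x \<in> C \<Longrightarrow> y \<in> C \<Longrightarrow> x \<oplus>\<^bsub>A\<^esub> y \<in> C" "\<And>x y. x \<in> C \<Longrightarrow> y \<in> C \<Longrightarrow> x \<otimes>\<^bsub>A\<^esub> y \<in> C"
      "\<And>c x. x \<in> C \<Longrightarrow> c \<odot>\<^bsub>A\<^esub> x \<in> C"
  shows "C_algebra (A\<lparr>carrier := C\<rparr>)"
proof -
  interpret algebra C_field A by (rule A)
  have CA: "x \<in> carrier A" if "x \<in> C" for x using C that by blast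
  have z: "\<zero>\<^bsub>A\<^esub> \<in> C" using closed(3)[OF C(2), of 0] smult_l_null[of "\<one>\<^bsub>A\<^esub>"] by simp
  have inv: "\<exists>y \<in> C. y \<oplus>\<^bsub>A\<^esub> x = \<zero>\<^bsub>A\<^esub>" if "x \<in> C" for x
  proof (rule bexI[OF _ closed(3)[OF that, of "-1"]])
    have "(-1 :: complex) \<odot>\<^bsub>A\<^esub> x \<oplus>\<^bsub>A\<^esub> x = (-1 + 1 :: complex) \<odot>\<^bsub>A\<^esub> x"
      using smult_l_distr[of "-1" 1 x] smult_one[of x] CA[OF that] by simp
    also have "\<dots> = \<zero>\<^bsub>A\<^esub>" using smult_l_null[of x] CA[OF that] by simp
    finally show "(-1 :: complex) \<odot>\<^bsub>A\<^esub> x \<oplus>\<^bsub>A\<^esub> x = \<zero>\<^bsub>A\<^esub>" .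
  qed
  show ?thesis
  proof (rule algebraI)
    show "cring (A\<lparr>carrier := C\<rparr>)"
    proof (rule cringI)
      show "abelian_group (A\<lparr>carrier := C\<rparr>)"
        by (rule abelian_groupI) (use inv in \<open>auto simp: CA z closed M.a_assoc intro: M.a_comm\<close>)
      show "comm_monoid (A\<lparr>carrier := C\<rparr>)"
        by (rule comm_monoidI) (simp_all add: CA C closed m_ac)
    qed (simp add: CA l_distr)
  qed (use smult_l_distr smult_r_distr smult_assoc1 smult_assoc2 smult_one in
      \<open>simp_all add: CA closed cring_C_field\<close>)
qed

lemma algebra_equalizer:
  assumes A: "C_algebra A" and B: "\<And>i. i \<in> I \<Longrightarrow> C_algebra (B i)"
    and f: "\<And>i. i \<in> I \<Longrightarrow> f i \<in> alg_hom A (B i)" and g: "\<And>i. i \<in> I \<Longrightarrow> g i \<in> alg_hom A (B i)"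
  shows "C_algebra (A\<lparr>carrier := {x \<in> carrier A. \<forall>i \<in> I. f i x = g i x}\<rparr>)"
proof -
  interpret algebra C_field A by (rule A)
  note h = f[THEN alg_homD(1)] g[THEN alg_homD(1)]
  show ?thesis
  proof (rule subalgebra[OF A])
    show "\<one>\<^bsub>A\<^esub> \<in> {x \<in> carrier A. \<forall>i\<in>I. f i x = g i x}"
      using ring_hom_one[OF h(1)] ring_hom_one[OF h(2)] by simp
    show "x \<oplus>\<^bsub>A\<^esub> y \<in> {x \<in> carrier A. \<forall>i\<in>I. f i x = g i x}"
      if "x \<in> {x \<in> carrier A. \<forall>i\<in>I. f i x = g i x}" "y \<in> {x \<in> carrier A. \<forall>i\<in>I. f i x = g i x}" for x y
      using that ring_hom_add[OF h(1), of _ x y] ring_hom_add[OF h(2), of _ x y] by simp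
    show "x \<otimes>\<^bsub>A\<^esub> y \<in> {x \<in> carrier A. \<forall>i\<in>I. f i x = g i x}"
      if "x \<in> {x \<in> carrier A. \<forall>i\<in>I. f i x = g i x}" "y \<in> {x \<in> carrier A. \<forall>i\<in>I. f i x = g i x}" for x y
      using that ring_hom_mult[OF h(1), of _ x y] ring_hom_mult[OF h(2), of _ x y] by simp
    show "c \<odot>\<^bsub>A\<^esub> x \<in> {x \<in> carrier A. \<forall>i\<in>I. f i x = g i x}"
      if "x \<in> {x \<in> carrier A. \<forall>i\<in>I. f i x = g i x}" for c x
      using that alg_homD(2)[OF f, of _ x c] alg_homD(2)[OF g, of _ x c] smult_closed[of c x] by simp
  qed blast
qed

lemma algebra_O_V: "C_algebra (O_V n)"
  unfolding O_V_def by (rule algebra_mpoly)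

lemma algebra_O_Z: "C_algebra (O_Z n)"
proof -
  define I :: "(complex mat \<times> complex mat \<times> complex mat) set"
    where "I = SL n \<times> (carrier_mat n n \<times> carrier_mat n n)"
  have V: "coord w \<in> V_coords n \<rightarrow> carrier complex_alg" for w
    by (simp add: complex_alg_def Pi_iff)
  have "C_algebra ((O_V n)\<lparr>carrier := {f \<in> carrier (O_V n). \<forall>i \<in> I.
      aeval complex_alg (coord (SL_act (fst i) (snd i))) f = aeval complex_alg (coord (snd i)) f}\<rparr>)"
    by (rule algebra_equalizer[where B = "\<lambda>_. complex_alg"])
      (simp_all add: algebra_O_V algebra_complex, simp_all add: O_V_def aeval_alg_hom[OF algebra_complex V])
  moreover have "{f \<in> carrier (O_V n). \<forall>i \<in> I.
      aeval complex_alg (coord (SL_act (fst i) (snd i))) f = aeval complex_alg (coord (snd i)) f} = carrier (O_Z n)"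
    unfolding O_Z_def I_def by (auto simp del: coord.simps)
  ultimately show ?thesis by (simp add: O_Z_def)
qed

lemma mpoly_closed_prod:
  "(\<And>i. i \<in> S \<Longrightarrow> f i \<in> carrier (mpoly_alg I)) \<Longrightarrow> prod f S \<in> carrier (mpoly_alg I)"
  by (induction S rule: infinite_finite_induct) auto

lemma mpoly_closed_det:
  assumes A: "A \<in> carrier_mat k k" and e: "\<And>i j. i < k \<Longrightarrow> j < k \<Longrightarrow> A $$ (i, j) \<in> carrier (mpoly_alg I)"
  shows "det A \<in> carrier (mpoly_alg I)"
proof -
  have s: "signof p \<in> carrier (mpoly_alg I)" for p
    by (auto simp: sign_def)
  show ?thesis
    unfolding det_def'[OF A]
  proof (rule mpoly_closed_sum)
    fix p assume "p \<in> {p. p permutes {0..<k}}"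
    then have p: "p permutes {0..<k}" by simp
    have "(\<Prod>i = 0..<k. A $$ (i, p i)) \<in> carrier (mpoly_alg I)"
      by (rule mpoly_closed_prod) (use permutes_in_image[OF p] in \<open>auto intro!: e\<close>)
    then show "signof p * (\<Prod>i = 0..<k. A $$ (i, p i)) \<in> carrier (mpoly_alg I)"
      using s mpoly_closed(5) by blast
  qed
qed

lemma mpoly_closed_mat_mult:
  assumes "A \<in> carrier_mat n n" "B \<in> carrier_mat n n" "i < n" "j < n"
    "\<And>i j. i < n \<Longrightarrow> j < n \<Longrightarrow> A $$ (i, j) \<in> carrier (mpoly_alg I)"
    "\<And>i j. i < n \<Longrightarrow> j < n \<Longrightarrow> B $$ (i, j) \<in> carrier (mpoly_alg I)"
  shows "(A * B) $$ (i, j) \<in> carrier (mpoly_alg I)"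
proof -
  have "(A * B) $$ (i, j) = (\<Sum>k\<in>{0..<n}. A $$ (i, k) * B $$ (k, j))"
    using assms(1-4) by (auto simp: scalar_prod_def intro!: sum.cong)
  also have "\<dots> \<in> carrier (mpoly_alg I)"
    by (rule mpoly_closed_sum) (use assms in auto)
  finally show ?thesis .
qed

lemma generic_closed:
  assumes "i < n" "j < n"
  shows "generic_g n $$ (i, j) \<in> carrier (mpoly_alg (GV_coords n))"
    "fst (generic_w n) $$ (i, j) \<in> carrier (mpoly_alg (GV_coords n))"
    "snd (generic_w n) $$ (i, j) \<in> carrier (mpoly_alg (GV_coords n))"
    "adj_mat (generic_g n) $$ (i, j) \<in> carrier (mpoly_alg (GV_coords n))"
proof -
  have g: "generic_g n $$ (i, j) \<in> carrier (mpoly_alg (GV_coords n))" if "i < n" "j < n" for i j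
    using that by (auto simp: generic_g_def GV_coords_def intro!: mpoly_closed_pvar)
  show "generic_g n $$ (i, j) \<in> carrier (mpoly_alg (GV_coords n))" by (rule g[OF assms])
  show "fst (generic_w n) $$ (i, j) \<in> carrier (mpoly_alg (GV_coords n))"
    "snd (generic_w n) $$ (i, j) \<in> carrier (mpoly_alg (GV_coords n))"
    using assms by (auto simp: generic_w_def GV_coords_def V_coords_def intro!: mpoly_closed_pvar)
  have "det (mat_delete (generic_g n) j i) \<in> carrier (mpoly_alg (GV_coords n))"
  proof (rule mpoly_closed_det[where k = "n - 1"])
    show "mat_delete (generic_g n) j i \<in> carrier_mat (n - 1) (n - 1)"
      by (simp add: mat_delete_def generic_g_def)
    show "mat_delete (generic_g n) j i $$ (i', j') \<in> carrier (mpoly_alg (GV_coords n))"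
      if "i' < n - 1" "j' < n - 1" for i' j'
      using that by (auto simp: mat_delete_def generic_g_def GV_coords_def intro!: mpoly_closed_pvar)
  qed
  moreover have "(- 1) ^ k \<in> carrier (mpoly_alg (GV_coords n))" for k :: nat
    by (induction k) auto
  ultimately show "adj_mat (generic_g n) $$ (i, j) \<in> carrier (mpoly_alg (GV_coords n))"
    using assms by (simp add: adj_mat_def cofactor_def generic_g_def)
qed

lemma ideal_GV: "ideal (GV_ideal n) (mpoly_alg (GV_coords n))"
proof -
  interpret cring "mpoly_alg (GV_coords n)" by (rule cring_mpoly)
  have "det (generic_g n) \<in> carrier (mpoly_alg (GV_coords n))"
    by (rule mpoly_closed_det[where k = n]) (auto intro: generic_closed, simp add: generic_g_def)
  then show ?thesis unfolding GV_ideal_def by (intro genideal_ideal) auto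
qed

lemma algebra_O_GV: "C_algebra (O_GV n)"
  unfolding O_GV_def by (rule algebra_quot_alg[OF algebra_mpoly ideal_GV])

lemma star_hom:
  shows "act_star n \<in> alg_hom (O_V n) (O_GV n)" "proj_star n \<in> alg_hom (O_V n) (O_GV n)"
proof -
  let ?P = "mpoly_alg (GV_coords n)"
  have q: "(+>\<^bsub>?P\<^esub>) (GV_ideal n) \<in> alg_hom ?P (O_GV n)"
    unfolding O_GV_def by (rule coset_alg_hom[OF algebra_mpoly ideal_GV])
  have dims: "generic_g n \<in> carrier_mat n n" "fst (generic_w n) \<in> carrier_mat n n"
    "snd (generic_w n) \<in> carrier_mat n n" "adj_mat (generic_g n) \<in> carrier_mat n n"
    by (simp_all add: generic_g_def generic_w_def adj_mat_def)
  have "coord (SL_act (generic_g n) (generic_w n)) \<in> V_coords n \<rightarrow> carrier ?P"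
    unfolding SL_act_def
    by (rule coord_closed; rule mpoly_closed_mat_mult) (use dims generic_closed in auto)
  then show "act_star n \<in> alg_hom (O_V n) (O_GV n)"
    using alg_hom_comp[OF aeval_alg_hom[OF algebra_mpoly] q] by (simp add: act_star_def[abs_def] O_V_def)
  have "coord (fst (generic_w n), snd (generic_w n)) \<in> V_coords n \<rightarrow> carrier ?P"
    by (rule coord_closed) (use generic_closed in auto)
  then show "proj_star n \<in> alg_hom (O_V n) (O_GV n)"
    using alg_hom_comp[OF aeval_alg_hom[OF algebra_mpoly] q] by (simp add: proj_star_def[abs_def] O_V_def)
qed

lemma algebra_O_Vm_inv: "C_algebra (O_Vm_inv m n)"
  using algebra_equalizer[of "jet_alg m (O_V n)" "UNIV :: unit set" "\<lambda>_. jet_alg m (O_GV n)"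
      "\<lambda>_. jet_map m (O_V n) (O_GV n) (act_star n)" "\<lambda>_. jet_map m (O_V n) (O_GV n) (proj_star n)"]
    algebra_jet[OF algebra_O_V] algebra_jet[OF algebra_O_GV]
  by (simp add: O_Vm_inv_def jet_map(1)[OF algebra_O_V algebra_O_GV star_hom(1)]
      jet_map(1)[OF algebra_O_V algebra_O_GV star_hom(2)])

lemma p_star:
  shows "p_star m n \<in> alg_hom (jet_alg m (O_Z n)) (jet_alg m (O_V n))"
    and "\<And>k f. enat k \<le> m \<Longrightarrow> f \<in> carrier (O_Z n) \<Longrightarrow>
           p_star m n (jet_gen m (O_Z n) k f) = jet_gen m (O_V n) k f"
proof -
  have "(\<lambda>f. f) \<in> alg_hom (O_Z n) (O_V n)"
    by (auto simp: alg_hom_def ring_hom_def O_Z_def)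
  note J = jet_map[OF algebra_O_Z algebra_O_V this, where m = m, folded p_star_def]
  show "p_star m n \<in> alg_hom (jet_alg m (O_Z n)) (jet_alg m (O_V n))" by (rule J(1))
  show "p_star m n (jet_gen m (O_Z n) k f) = jet_gen m (O_V n) k f"
    if "enat k \<le> m" "f \<in> carrier (O_Z n)" for k f
    using that by (rule J(2))
qed

lemma adj_mat_SL:
  assumes "g \<in> SL n"
  shows "g * adj_mat g = 1\<^sub>m n" "adj_mat g * g = 1\<^sub>m n"
  using assms adj_mat[of g n] by (auto simp: SL_def)

end

theory Submission
  imports
    Defs
    "HOL-Computational_Algebra.Formal_Power_Series"
    "HOL-Computational_Algebra.Fraction_Field"
    "HOL-Computational_Algebra.Primes"
    "HOL-Library.Countable"
    "HOL-Library.Product_Lexorder"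
begin

text \<open>
  Write \<open>x = \<xi> v\<close>, \<open>a = det v\<close>, \<open>b = det \<xi>\<close> and let \<open>x\<^sub>k\<close>, \<open>a\<^sub>k\<close>, \<open>b\<^sub>k\<close> be their jets, so that the jets
  \<open>F\<^sub>s\<close> of \<open>det x - a b\<close> vanish on \<open>V\<^sub>m\<close>. For a suitable weight the lightest monomial of \<open>F\<^sub>s\<close> is a
  product \<open>M\<^sub>s\<close> of \<open>n\<close> jets of entries of \<open>x\<close>, and the \<open>M\<^sub>s\<close> are pairwise coprime. Hence modulo the
  relations \<open>F\<^sub>s\<close> the standard monomials, those divisible by no \<open>M\<^sub>s\<close>, span. Their images in
  \<open>\<O>(V\<^sub>m)\<close> have pairwise distinct leading monomials and are therefore linearly independent. This gives
  injectivity of \<open>p\<^sub>m\<^sup>*\<close>, and it shows that its image \<open>R\<close> is free over the polynomial ring in the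
  \<open>a\<^sub>k\<close> and \<open>b\<^sub>k\<close>, so that \<open>a\<^sub>0, b\<^sub>0\<close> is a regular sequence in \<open>R\<close>.

  Let \<open>h\<close> be an invariant. Moving \<open>v\<close> to \<open>diag(a, 1, ..., 1)\<close> by the group shows that \<open>a\<^sub>0^N h\<close> lies in \<open>R\<close>
  for some \<open>N\<close>; symmetrically \<open>b\<^sub>0^M h\<close> lies in \<open>R\<close>. Regularity of \<open>a\<^sub>0, b\<^sub>0\<close> then gives \<open>h \<in> R\<close>. The case
  \<open>m = 0\<close> is the first fundamental theorem, which provides the generators of \<open>\<O>(Z)\<close> used above.

  Finally \<open>R\<close> is the intersection of its fraction field with the polynomial ring \<open>\<O>(V\<^sub>m)\<close>, which is
  integrally closed, so \<open>R\<close> is integrally closed and so are its localizations.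
\<close>

text \<open>In \<open>\<O>(V_m)\<close> the jet of level \<open>k\<close> of the entry
  \<open>(i, j)\<close> of \<open>x\<close> leads with the covector variable
  \<open>(k, i, j)\<close> times the vector variable \<open>(0, j, j)\<close>. So \<open>M_s\<close>
  leads with the covector variables along diagonal \<open>s\<close> times all diagonal vector
  variables of level 0, which is also the leading monomial of \<open>a_0 b_s\<close>. The relation
  \<open>F_s\<close> accounts for this coincidence, and leaving out the multiples of
  \<open>M_s\<close> removes it.

  A polynomial has finitely many variables, so \<open>m = \<infinity>\<close> needs no separate
  treatment. The weights, however, are real numbers and not well-founded; termination of the
  rewriting comes from the finiteness of the set of monomials of given degree and level.

  To place an invariant in \<open>R\<close>, its invariance is used at complex arcs only. The matrix
  computations then take place over \<open>C[[t]]\<close>, where a determinant with nonzero constant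
  term is a unit; this is why \<open>a_0\<close> and \<open>b_0\<close> are the only
  denominators.\<close>

abbreviation (input) "lookup \<equiv> Poly_Mapping.lookup"
abbreviation (input) "keys \<equiv> Poly_Mapping.keys"
abbreviation (input) "single \<equiv> Poly_Mapping.single"
abbreviation (input) "polys I \<equiv> carrier (mpoly_alg I)"


section \<open>Evaluation of polynomials in commutative complex algebras\<close>

text \<open>The statement uses algebras on carriers. Computations with complex numbers, polynomials
  and power series are done in this type class instead; \<open>type_alg\<close> turns its instances
  back into algebras on carriers, so that homomorphisms out of \<open>mpoly_alg\<close> and
  \<open>jet_alg\<close> can take values in them.\<close>

class complex_algebra = comm_ring_1 +
  fixes of_scalar :: "complex \<Rightarrow> 'a"
  assumes of_scalar_1 [simp]: "of_scalar 1 = 1"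
    and of_scalar_add: "of_scalar (a + b) = of_scalar a + of_scalar b"
    and of_scalar_mult: "of_scalar (a * b) = of_scalar a * of_scalar b"

instantiation complex :: complex_algebra
begin
definition of_scalar_complex :: "complex \<Rightarrow> complex" where [simp]: "of_scalar_complex c = c"
instance by standard simp_all
end

instantiation poly_mapping :: (comm_monoid_add, complex_algebra) complex_algebra
begin
definition of_scalar_poly_mapping :: "complex \<Rightarrow> 'a \<Rightarrow>\<^sub>0 'b" where
  "of_scalar_poly_mapping c = single 0 (of_scalar c)"
instance
  by standard (simp_all add: of_scalar_poly_mapping_def of_scalar_add of_scalar_mult single_add mult_single)
end

instantiation fps :: (complex_algebra) complex_algebra
begin
definition of_scalar_fps :: "complex \<Rightarrow> 'a fps" where
  "of_scalar_fps c = fps_const (of_scalar c)"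
instance
  by standard (simp_all add: of_scalar_fps_def of_scalar_add of_scalar_mult)
end

lemma of_scalar_cpoly [simp]: "(of_scalar c :: 'v cpoly) = pconst c"
  by (simp add: of_scalar_poly_mapping_def pconst_def)

locale calg_hom = comm_ring_hom f for f :: "'a :: complex_algebra \<Rightarrow> 'b :: complex_algebra" +
  assumes hom_scalar [simp]: "f (of_scalar c) = of_scalar c"

lemma calg_homI:
  assumes "\<And>x y. f (x + y) = f x + f y" "\<And>x y. f (x * y) = f x * f y"
    "\<And>c. f (of_scalar c) = of_scalar c"
  shows "calg_hom f"
proof
  show "f 1 = 1" using assms(3)[of 1] by simp
  show "f 0 = 0" using assms(1)[of 0 0] by simp
qed (use assms in auto)

lemma calg_hom_comp:
  assumes "calg_hom f" "calg_hom g" shows "calg_hom (\<lambda>x. g (f x))"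
proof -
  interpret f: calg_hom f by fact
  interpret g: calg_hom g by fact
  show ?thesis
    by (rule calg_homI) (simp_all add: f.hom_add g.hom_add f.hom_mult g.hom_mult)
qed

definition type_alg :: "(complex, 'a :: complex_algebra) module" where
  "type_alg = \<lparr>carrier = UNIV, monoid.mult = (*), one = 1, ring.zero = 0, add = (+),
     module.smult = (\<lambda>c x. of_scalar c * x)\<rparr>"

lemma type_alg_simps [simp]:
  "carrier type_alg = UNIV" "a \<otimes>\<^bsub>type_alg\<^esub> b = a * b" "\<one>\<^bsub>type_alg\<^esub> = 1" "\<zero>\<^bsub>type_alg\<^esub> = 0"
  "a \<oplus>\<^bsub>type_alg\<^esub> b = a + b" "c \<odot>\<^bsub>type_alg\<^esub> a = of_scalar c * a"
  by (simp_all add: type_alg_def)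

lemma algebra_type_alg: "C_algebra (type_alg :: (complex, 'a :: complex_algebra) module)"
proof (rule algebraI)
  show "cring (type_alg :: (complex, 'a) module)"
  proof (rule cringI)
    show "abelian_group (type_alg :: (complex, 'a) module)"
    proof (rule abelian_groupI)
      fix x :: 'a
      show "\<exists>y\<in>carrier type_alg. y \<oplus>\<^bsub>type_alg\<^esub> x = \<zero>\<^bsub>type_alg\<^esub>"
        by (rule bexI[of _ "- x"]) simp_all
    qed (simp_all add: algebra_simps)
    show "comm_monoid (type_alg :: (complex, 'a) module)"
      by (rule comm_monoidI) (simp_all add: algebra_simps)
  qed (simp_all add: algebra_simps)
qed (simp_all add: cring_C_field of_scalar_add of_scalar_mult algebra_simps)

lemma alg_hom_type_alg_iff: "f \<in> alg_hom type_alg type_alg \<longleftrightarrow> calg_hom f"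
proof
  assume "calg_hom f"
  then interpret calg_hom f .
  show "f \<in> alg_hom type_alg type_alg"
    by (auto simp: alg_hom_def hom_add hom_mult intro!: ring_hom_memI)
next
  assume f: "f \<in> alg_hom type_alg type_alg"
  then have "f (of_scalar c * 1) = of_scalar c * f 1" for c
    using alg_homD(2)[OF f, of 1 c] by simp
  moreover have "f 1 = 1" using f ring_hom_one[of f type_alg type_alg] by (simp add: alg_hom_def)
  ultimately show "calg_hom f"
    using f by (intro calg_homI) (auto simp: alg_hom_def dest: ring_hom_add ring_hom_mult)
qed

lemma type_alg_complex: "complex_alg = type_alg"
  by (simp add: complex_alg_def type_alg_def fun_eq_iff)

lemma type_alg_mpoly: "mpoly_alg UNIV = (type_alg :: (complex, 'v cpoly) module)"
  by (simp add: mpoly_alg_def type_alg_def fun_eq_iff)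

definition ev :: "('v \<Rightarrow> 'a :: complex_algebra) \<Rightarrow> 'v cpoly \<Rightarrow> 'a" where
  "ev \<phi> = aeval type_alg \<phi>"

lemma ev_alg_hom: "ev \<phi> \<in> alg_hom (mpoly_alg UNIV) type_alg"
  unfolding ev_def by (rule aeval_alg_hom[OF algebra_type_alg]) simp

interpretation ev: calg_hom "ev \<phi>" for \<phi>
  using ev_alg_hom[of \<phi>] unfolding type_alg_mpoly alg_hom_type_alg_iff .

lemma ev_pvar [simp]: "ev \<phi> (pvar v) = \<phi> v"
  unfolding ev_def by (rule aeval_pvar[OF algebra_type_alg, where I = UNIV]) simp_all

lemma ev_pconst [simp]: "ev \<phi> (pconst c) = of_scalar c"
  using ev.hom_scalar[of \<phi> c] by simp

lemma cpoly_alg_hom_eq_ev: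
  assumes "f \<in> alg_hom (mpoly_alg I) type_alg" "\<And>v. v \<in> I \<Longrightarrow> f (pvar v) = \<phi> v" "p \<in> polys I"
  shows "f p = ev \<phi> p"
  unfolding ev_def by (rule alg_hom_mpoly_unique[OF algebra_type_alg _ assms]) simp_all

lemma calg_hom_restrict:
  assumes "calg_hom f" shows "f \<in> alg_hom (mpoly_alg I) type_alg"
proof -
  interpret calg_hom f by fact
  have "f (pconst c) = of_scalar c" for c using hom_scalar[of c] by simp
  then show ?thesis
    by (auto simp: alg_hom_def hom_add hom_mult intro!: ring_hom_memI)
qed

lemma hom_ev:
  assumes "calg_hom f" shows "f (ev \<phi> p) = ev (\<lambda>v. f (\<phi> v)) p"
  by (rule cpoly_alg_hom_eq_ev[where I = UNIV])
     (use calg_hom_restrict[OF calg_hom_comp[OF ev.calg_hom_axioms assms]] in \<open>simp_all add: mem_mpoly_alg\<close>)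

lemma ev_ev: "ev \<psi> (ev \<phi> p) = ev (\<lambda>v. ev \<psi> (\<phi> v)) p"
  by (rule hom_ev[OF ev.calg_hom_axioms])

lemma ev_cong:
  assumes "p \<in> polys I" "\<And>v. v \<in> I \<Longrightarrow> \<phi> v = \<psi> v"
  shows "ev \<phi> p = ev \<psi> p"
  by (rule cpoly_alg_hom_eq_ev[OF calg_hom_restrict[OF ev.calg_hom_axioms] _ assms(1)]) (simp add: assms)

lemma calg_hom_id: "calg_hom (\<lambda>x. x)"
  by (rule calg_homI) simp_all

lemma ev_pvar_id [simp]: "ev pvar p = p"
  using cpoly_alg_hom_eq_ev[OF calg_hom_restrict[OF calg_hom_id], of UNIV pvar p]
  by (simp add: mem_mpoly_alg)

lemma aeval_complex_alg: "aeval complex_alg \<phi> = ev \<phi>"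
  by (simp add: ev_def type_alg_complex)

lemma aeval_mpoly_alg:
  assumes "\<And>v. v \<in> I \<Longrightarrow> \<phi> v \<in> polys J" "p \<in> polys I"
  shows "aeval (mpoly_alg J) \<phi> p = ev \<phi> p"
proof (rule cpoly_alg_hom_eq_ev[OF _ _ assms(2)])
  have \<phi>: "\<phi> \<in> I \<rightarrow> polys J" using assms by auto
  have "(\<lambda>x. x) \<in> alg_hom (mpoly_alg J) type_alg"
    by (rule calg_hom_restrict[OF calg_hom_id])
  from alg_hom_comp[OF aeval_alg_hom[OF algebra_mpoly \<phi>] this]
  show "aeval (mpoly_alg J) \<phi> \<in> alg_hom (mpoly_alg I) type_alg" .
  show "v \<in> I \<Longrightarrow> aeval (mpoly_alg J) \<phi> (pvar v) = \<phi> v" for v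
    by (rule aeval_pvar[OF algebra_mpoly \<phi>])
qed

lemma ev_closed:
  assumes "\<And>v. v \<in> I \<Longrightarrow> \<phi> v \<in> polys J" "p \<in> polys I"
  shows "ev \<phi> p \<in> polys J"
proof -
  have "aeval (mpoly_alg J) \<phi> p \<in> polys J"
    by (rule aeval_closed[OF algebra_mpoly _ assms(2)]) (use assms in auto)
  then show ?thesis by (simp add: aeval_mpoly_alg[OF assms])
qed

lemma poly_mapping_sum_single:
  "(\<Sum>v\<in>keys \<mu>. single v (lookup \<mu> v)) = (\<mu> :: 'a \<Rightarrow>\<^sub>0 'b :: comm_monoid_add)"
proof (rule poly_mapping_eqI)
  fix w
  have "lookup (\<Sum>v\<in>keys \<mu>. single v (lookup \<mu> v)) w
      = (\<Sum>v\<in>keys \<mu>. if v = w then lookup \<mu> v else 0)"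
    unfolding lookup_sum by (rule sum.cong) (auto simp: lookup_single when_def)
  then show "lookup (\<Sum>v\<in>keys \<mu>. single v (lookup \<mu> v)) w
      = lookup \<mu> w"
    by (simp add: in_keys_iff)
qed

lemma prod_single: "(\<Prod>i\<in>A. single (\<mu> i) (1 :: 'b :: comm_semiring_1)) =
   single (\<Sum>i\<in>A. \<mu> i :: 'a :: comm_monoid_add) 1"
  by (induction A rule: infinite_finite_induct) (simp_all add: mult_single)

lemma pvar_power: "pvar v ^ k = (single (single v k) 1 :: 'v cpoly)"
  by (induction k) (simp_all add: pvar_def mult_single single_add[symmetric])

lemma single_eq_prod_pvar:
  "single \<mu> (1 :: complex) = (\<Prod>v\<in>keys \<mu>. pvar v ^ lookup \<mu> v)"
  by (simp add: pvar_power prod_single poly_mapping_sum_single)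

lemma single_eq_pconst_mult: "single \<mu> c = pconst c * single \<mu> (1 :: complex)"
  by (simp add: pconst_def mult_single)

lemma ev_single:
  "ev \<phi> (single \<mu> c) =
     of_scalar c * (\<Prod>v\<in>keys \<mu>. \<phi> v ^ lookup \<mu> v)"
  by (simp add: single_eq_pconst_mult[of \<mu> c] single_eq_prod_pvar ev.hom_mult ev.hom_prod ev.hom_power)

lemma ev_altdef:
  "ev \<phi> p = (\<Sum>\<mu>\<in>keys p. of_scalar (lookup p \<mu>) *
     (\<Prod>v\<in>keys \<mu>. \<phi> v ^ lookup \<mu> v))"
  by (subst poly_mapping_sum_single[of p, symmetric]) (simp only: ev.hom_sum ev_single)

lemma mpoly_alg_induct [consumes 1, case_names const var add mult]:
  assumes p: "p \<in> polys I"
    and const: "\<And>c. P (pconst c)" and var: "\<And>v. v \<in> I \<Longrightarrow> P (pvar v)"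
    and add: "\<And>p q. p \<in> polys I \<Longrightarrow> q \<in> polys I \<Longrightarrow> P p \<Longrightarrow> P q \<Longrightarrow> P (p + q)"
    and mult: "\<And>p q. p \<in> polys I \<Longrightarrow> q \<in> polys I \<Longrightarrow> P p \<Longrightarrow> P q \<Longrightarrow> P (p * q)"
  shows "P p"
  using p
proof (induction p rule: mpoly_induct)
  case (single \<mu> c)
  have one: "P 1" using const[of 1] by simp
  have pow: "pvar v ^ k \<in> polys I \<and> P (pvar v ^ k)" if "v \<in> I" for v k
    using that by (induction k) (use one var mult in auto)
  have "(\<Prod>v\<in>S. pvar v ^ lookup \<mu> v) \<in> polys I \<and>
      P (\<Prod>v\<in>S. pvar v ^ lookup \<mu> v)" if "S \<subseteq> I" for S
    using that by (induction S rule: infinite_finite_induct) (use one mult pow in auto)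
  from this[OF single] show ?case
    unfolding single_eq_pconst_mult[of \<mu> c] single_eq_prod_pvar using const mult by blast
qed (use add in auto)

text \<open>
  The primes give an injective homomorphism from the monomials in countably many variables to the
  positive integers: a monomial order which is a well-order, and separating points.
\<close>

definition var_prime :: "'v :: countable \<Rightarrow> nat" where
  "var_prime v = enumerate {p. Factorial_Ring.prime p} (to_nat v)"

lemma prime_var_prime: "Factorial_Ring.prime (var_prime v)"
  using enumerate_in_set[OF primes_infinite, of "to_nat v"] by (simp add: var_prime_def)

lemma inj_var_prime: "var_prime v = var_prime w \<longleftrightarrow> v = w"
  using strict_mono_eq[OF strict_mono_enumerate[OF primes_infinite], of "to_nat v" "to_nat w"]
  by (simp add: var_prime_def)

definition mono_num :: "('v :: countable \<Rightarrow>\<^sub>0 nat) \<Rightarrow> nat" where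
  "mono_num \<mu> = (\<Prod>v\<in>keys \<mu>. var_prime v ^ lookup \<mu> v)"

lemma multiplicity_mono_num: "multiplicity (var_prime v) (mono_num \<mu>) = lookup \<mu> v"
proof -
  let ?K = "keys \<mu>"
  have inj: "inj_on var_prime ?K" by (auto simp: inj_on_def inj_var_prime)
  define f where "f p = lookup \<mu> (inv_into ?K var_prime p)" for p
  have "mono_num \<mu> = (\<Prod>p\<in>var_prime ` ?K. p ^ f p)"
    unfolding mono_num_def by (subst prod.reindex[OF inj]) (auto simp: f_def inv_into_f_f[OF inj] intro!: prod.cong)
  then have "multiplicity (var_prime v) (mono_num \<mu>) = (if var_prime v \<in> var_prime ` ?K then f (var_prime v) else 0)"
    by (auto simp del: image_eqI simp: prime_var_prime intro!: trans[OF multiplicity_prod_prime_powers])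
  also have "\<dots> = lookup \<mu> v"
    by (auto simp: f_def inv_into_f_f[OF inj] inj_var_prime in_keys_iff image_iff)
  finally show ?thesis .
qed

lemma inj_mono_num: "mono_num \<mu> = mono_num \<nu> \<longleftrightarrow> \<mu> = \<nu>"
  by (metis multiplicity_mono_num poly_mapping_eqI)

text \<open>At the point whose coordinate at \<open>v\<close> is \<open>var_prime v ^ s\<close>, a
  monomial takes the value \<open>mono_num \<nu> ^ s\<close>. Distinct monomials have distinct
  numbers, so vanishing for all \<open>s\<close> kills the coefficients by a Vandermonde
  argument.\<close>

lemma cpoly_eq_0I:
  fixes p :: "'v :: countable cpoly"
  assumes p: "\<And>z. ev z p = (0 :: complex)"
  shows "p = 0"
proof (rule ccontr)
  assume "p \<noteq> 0"
  then obtain \<mu> where \<mu>: "\<mu> \<in> keys p" by fastforce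
  let ?c = "lookup p"
  have pw: "(\<Sum>\<nu>\<in>keys p. ?c \<nu> * of_nat (mono_num \<nu>) ^ s) = 0" for s
  proof -
    have e: "(\<Prod>v\<in>keys \<nu>. (of_nat (var_prime v) ^ s) ^ lookup \<nu> v) =
      (of_nat (mono_num \<nu>) ^ s :: complex)" for \<nu>
      by (simp add: mono_num_def prod_power_distrib power_mult[symmetric] mult.commute)
    then show ?thesis
      using p[of "\<lambda>v. of_nat (var_prime v) ^ s"] unfolding ev_altdef of_scalar_complex_def e by blast
  qed
  have P: "(\<Sum>\<nu>\<in>keys p. ?c \<nu> * poly q (of_nat (mono_num \<nu>))) = 0" for q
  proof -
    have "(\<Sum>\<nu>\<in>keys p. ?c \<nu> * poly q (of_nat (mono_num \<nu>))) =
       (\<Sum>i\<le>Polynomial.degree q. Polynomial.coeff q i * (\<Sum>\<nu>\<in>keys p. ?c \<nu> * of_nat (mono_num \<nu>) ^ i))"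
      unfolding poly_altdef sum_distrib_left by (subst sum.swap) (simp add: mult_ac)
    then show ?thesis by (simp add: pw)
  qed
  \<comment> \<open>\<open>q\<close> vanishes at the numbers of all monomials of \<open>p\<close>
    except \<open>\<mu>\<close>, so inserting it into \<open>P\<close> isolates the coefficient of
    \<open>\<mu>\<close>.\<close>
  define q where "q = (\<Prod>\<nu>\<in>keys p - {\<mu>}. [:- of_nat (mono_num \<nu>), 1 :: complex:])"
  have "poly q (of_nat (mono_num \<nu>)) = 0" if "\<nu> \<in> keys p - {\<mu>}" for \<nu>
    unfolding q_def poly_prod by (rule prod_zero[OF _ bexI[OF _ that]]) simp_all
  then have "(\<Sum>\<nu>\<in>keys p. ?c \<nu> * poly q (of_nat (mono_num \<nu>))) = ?c \<mu> * poly q (of_nat (mono_num \<mu>))"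
    using \<mu> by (subst sum.remove[OF _ \<mu>]) simp_all
  moreover have "poly q (of_nat (mono_num \<mu>)) \<noteq> 0"
    unfolding q_def poly_prod by (auto simp: prod_zero_iff inj_mono_num)
  ultimately show False using P[of q] \<mu> by (simp add: in_keys_iff)
qed

section \<open>Jets\<close>

definition arc_var :: "'v \<Rightarrow> (nat \<times> 'v) cpoly fps" where
  "arc_var v = Abs_fps (\<lambda>k. pvar (k, v))"

text \<open>The maps \<open>jetc k\<close> form the universal Hasse-Schmidt derivation of the
  polynomial ring; \<open>jetc_mult\<close> is its Leibniz rule.\<close>

definition jetc :: "nat \<Rightarrow> 'v cpoly \<Rightarrow> (nat \<times> 'v) cpoly" where
  "jetc k f = fps_nth (ev arc_var f) k"

lemma jetc_simps [simp]:
  "jetc k (pvar v) = pvar (k, v)" "jetc k (f + g) = jetc k f + jetc k g" "jetc k (f - g) = jetc k f - jetc k g"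
  "jetc k (pconst c) = (if k = 0 then pconst c else 0)"
  by (simp_all add: jetc_def arc_var_def ev.hom_add ev.hom_minus of_scalar_fps_def)

lemma jetc_mult: "jetc k (f * g) = (\<Sum>i\<le>k. jetc i f * jetc (k - i) g)"
  by (simp add: jetc_def ev.hom_mult fps_mult_nth atLeast0AtMost)

lemma calg_hom_fps_map:
  assumes "calg_hom f" shows "calg_hom (\<lambda>F. Abs_fps (\<lambda>k. f (fps_nth F k)))"
proof -
  interpret calg_hom f by fact
  show ?thesis
    by (rule calg_homI) (auto simp: fps_eq_iff fps_mult_nth hom_add hom_sum hom_mult of_scalar_fps_def)
qed

lemma ev_jetc: "ev z (jetc k f) = fps_nth (ev (\<lambda>v. Abs_fps (\<lambda>k. z (k, v))) f) k"
proof -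
  have "Abs_fps (\<lambda>k. ev z (fps_nth (ev arc_var f) k)) = ev (\<lambda>v. Abs_fps (\<lambda>k. ev z (fps_nth (arc_var v) k))) f"
    by (rule hom_ev[OF calg_hom_fps_map[OF ev.calg_hom_axioms]])
  from arg_cong[OF this, of "\<lambda>F. fps_nth F k"] show ?thesis
    by (simp add: jetc_def arc_var_def)
qed

abbreviation jvars :: "enat \<Rightarrow> 'v set \<Rightarrow> (nat \<times> 'v) set" where
  "jvars m I \<equiv> {k. enat k \<le> m} \<times> I"

lemma enat_le_mono: "enat k \<le> m \<Longrightarrow> i \<le> k \<Longrightarrow> enat i \<le> m"
  by (metis enat_ord_simps(1) order_trans)

lemma jetc_closed:
  assumes "f \<in> polys I" "enat k \<le> m"
  shows "jetc k f \<in> polys (jvars m I)"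
  using assms
proof (induction f arbitrary: k rule: mpoly_alg_induct)
  case (mult p q)
  show ?case
    unfolding jetc_mult
    by (intro mpoly_closed_sum mpoly_closed(5) mult.IH) (use mult.prems in \<open>auto intro: enat_le_mono\<close>)
qed auto

section \<open>Presenting jet algebras by the jets of algebra generators\<close>

lemma aeval_sum:
  assumes B: "C_algebra B" and \<phi>: "\<phi> \<in> I \<rightarrow> carrier B" and f: "\<And>i. i \<in> S \<Longrightarrow> f i \<in> polys I"
    and "finite S"
  shows "aeval B \<phi> (\<Sum>i\<in>S. f i) = (\<Oplus>\<^bsub>B\<^esub>i\<in>S. aeval B \<phi> (f i))"
proof -
  interpret B: algebra C_field B by (rule B)
  have "aeval B \<phi> (pconst 0) = \<zero>\<^bsub>B\<^esub>"
    using aeval_pconst[OF B \<phi>, of 0] B.smult_l_null[of "\<one>\<^bsub>B\<^esub>"] by simp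
  with \<open>finite S\<close> f show ?thesis
  proof (induction S)
    case (insert x F)
    then show ?case
      by (simp add: aeval_add[OF B \<phi>] mpoly_closed_sum aeval_closed[OF B \<phi>] Pi_iff)
  qed simp
qed

lemma finsum_type_alg [simp]:
  "(\<Oplus>\<^bsub>type_alg\<^esub>i\<in>S. f i :: 'b :: complex_algebra) = (\<Sum>i\<in>S. f i)"
proof (induction S rule: infinite_finite_induct)
  case (insert x F)
  interpret algebra C_field "type_alg :: (complex, 'b) module" by (rule algebra_type_alg)
  show ?case using insert by simp
qed (simp_all add: finsum_def finprod_def)

lemma jet_gen_props:
  assumes A: "C_algebra A" and k: "enat k \<le> m" and a: "a \<in> carrier A"
  shows "jet_gen m A k a \<in> carrier (jet_alg m A)"
    "\<And>b. b \<in> carrier A \<Longrightarrow> jet_gen m A k (a \<oplus>\<^bsub>A\<^esub> b) = jet_gen m A k a \<oplus>\<^bsub>jet_alg m A\<^esub> jet_gen m A k b"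
    "\<And>b. b \<in> carrier A \<Longrightarrow> jet_gen m A k (a \<otimes>\<^bsub>A\<^esub> b) =
      (\<Oplus>\<^bsub>jet_alg m A\<^esub>i\<in>{..k}. jet_gen m A i a \<otimes>\<^bsub>jet_alg m A\<^esub> jet_gen m A (k - i) b)"
    "jet_gen m A k (c \<odot>\<^bsub>A\<^esub> a) = c \<odot>\<^bsub>jet_alg m A\<^esub> jet_gen m A k a"
    "jet_gen m A k \<one>\<^bsub>A\<^esub> = (if k = 0 then \<one>\<^bsub>jet_alg m A\<^esub> else \<zero>\<^bsub>jet_alg m A\<^esub>)"
  using jet_arc_hom[OF A, of m, unfolded arc_hom_iff[OF A algebra_jet[OF A]]] k a by blast+

text \<open>\<open>jet_alg\<close> has one generator for each level and each element of
  \<open>A\<close>. If the \<open>\<phi> v\<close> generate \<open>A\<close>, this map presents the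
  same algebra by the jets of these generators alone; see \<open>jet_pres_surj\<close>.\<close>

definition jet_pres :: "enat \<Rightarrow> (complex, 'a, 'm) module_scheme \<Rightarrow> ('v \<Rightarrow> 'a) \<Rightarrow>
    (nat \<times> 'v) cpoly \<Rightarrow> (nat \<times> 'a) cpoly set" where
  "jet_pres m A \<phi> = aeval (jet_alg m A) (\<lambda>(k, v). jet_gen m A k (\<phi> v))"

context
  fixes m :: enat and A :: "(complex, 'a, 'm) module_scheme" and \<phi> :: "'v \<Rightarrow> 'a" and I :: "'v set"
  assumes A: "C_algebra A" and \<phi>: "\<phi> \<in> I \<rightarrow> carrier A"
begin

lemma jet_pres_var: "(\<lambda>(k, v). jet_gen m A k (\<phi> v)) \<in> jvars m I \<rightarrow> carrier (jet_alg m A)"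
  using jet_gen_props(1)[OF A] \<phi> by auto

lemma jet_pres_alg_hom: "jet_pres m A \<phi> \<in> alg_hom (mpoly_alg (jvars m I)) (jet_alg m A)"
  unfolding jet_pres_def by (rule aeval_alg_hom[OF algebra_jet[OF A] jet_pres_var])

lemma jet_pres_jetc:
  assumes "f \<in> polys I" "enat k \<le> m"
  shows "jet_pres m A \<phi> (jetc k f) = jet_gen m A k (aeval A \<phi> f)"
  using assms
proof (induction f arbitrary: k rule: mpoly_alg_induct)
  case (const c)
  interpret A: algebra C_field A by (rule A)
  interpret J: algebra C_field "jet_alg m A" by (rule algebra_jet[OF A])
  have "pconst 0 = (0 :: (nat \<times> 'v) cpoly)" by simp
  then have z: "jet_pres m A \<phi> 0 = \<zero>\<^bsub>jet_alg m A\<^esub>"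
    using aeval_pconst[OF algebra_jet[OF A] jet_pres_var, of 0] J.smult_l_null[of "\<one>\<^bsub>jet_alg m A\<^esub>"]
    by (simp add: jet_pres_def)
  have "jet_gen m A k (aeval A \<phi> (pconst c)) = c \<odot>\<^bsub>jet_alg m A\<^esub> jet_gen m A k \<one>\<^bsub>A\<^esub>"
    using jet_gen_props(4)[OF A const, of "\<one>\<^bsub>A\<^esub>" c] by (simp add: aeval_pconst[OF A \<phi>])
  also have "\<dots> = jet_pres m A \<phi> (jetc k (pconst c))"
    using jet_gen_props(5)[OF A const A.one_closed] z aeval_pconst[OF algebra_jet[OF A] jet_pres_var, of c]
    by (simp add: jet_pres_def)
  finally show ?case by simp
next
  case (var v)
  then show ?case
    using aeval_pvar[OF algebra_jet[OF A] jet_pres_var, of "(k, v)"] aeval_pvar[OF A \<phi>, of v]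
    by (simp add: jet_pres_def)
next
  case (add p q)
  have c: "aeval A \<phi> p \<in> carrier A" "aeval A \<phi> q \<in> carrier A"
    using aeval_closed[OF A \<phi>] add by auto
  show ?case
    using add aeval_add[OF algebra_jet[OF A] jet_pres_var, of "jetc k p" "jetc k q"] jetc_closed[of _ I k m]
      jet_gen_props(2)[OF A add.prems c]
    by (simp add: jet_pres_def aeval_add[OF A \<phi>])
next
  case (mult p q)
  interpret J: algebra C_field "jet_alg m A" by (rule algebra_jet[OF A])
  have c: "aeval A \<phi> p \<in> carrier A" "aeval A \<phi> q \<in> carrier A"
    using aeval_closed[OF A \<phi>] mult by auto
  have le: "enat i \<le> m" "enat (k - i) \<le> m" if "i \<le> k" for i
    using that mult.prems enat_le_mono by auto
  have cl: "jetc i p \<in> polys (jvars m I)" "jetc (k - i) q \<in> polys (jvars m I)"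
    if "i \<le> k" for i
    using jetc_closed mult.hyps le[OF that] by blast+
  have "jet_pres m A \<phi> (jetc k (p * q)) = (\<Oplus>\<^bsub>jet_alg m A\<^esub>i\<in>{..k}. jet_pres m A \<phi> (jetc i p * jetc (k - i) q))"
    unfolding jetc_mult jet_pres_def
    by (rule aeval_sum[OF algebra_jet[OF A] jet_pres_var]) (use cl in auto)
  also have "\<dots> = (\<Oplus>\<^bsub>jet_alg m A\<^esub>i\<in>{..k}. jet_gen m A i (aeval A \<phi> p) \<otimes>\<^bsub>jet_alg m A\<^esub> jet_gen m A (k - i) (aeval A \<phi> q))"
  proof (rule J.add.finprod_cong')
    show "(\<lambda>i. jet_gen m A i (aeval A \<phi> p) \<otimes>\<^bsub>jet_alg m A\<^esub> jet_gen m A (k - i) (aeval A \<phi> q)) \<in> {..k} \<rightarrow> carrier (jet_alg m A)"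
      using le c jet_gen_props(1)[OF A] by auto
    fix i assume "i \<in> {..k}"
    then have i: "i \<le> k" by simp
    show "jet_pres m A \<phi> (jetc i p * jetc (k - i) q) =
        jet_gen m A i (aeval A \<phi> p) \<otimes>\<^bsub>jet_alg m A\<^esub> jet_gen m A (k - i) (aeval A \<phi> q)"
      using aeval_mult[OF algebra_jet[OF A] jet_pres_var cl[OF i]] mult.IH le[OF i]
      by (simp add: jet_pres_def)
  qed simp
  also have "\<dots> = jet_gen m A k (aeval A \<phi> (p * q))"
    using jet_gen_props(3)[OF A mult.prems c] aeval_mult[OF A \<phi> mult.hyps] by simp
  finally show ?case .
qed

lemma jet_pres_surj:
  assumes gen: "\<And>a. a \<in> carrier A \<Longrightarrow> \<exists>f \<in> polys I. a = aeval A \<phi> f"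
    and U: "U \<in> carrier (jet_alg m A)"
  shows "\<exists>Q \<in> polys (jvars m I). U = jet_pres m A \<phi> Q"
proof -
  let ?P = "mpoly_alg (jet_vars m A)"
  note I = jet_ideal[OF A, of m]
  let ?q = "(+>\<^bsub>?P\<^esub>) (jet_ideal m A)"
  have q: "?q \<in> alg_hom ?P (jet_alg m A)"
    unfolding jet_alg_def by (rule coset_alg_hom[OF algebra_mpoly I])
  note h = jet_pres_alg_hom
  note H = ring_hom_add[OF alg_homD(1)[OF h]] ring_hom_mult[OF alg_homD(1)[OF h]]
  note Q = ring_hom_add[OF alg_homD(1)[OF q]] ring_hom_mult[OF alg_homD(1)[OF q]]
  obtain p where p: "p \<in> carrier ?P" "U = ?q p"
    using U unfolding jet_alg_def quot_alg_elem[OF algebra_mpoly I] by blast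
  from p(1) have "\<exists>Q \<in> polys (jvars m I). ?q p = jet_pres m A \<phi> Q"
  proof (induction p rule: mpoly_alg_induct)
    case (const c)
    have "?q (pconst c) = jet_pres m A \<phi> (pconst c)"
      using alg_homD(2)[OF q, of 1 c] alg_homD(2)[OF h, of 1 c]
        ring_hom_one[OF alg_homD(1)[OF h]] ring_hom_one[OF alg_homD(1)[OF q]] by simp
    then show ?case by blast
  next
    case (var w)
    then obtain k a where w: "w = (k, a)" "enat k \<le> m" "a \<in> carrier A" by (auto simp: jet_vars_def)
    obtain f where f: "f \<in> polys I" "a = aeval A \<phi> f" using gen[OF w(3)] by blast
    show ?case
      using jet_pres_jetc[OF f(1) w(2)] jetc_closed[OF f(1) w(2)] f(2) w(1)
      by (auto simp: jet_gen_def)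
  next
    case (add p q)
    then show ?case using H(1) Q(1) by (metis mpoly_alg_simps(4) mpoly_closed(4))
  next
    case (mult p q)
    then show ?case using H(2) Q(2) by (metis mpoly_alg_simps(1) mpoly_closed(5))
  qed
  then show ?thesis using p(2) by simp
qed

end

text \<open>A homomorphism from \<open>A\<close> to power series is an arc of \<open>Spec A\<close>;
  its coefficients of order at most \<open>m\<close> define a point of the jet scheme with values in
  \<open>'r\<close>.\<close>

definition jet_eval :: "enat \<Rightarrow> (complex, 'a, 'm) module_scheme \<Rightarrow> ('a \<Rightarrow> 'r :: complex_algebra fps) \<Rightarrow>
    (nat \<times> 'a) cpoly set \<Rightarrow> 'r" where
  "jet_eval m A h U = the_elem (aeval type_alg (\<lambda>(k, a). fps_nth (h a) k) ` U)"

lemma jet_eval: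
  fixes h :: "'a \<Rightarrow> 'r :: complex_algebra fps"
  assumes A: "C_algebra A" and h: "h \<in> alg_hom A type_alg"
  shows "jet_eval m A h \<in> alg_hom (jet_alg m A) type_alg"
    "\<And>k a. enat k \<le> m \<Longrightarrow> a \<in> carrier A \<Longrightarrow> jet_eval m A h (jet_gen m A k a) = fps_nth (h a) k"
proof -
  have "fps_nth (h (a \<otimes>\<^bsub>A\<^esub> b)) k = (\<Sum>i\<le>k. fps_nth (h a) i * fps_nth (h b) (k - i))"
    if "a \<in> carrier A" "b \<in> carrier A" for a b k
    using ring_hom_mult[OF alg_homD(1)[OF h] that] by (simp add: fps_mult_nth atLeast0AtMost)
  then have "arc m (type_alg :: (complex, 'r) module) (\<lambda>k a. fps_nth (h a) k) \<in> alg_hom A (trunc_alg m type_alg)"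
    unfolding arc_hom_iff[OF A algebra_type_alg]
    using ring_hom_add[OF alg_homD(1)[OF h]] ring_hom_one[OF alg_homD(1)[OF h]] alg_homD(2)[OF h]
    by (simp add: of_scalar_fps_def)
  note L = jet_lift[OF A algebra_type_alg this]
  have e: "jet_eval m A h = (\<lambda>U. the_elem (aeval type_alg (\<lambda>(k, a). fps_nth (h a) k) ` U))"
    by (auto simp: jet_eval_def)
  show "jet_eval m A h \<in> alg_hom (jet_alg m A) type_alg" unfolding e by (rule L(1))
  show "jet_eval m A h (jet_gen m A k a) = fps_nth (h a) k" if "enat k \<le> m" "a \<in> carrier A" for k a
    unfolding e by (rule L(2)[OF that])
qed

section \<open>Leading monomials\<close>

definition wt :: "('v \<Rightarrow> real) \<Rightarrow> ('v \<Rightarrow>\<^sub>0 nat) \<Rightarrow> real" where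
  "wt w \<mu> = (\<Sum>v\<in>keys \<mu>. real (lookup \<mu> v) * w v)"

lemma wt_superset:
  assumes "finite S" "keys \<mu> \<subseteq> S"
  shows "wt w \<mu> = (\<Sum>v\<in>S. real (lookup \<mu> v) * w v)"
  unfolding wt_def by (rule sum.mono_neutral_left) (use assms in \<open>auto simp: in_keys_iff\<close>)

lemma wt_0 [simp]: "wt w 0 = 0"
  by (simp add: wt_def)

lemma wt_add: "wt w (\<mu> + \<nu>) = wt w \<mu> + wt w \<nu>"
proof -
  let ?S = "keys \<mu> \<union> keys \<nu>"
  have "wt w (\<mu> + \<nu>) = (\<Sum>v\<in>?S. real (lookup (\<mu> + \<nu>) v) * w v)"
    by (rule wt_superset) (use Poly_Mapping.keys_add[of \<mu> \<nu>] in auto)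
  also have "\<dots> = wt w \<mu> + wt w \<nu>"
    using wt_superset[of ?S \<mu> w] wt_superset[of ?S \<nu> w]
    by (simp add: lookup_add algebra_simps sum.distrib)
  finally show ?thesis .
qed

lemma wt_single [simp]: "wt w (single v k) = real k * w v"
  by (simp add: wt_def)

lemma wt_sum: "wt w (\<Sum>i\<in>A. \<mu> i) = (\<Sum>i\<in>A. wt w (\<mu> i))"
  by (induction A rule: infinite_finite_induct) (simp_all add: wt_add)

lemma wt_nonneg: "(\<And>v. v \<in> keys \<mu> \<Longrightarrow> 0 \<le> w v) \<Longrightarrow> 0 \<le> wt w \<mu>"
  unfolding wt_def by (intro sum_nonneg) simp

lemma lookup_times_le_wt:
  assumes "\<And>v. 0 \<le> w v" shows "real (lookup \<mu> v) * w v \<le> wt w \<mu>"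
proof (cases "v \<in> keys \<mu>")
  case True
  then show ?thesis
    unfolding wt_def
    by (rule member_le_sum[where f = "\<lambda>v. real (lookup \<mu> v) * w v"]) (use assms in auto)
next
  case False
  then show ?thesis using wt_nonneg[of \<mu> w] assms by (simp add: in_keys_iff)
qed

text \<open>The weight need not separate monomials; leading means strictly lighter than all others.\<close>

definition lead :: "('v \<Rightarrow> real) \<Rightarrow> 'v cpoly \<Rightarrow> ('v \<Rightarrow>\<^sub>0 nat) \<Rightarrow> bool" where
  "lead w p \<mu> \<longleftrightarrow> lookup p \<mu> \<noteq> 0 \<and>
     (\<forall>\<nu> \<in> keys p. \<nu> \<noteq> \<mu> \<longrightarrow> wt w \<mu> < wt w \<nu>)"

lemma leadI:
  assumes p: "p = single \<mu> c + r" and "c \<noteq> 0" and r: "\<And>\<nu>. \<nu> \<in> keys r \<Longrightarrow> wt w \<mu> < wt w \<nu>"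
  shows "lead w p \<mu>"
proof -
  have "lookup r \<mu> = 0" using r[of \<mu>] by (auto simp: in_keys_iff)
  then show ?thesis
    using \<open>c \<noteq> 0\<close> r unfolding lead_def p
    by (auto simp: lookup_add lookup_single when_def in_keys_iff split: if_splits)
qed

lemma leadD:
  assumes "lead w p \<mu>"
  shows "\<exists>c r. p = single \<mu> c + r \<and> c \<noteq> 0 \<and> (\<forall>\<nu> \<in> keys r. wt w \<mu> < wt w \<nu>)"
proof (intro exI conjI ballI)
  let ?c = "lookup p \<mu>"
  show "p = single \<mu> ?c + (p - single \<mu> ?c)" by simp
  show "?c \<noteq> 0" using assms by (simp add: lead_def)
  show "wt w \<mu> < wt w \<nu>" if "\<nu> \<in> keys (p - single \<mu> ?c)" for \<nu>
    using assms that by (cases "\<nu> = \<mu>") (auto simp: lead_def in_keys_iff lookup_minus lookup_single when_def)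
qed

lemma keys_multE:
  assumes "\<kappa> \<in> keys (p * q)"
  obtains \<mu> \<nu> where "\<mu> \<in> keys p" "\<nu> \<in> keys q" "\<kappa> = \<mu> + \<nu>"
  using subsetD[OF Poly_Mapping.keys_mult assms] by (elim CollectE exE conjE)

lemma lead_mult:
  assumes "lead w p \<mu>" "lead w q \<nu>" shows "lead w (p * q) (\<mu> + \<nu>)"
proof -
  from leadD[OF assms(1)] obtain c r where p: "p = single \<mu> c + r" "c \<noteq> 0"
    and r: "\<forall>\<nu> \<in> keys r. wt w \<mu> < wt w \<nu>" by (elim exE conjE)
  from leadD[OF assms(2)] obtain d s where q: "q = single \<nu> d + s" "d \<noteq> 0"
    and s: "\<forall>\<kappa> \<in> keys s. wt w \<nu> < wt w \<kappa>" by (elim exE conjE)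
  have q': "wt w \<nu> \<le> wt w \<kappa>" if "\<kappa> \<in> keys q" for \<kappa>
    using assms(2) that unfolding lead_def by (cases "\<kappa> = \<nu>") auto
  show ?thesis
  proof (rule leadI)
    show "p * q = single (\<mu> + \<nu>) (c * d) + (single \<mu> c * s + r * q)"
      unfolding p(1) q(1) by (simp add: algebra_simps mult_single)
    show "c * d \<noteq> 0" using p q by simp
    fix \<kappa> assume "\<kappa> \<in> keys (single \<mu> c * s + r * q)"
    from subsetD[OF Poly_Mapping.keys_add this]
    have "\<kappa> \<in> keys (single \<mu> c * s) \<or> \<kappa> \<in> keys (r * q)"
      by simp
    then show "wt w (\<mu> + \<nu>) < wt w \<kappa>"
    proof
      assume "\<kappa> \<in> keys (single \<mu> c * s)"
      then obtain a b where "a \<in> keys (single \<mu> c)" "b \<in> keys s" "\<kappa> = a + b"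
        by (rule keys_multE)
      then show ?thesis using s by (auto simp: wt_add split: if_splits)
    next
      assume "\<kappa> \<in> keys (r * q)"
      then obtain a b where "a \<in> keys r" "b \<in> keys q" "\<kappa> = a + b"
        by (rule keys_multE)
      then show ?thesis using r q'[of b] by (auto simp: wt_add intro: add_less_le_mono)
    qed
  qed
qed

lemma lead_one [simp]: "lead w 1 0"
  by (simp add: lead_def lookup_one)

lemma lead_single: "c \<noteq> 0 \<Longrightarrow> lead w (single \<mu> c) \<mu>"
  by (rule leadI[where r = 0]) simp_all

lemma lead_prod:
  assumes "\<And>i. i \<in> A \<Longrightarrow> lead w (p i) (\<mu> i)" shows "lead w (\<Prod>i\<in>A. p i) (\<Sum>i\<in>A. \<mu> i)"
  using assms by (induction A rule: infinite_finite_induct) (auto intro: lead_mult)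

lemma lead_power: "lead w p \<mu> \<Longrightarrow> lead w (p ^ k) (\<Sum>i<k. \<mu>)"
  using lead_prod[of "{..<k}" w "\<lambda>_. p" "\<lambda>_. \<mu>"] by simp

lemma lead_sum_single:
  assumes "finite A" "i \<in> A" "c i \<noteq> 0" "\<And>j. j \<in> A \<Longrightarrow> j \<noteq> i \<Longrightarrow> wt w (\<mu> i) < wt w (\<mu> j)"
  shows "lead w (\<Sum>j\<in>A. single (\<mu> j) (c j)) (\<mu> i)"
proof (rule leadI)
  show "(\<Sum>j\<in>A. single (\<mu> j) (c j)) =
    single (\<mu> i) (c i) + (\<Sum>j\<in>A - {i}. single (\<mu> j) (c j))"
    by (rule sum.remove[OF assms(1,2)])
  fix \<nu> assume "\<nu> \<in> keys (\<Sum>j\<in>A - {i}. single (\<mu> j) (c j))"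
  from subsetD[OF Poly_Mapping.keys_sum this]
  obtain j where "j \<in> A - {i}" "\<nu> \<in> keys (single (\<mu> j) (c j))"
    by (elim UN_E)
  then show "wt w (\<mu> i) < wt w \<nu>" using assms(4)[of j] by (auto split: if_splits)
qed (use assms in auto)

lemma lookup_single_mult:
  "lookup (single \<nu> c * (p :: 'v cpoly)) (\<nu> + \<mu>) = c * lookup p \<mu>"
proof -
  have "single \<nu> c * p =
      (\<Sum>\<kappa>\<in>keys p. single (\<nu> + \<kappa>) (c * lookup p \<kappa>))"
    by (subst poly_mapping_sum_single[of p, symmetric]) (simp only: sum_distrib_left mult_single)
  then have "lookup (single \<nu> c * p) (\<nu> + \<mu>) =
      (\<Sum>\<kappa>\<in>keys p. if \<kappa> = \<mu> then c * lookup p \<kappa> else 0)"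
    by (auto simp: lookup_sum lookup_single when_def intro!: sum.cong)
  then show ?thesis by (simp add: in_keys_iff)
qed

text \<open>Among the indices with nonzero coefficient take one whose leading monomial is lightest.
  No other summand with nonzero coefficient contains this monomial, because its own leading monomial
  is different and not lighter.\<close>

lemma lead_independent:
  assumes "finite A" and lead: "\<And>i. i \<in> A \<Longrightarrow> lead w (p i) (\<mu> i)" and inj: "inj_on \<mu> A"
    and 0: "(\<Sum>i\<in>A. pconst (c i) * p i) = 0" and i: "i \<in> A"
  shows "c i = 0"
proof (rule ccontr)
  assume "c i \<noteq> 0"
  let ?B = "{i \<in> A. c i \<noteq> 0}"
  have "finite ?B" "?B \<noteq> {}" using \<open>finite A\<close> i \<open>c i \<noteq> 0\<close> by auto
  then obtain k where "is_arg_min (\<lambda>i. wt w (\<mu> i)) (\<lambda>i. i \<in> ?B) k"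
    using ex_is_arg_min_if_finite by blast
  then have k: "k \<in> ?B" "\<And>j. j \<in> ?B \<Longrightarrow> wt w (\<mu> k) \<le> wt w (\<mu> j)"
    by (auto simp: is_arg_min_linorder)
  have lk: "lookup (pconst a * r) \<nu> = a * lookup r \<nu>" for a and r :: "'b cpoly" and \<nu>
    using lookup_single_mult[of 0 a r \<nu>] by (simp add: pconst_def)
  have z: "c j * lookup (p j) (\<mu> k) = 0" if "j \<in> A - {k}" for j
  proof (rule ccontr)
    assume n: "c j * lookup (p j) (\<mu> k) \<noteq> 0"
    then have "wt w (\<mu> k) \<le> wt w (\<mu> j)" using k(2)[of j] that by simp
    moreover have "\<mu> k \<noteq> \<mu> j" using inj that k(1) by (auto simp: inj_on_def)
    moreover have "\<mu> k \<in> keys (p j)" using n by (simp add: in_keys_iff)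
    moreover have "lead w (p j) (\<mu> j)" using lead that by simp
    ultimately show False unfolding lead_def by (meson not_less)
  qed
  have "0 = lookup (\<Sum>i\<in>A. pconst (c i) * p i) (\<mu> k)" by (simp add: 0)
  also have "\<dots> = (\<Sum>i\<in>A. c i * lookup (p i) (\<mu> k))"
    by (simp add: lookup_sum lk)
  also have "\<dots> = c k * lookup (p k) (\<mu> k)"
    using z k(1) \<open>finite A\<close> sum.neutral[of "A - {k}" "\<lambda>i. c i * lookup (p i) (\<mu> k)"]
    by (subst sum.remove[of _ k]) auto
  finally show False using lead[of k] k(1) by (simp add: lead_def)
qed


section \<open>Jets of the determinant\<close>

text \<open>
  A term of the \<open>s\<close>-th jet of the determinant is a permutation together with the levels of its factors;
  the levels have sum \<open>s\<close> and are encoded as the multiplicities of a multiset of size \<open>s\<close>.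
\<close>

definition det_terms :: "nat \<Rightarrow> nat \<Rightarrow> ((nat \<Rightarrow> nat) \<times> nat multiset) set" where
  "det_terms n s = {\<sigma>. \<sigma> permutes {0..<n}} \<times> multisets_of_size {0..<n} s"

definition det_mono :: "nat \<Rightarrow> (nat \<Rightarrow> nat \<Rightarrow> 'v) \<Rightarrow> (nat \<Rightarrow> nat) \<times> nat multiset \<Rightarrow> (nat \<times> 'v) \<Rightarrow>\<^sub>0 nat" where
  "det_mono n x t = (\<Sum>i\<in>{0..<n}. single (count (snd t) i, x i (fst t i)) 1)"

lemma finite_det_terms [simp]: "finite (det_terms n s)"
  unfolding det_terms_def by (intro finite_cartesian_product finite_permutations finite_multisets_of_size) simp_all

lemma jetc_det:
  "jetc s (det (mat n n (\<lambda>(i, j). pvar (x i j)))) =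
     (\<Sum>t\<in>det_terms n s. single (det_mono n x t) (signof (fst t)))"
proof -
  let ?A = "mat n n (\<lambda>(i, j). pvar (x i j) :: 'a cpoly)"
  have pc: "(of_int a :: (nat \<times> 'a) cpoly) = pconst (of_int a)" for a
    by (simp add: pconst_def single_of_int)
  have o: "fps_nth (of_int a * F) s = of_int a * fps_nth F s" for a and F :: "(nat \<times> 'a) cpoly fps"
    by (metis fps_mult_left_const_nth fps_of_int)
  have permutes_lt: "\<sigma> i < n" if "\<sigma> \<in> {\<sigma>. \<sigma> permutes {0..<n}}" "i \<in> {0..<n}" for \<sigma> i
    using that permutes_in_image[of \<sigma> "{0..<n}" i] by simp
  have "ev arc_var (det ?A) = (\<Sum>\<sigma> | \<sigma> permutes {0..<n}. signof \<sigma> * (\<Prod>i = 0..<n. arc_var (x i (\<sigma> i))))"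
    unfolding det_def'[OF mat_carrier] ev.hom_sum ev.hom_mult ev.hom_prod ev.hom_of_int
    by (intro sum.cong prod.cong arg_cong2[where f = "(*)"] refl)
       (simp add: permutes_lt)
  then have "jetc s (det ?A) = (\<Sum>\<sigma>\<in>{\<sigma>. \<sigma> permutes {0..<n}}. \<Sum>L\<in>multisets_of_size {0..<n} s.
      signof \<sigma> * (\<Prod>i = 0..<n. pvar (count L i, x i (\<sigma> i))))"
    by (simp add: jetc_def fps_sum_nth o fps_prod_nth' arc_var_def sum_distrib_left)
  also have "\<dots> = (\<Sum>t\<in>det_terms n s. single (det_mono n x t) (signof (fst t)))"
    unfolding det_terms_def sum.cartesian_product
    by (intro sum.cong refl)
       (auto simp: pc det_mono_def pvar_def prod_single single_eq_pconst_mult[of _ "signof _"] split_beta)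
  finally show ?thesis .
qed

text \<open>
  The jet of level \<open>k\<close> of the entry \<open>(i, j)\<close> lies on diagonal \<open>k * n + j - i\<close> of the \<open>n\<close>-periodic infinite
  matrix of a loop. The weight is a strictly convex function of the diagonal, hence the lightest
  term of the \<open>s\<close>-th jet of the determinant is the product along diagonal \<open>s\<close>. In particular these
  terms involve disjoint sets of variables for different \<open>s\<close>.
\<close>

definition det_weight :: "nat \<Rightarrow> nat \<Rightarrow> nat \<Rightarrow> nat \<Rightarrow> real" where
  "det_weight n k i j = exp (real i - real j - real k * real n)"

text \<open>Row \<open>i\<close> meets diagonal \<open>s\<close> in column
  \<open>(s + i) mod n\<close> at level \<open>(s + i) div n\<close>, because
  \<open>k * n + j - i = s\<close> means \<open>k * n + j = s + i\<close>.\<close>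

definition main_perm :: "nat \<Rightarrow> nat \<Rightarrow> nat \<Rightarrow> nat" where
  "main_perm n s i = (if i < n then (s + i) mod n else i)"

definition main_levels :: "nat \<Rightarrow> nat \<Rightarrow> nat multiset" where
  "main_levels n s = (\<Sum>i\<in>{0..<n}. replicate_mset ((s + i) div n) i)"

lemma count_main_levels: "count (main_levels n s) i = (if i < n then (s + i) div n else 0)"
  by (simp add: main_levels_def count_sum)

lemma main_perm_permutes: "n \<ge> 1 \<Longrightarrow> main_perm n s permutes {0..<n}"
proof (rule bij_imp_permutes)
  assume n: "n \<ge> 1"
  have "inj_on (main_perm n s) {0..<n}"
  proof (rule inj_onI)
    fix i j assume ij: "i \<in> {0..<n}" "j \<in> {0..<n}" "main_perm n s i = main_perm n s j"
    have *: "a = b" if "a \<le> b" "b < n" "(s + a) mod n = (s + b) mod n" for a b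
    proof -
      have "n dvd b - a" using that mod_eq_dvd_iff_nat[of "s + a" "s + b" n] by simp
      then show ?thesis using that by (auto dest: dvd_imp_le)
    qed
    show "i = j" using *[of i j] *[of j i] ij by (cases "i \<le> j") (simp_all add: main_perm_def)
  qed
  then show "bij_betw (main_perm n s) {0..<n} {0..<n}"
    unfolding bij_betw_def using n endo_inj_surj[of "{0..<n}" "main_perm n s"]
    by (simp add: image_subset_iff main_perm_def)
qed (simp add: main_perm_def)

text \<open>The levels add up to \<open>s\<close>: when
  \<open>s + i = n * ((s + i) div n) + (s + i) mod n\<close> is summed over the rows, the remainders
  are a permutation of the \<open>i\<close> and cancel against them.\<close>

lemma main_term_mem: "n \<ge> 1 \<Longrightarrow> (main_perm n s, main_levels n s) \<in> det_terms n s"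
proof -
  assume n: "n \<ge> 1"
  have "n * s + (\<Sum>i\<in>{0..<n}. i) = (\<Sum>i\<in>{0..<n}. s + i)" by (simp add: sum.distrib)
  also have "\<dots> = (\<Sum>i\<in>{0..<n}. n * ((s + i) div n) + main_perm n s i)"
    by (rule sum.cong) (auto simp: main_perm_def)
  also have "\<dots> = n * (\<Sum>i\<in>{0..<n}. (s + i) div n) + (\<Sum>i\<in>{0..<n}. i)"
    using sum.permute[OF main_perm_permutes[OF n], of "\<lambda>i. i" s]
    by (simp add: sum.distrib sum_distrib_left comp_def)
  finally have "(\<Sum>i\<in>{0..<n}. (s + i) div n) = s" using n by simp
  then have "size (main_levels n s) = s"
    unfolding main_levels_def size_multiset_sum by simp
  moreover have "set_mset (main_levels n s) \<subseteq> {0..<n}"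
    using count_main_levels[of n s] by (auto simp: set_mset_def split: if_splits)
  ultimately show ?thesis
    using main_perm_permutes[OF n] by (simp add: det_terms_def multisets_of_size_def)
qed

lemma exp_gt_add_one: "(y :: real) \<noteq> 0 \<Longrightarrow> 1 + y < exp y"
proof (rule ccontr)
  assume y: "y \<noteq> 0" "\<not> 1 + y < exp y"
  then have "y = exp y - 1" using exp_ge_add_one_self[of y] by simp
  then have "exp y = 1" using ln_eq_minus_one[of "exp y"] by simp
  then show False using y by simp
qed

lemma det_terms_levels:
  assumes "t \<in> det_terms n s" shows "(\<Sum>i\<in>{0..<n}. count (snd t) i) = s"
proof -
  have t: "set_mset (snd t) \<subseteq> {0..<n}" "size (snd t) = s"
    using assms by (auto simp: det_terms_def multisets_of_size_def)
  have "size (snd t) = (\<Sum>i\<in>{0..<n}. count (snd t) i)"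
    unfolding size_multiset_overloaded_eq
    by (rule sum.mono_neutral_left) (use t in \<open>auto simp: not_in_iff\<close>)
  then show ?thesis using t by simp
qed

text \<open>
  The exponents \<open>y\<close> below sum to zero, so the strict convexity of \<open>exp\<close> singles out the term in which
  all of them vanish.
\<close>

lemma det_terms_weight:
  assumes n: "n \<ge> 1" and t: "t \<in> det_terms n s" and ne: "t \<noteq> (main_perm n s, main_levels n s)"
  shows "(\<Sum>i\<in>{0..<n}. det_weight n ((s + i) div n) i ((s + i) mod n)) <
    (\<Sum>i\<in>{0..<n}. det_weight n (count (snd t) i) i (fst t i))"
proof -
  obtain \<sigma> L where tt: "t = (\<sigma>, L)" by (cases t)
  have \<sigma>: "\<sigma> permutes {0..<n}" and L: "set_mset L \<subseteq> {0..<n}"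
    using t by (auto simp: tt det_terms_def multisets_of_size_def)
  define y where "y i = real s + real i - real (\<sigma> i) - real (count L i) * real n" for i
  have w: "det_weight n (count L i) i (\<sigma> i) = exp (- real s) * exp (y i)" for i
    by (simp add: det_weight_def y_def exp_add[symmetric])
  have w0: "det_weight n ((s + i) div n) i ((s + i) mod n) = exp (- real s)" for i
  proof -
    have "real (s + i) = real ((s + i) div n * n + (s + i) mod n)" by simp
    then have "real i - real ((s + i) mod n) - real ((s + i) div n) * real n = - real s"
      unfolding of_nat_add of_nat_mult by linarith
    then show ?thesis by (simp add: det_weight_def)
  qed
  have "(\<Sum>i\<in>{0..<n}. real (\<sigma> i)) = (\<Sum>i\<in>{0..<n}. real i)"
    using sum.permute[OF \<sigma>, of real] by (simp add: comp_def)
  moreover have "(\<Sum>i\<in>{0..<n}. real (count L i)) = real s"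
    using arg_cong[OF det_terms_levels[OF t], of real] by (simp add: tt)
  ultimately have y0: "(\<Sum>i\<in>{0..<n}. y i) = 0"
    by (simp add: y_def sum.distrib sum_subtractf sum_distrib_right[symmetric])
  \<comment> \<open>If all exponents vanish, then \<open>s + i = count L i * n + \<sigma> i\<close>
    with \<open>\<sigma> i < n\<close>, and uniqueness of division with remainder identifies the
    term as the main one.\<close>
  have "\<exists>i\<in>{0..<n}. y i \<noteq> 0"
  proof (rule ccontr)
    assume "\<not> ?thesis"
    then have "real (\<sigma> i + count L i * n) = real (s + i)" if "i < n" for i
      using that by (force simp: y_def)
    then have e: "\<sigma> i + count L i * n = s + i" if "i < n" for i
      using that of_nat_eq_iff by blast
    have lt: "\<sigma> i < n" if "i < n" for i
      using permutes_in_image[OF \<sigma>, of i] that by simp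
    have "\<sigma> i = main_perm n s i" for i
      using e[of i] lt[of i] permutes_not_in[OF \<sigma>, of i]
      by (auto simp: main_perm_def mod_less simp flip: e)
    moreover have "count L i = count (main_levels n s) i" for i
    proof (cases "i < n")
      case True
      have "(s + i) div n = count L i" unfolding e[OF True, symmetric] using lt[OF True] by simp
      then show ?thesis using True by (simp add: count_main_levels)
    next
      case False
      then have "i \<notin># L" using L by auto
      then show ?thesis using False by (simp add: count_main_levels not_in_iff)
    qed
    ultimately show False using ne by (auto simp: tt multiset_eq_iff)
  qed
  then obtain i where i: "i \<in> {0..<n}" "y i \<noteq> 0" by blast
  have "(\<Sum>i\<in>{0..<n}. 1 + y i) < (\<Sum>i\<in>{0..<n}. exp (y i))"
    by (rule sum_strict_mono_ex1) (use i exp_gt_add_one[of "y i"] exp_ge_add_one_self in auto)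
  then have "real n < (\<Sum>i\<in>{0..<n}. exp (y i))" using y0 by (simp add: sum.distrib)
  then show ?thesis
    by (simp add: tt w w0 sum_distrib_left[symmetric])
qed

definition main_mono :: "nat \<Rightarrow> (nat \<Rightarrow> nat \<Rightarrow> 'v) \<Rightarrow> nat \<Rightarrow> (nat \<times> 'v) \<Rightarrow>\<^sub>0 nat" where
  "main_mono n x s = (\<Sum>i\<in>{0..<n}. single ((s + i) div n, x i ((s + i) mod n)) 1)"

lemma det_mono_main: "det_mono n x (main_perm n s, main_levels n s) = main_mono n x s"
  unfolding det_mono_def main_mono_def by (rule sum.cong) (auto simp: count_main_levels main_perm_def)

lemma wt_det_mono: "wt w (det_mono n x t) = (\<Sum>i\<in>{0..<n}. w (count (snd t) i, x i (fst t i)))"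
  by (simp add: det_mono_def wt_sum)

lemma wt_main_mono: "wt w (main_mono n x s) = (\<Sum>i\<in>{0..<n}. w ((s + i) div n, x i ((s + i) mod n)))"
  by (simp add: main_mono_def wt_sum)

lemma keys_sum_single: "keys (\<Sum>i\<in>A. single (v i) (1 :: nat)) \<subseteq> v ` A"
  by (induction A rule: infinite_finite_induct)
     (use Poly_Mapping.keys_add in \<open>auto dest!: subsetD[OF Poly_Mapping.keys_add] split: if_splits\<close>)


section \<open>Generators of the invariants and standard monomials\<close>

datatype inv_gen = GX nat nat | GA | GB

definition gens :: "nat \<Rightarrow> inv_gen set" where
  "gens n = (\<Union>i<n. \<Union>j<n. {GX i j}) \<union> {GA, GB}"

definition gen_rel :: "nat \<Rightarrow> inv_gen cpoly" where
  "gen_rel n = det (mat n n (\<lambda>(i, j). pvar (GX i j))) - pvar GA * pvar GB"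

definition standard :: "nat \<Rightarrow> enat \<Rightarrow> (nat \<times> inv_gen \<Rightarrow>\<^sub>0 nat) \<Rightarrow> bool" where
  "standard n m \<mu> \<longleftrightarrow>
     (\<forall>s. enat s \<le> m \<longrightarrow> (\<exists>i<n. lookup \<mu> ((s + i) div n, GX i ((s + i) mod n)) = 0))"

text \<open>The factors of \<open>M_s\<close> lie in different rows, so \<open>M_s\<close> is
  squarefree and divides every monomial that contains all its variables.\<close>

lemma lookup_main_mono_le:
  assumes "\<And>i. i < n \<Longrightarrow> lookup \<mu> ((s + i) div n, GX i ((s + i) mod n)) \<noteq> 0"
  shows "lookup (main_mono n GX s) v \<le> lookup \<mu> v"
proof -
  have e: "lookup (main_mono n GX s) v =
      (\<Sum>i\<in>{0..<n}. if ((s + i) div n, GX i ((s + i) mod n)) = v then 1 else 0)"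
    by (auto simp: main_mono_def lookup_sum lookup_single when_def intro!: sum.cong)
  show ?thesis
  proof (cases "\<exists>i<n. v = ((s + i) div n, GX i ((s + i) mod n))")
    case True
    then obtain i where i: "i < n" "v = ((s + i) div n, GX i ((s + i) mod n))" by blast
    have "lookup (main_mono n GX s) v = (\<Sum>j\<in>{0..<n}. if j = i then 1 else 0)"
      unfolding e by (rule sum.cong) (auto simp: i)
    then show ?thesis using assms[OF i(1)] i by simp
  next
    case False
    then have "lookup (main_mono n GX s) v = 0"
      unfolding e by (intro sum.neutral) auto
    then show ?thesis by simp
  qed
qed

lemma finite_bounded_monos:
  assumes "finite V"
  shows "finite {\<mu> :: 'v \<Rightarrow>\<^sub>0 nat. keys \<mu> \<subseteq> V \<and> (\<forall>v. lookup \<mu> v \<le> D)}" (is "finite ?M")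
proof (rule finite_imageD)
  have "lookup ` ?M \<subseteq> {f. \<forall>v. (v \<in> V \<longrightarrow> f v \<in> {..D}) \<and> (v \<notin> V \<longrightarrow> f v = 0)}"
    by (auto simp: in_keys_iff)
  then show "finite (lookup ` ?M)"
    by (rule finite_subset) (rule finite_set_of_finite_funs, use assms in auto)
  show "inj_on lookup ?M" by (auto simp: inj_on_def intro: poly_mapping_eqI)
qed

lemma finite_gens [simp]: "finite (gens n)"
  by (simp add: gens_def)

section \<open>The standard monomials span modulo the relations\<close>

definition x_weight :: "nat \<Rightarrow> nat \<times> inv_gen \<Rightarrow> real" where
  "x_weight n v = (case snd v of GX i j \<Rightarrow> det_weight n (fst v) i j | _ \<Rightarrow> 0)"

definition x_degree :: "nat \<times> inv_gen \<Rightarrow> real" where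
  "x_degree v = (case snd v of GX i j \<Rightarrow> 1 | _ \<Rightarrow> 0)"

text \<open>
  Rewriting with \<open>gen_rel\<close> preserves the total degree and the level, unless it lowers the degree
  in the variables \<open>GX\<close>; the weight increases within the finite set of monomials below.
\<close>

definition same_degrees :: "nat \<Rightarrow> (nat \<times> inv_gen \<Rightarrow>\<^sub>0 nat) \<Rightarrow> (nat \<times> inv_gen \<Rightarrow>\<^sub>0 nat) set" where
  "same_degrees n \<mu> = {\<nu>. keys \<nu> \<subseteq> UNIV \<times> gens n \<and> wt (\<lambda>_. 1) \<nu> = wt (\<lambda>_. 1) \<mu> \<and>
     wt (\<lambda>v. real (fst v)) \<nu> = wt (\<lambda>v. real (fst v)) \<mu>}"

text \<open>The degree bounds the exponents and the total level bounds the level of each variable,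
  so only finitely many variables can occur.\<close>

lemma finite_same_degrees: "finite (same_degrees n \<mu>)"
proof (rule finite_subset)
  let ?D = "nat \<lfloor>wt (\<lambda>_. 1) \<mu>\<rfloor>" and ?L = "nat \<lfloor>wt (\<lambda>v. real (fst v)) \<mu>\<rfloor>"
  show "finite {\<nu>. keys \<nu> \<subseteq> {..?L} \<times> gens n \<and> (\<forall>v. lookup \<nu> v \<le> ?D)}"
    by (rule finite_bounded_monos) simp
  show "same_degrees n \<mu> \<subseteq> {\<nu>. keys \<nu> \<subseteq> {..?L} \<times> gens n \<and> (\<forall>v. lookup \<nu> v \<le> ?D)}"
  proof safe
    fix \<nu> k g assume \<nu>: "\<nu> \<in> same_degrees n \<mu>"
    show "lookup \<nu> v \<le> ?D" for v
      using lookup_times_le_wt[of "\<lambda>_. 1" \<nu> v] \<nu> by (simp add: same_degrees_def le_nat_floor)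
    assume k: "(k, g) \<in> keys \<nu>"
    then show "g \<in> gens n" using \<nu> by (auto simp: same_degrees_def)
    have "real k \<le> real (lookup \<nu> (k, g)) * real k"
      using k by (cases "lookup \<nu> (k, g)") (auto simp: in_keys_iff algebra_simps)
    also have "\<dots> \<le> wt (\<lambda>v. real (fst v)) \<mu>"
      using lookup_times_le_wt[of "\<lambda>v. real (fst v)" \<nu> "(k, g)"] \<nu> by (simp add: same_degrees_def)
    finally show "k \<le> ?L" by (simp add: le_nat_floor)
  qed
qed

text \<open>\<open>J\<close> is left abstract because there are two applications: the kernel of the
  evaluation in \<open>\<O>(V_m)\<close>, and the kernel of the presentation of the jet algebra of
  \<open>Z\<close>. A monomial that is not standard is rewritten by replacing a factor
  \<open>M_s\<close> with the remaining terms of \<open>F_s\<close>.\<close>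

lemma standard_span:
  fixes J C :: "(nat \<times> inv_gen) cpoly set"
  assumes C_def: "C = polys (jvars m (gens n))" and n: "n \<ge> 1"
    and J0: "0 \<in> J" and J_add: "\<And>p q. p \<in> J \<Longrightarrow> q \<in> J \<Longrightarrow> p + q \<in> J"
    and J_mult: "\<And>p q. p \<in> J \<Longrightarrow> q \<in> C \<Longrightarrow> p * q \<in> J"
    and rel: "\<And>s. enat s \<le> m \<Longrightarrow> jetc s (gen_rel n) \<in> J"
    and p: "p \<in> C"
  shows "\<exists>q \<in> C. (\<forall>\<mu> \<in> keys q. standard n m \<mu>) \<and> p - q \<in> J"
proof -
  define good where "good p \<longleftrightarrow> (\<exists>q \<in> C. (\<forall>\<mu> \<in> keys q. standard n m \<mu>) \<and> p - q \<in> J)" for p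
  have good_0: "good 0" unfolding good_def C_def by (rule bexI[of _ 0]) (simp_all add: J0)
  have good_add: "good (p + q)" if "good p" "good q" for p q
  proof -
    obtain p' q' where *: "p' \<in> C" "q' \<in> C" "\<forall>\<mu> \<in> keys p'. standard n m \<mu>"
      "\<forall>\<mu> \<in> keys q'. standard n m \<mu>" "p - p' \<in> J" "q - q' \<in> J"
      using \<open>good p\<close> \<open>good q\<close> unfolding good_def by blast
    have "(p - p') + (q - q') = (p + q) - (p' + q')" by simp
    from J_add[OF *(5,6), unfolded this] have "(p + q) - (p' + q') \<in> J" .
    moreover have "\<forall>\<mu> \<in> keys (p' + q'). standard n m \<mu>"
      using *(3,4) by (auto dest!: subsetD[OF Poly_Mapping.keys_add])
    moreover have "p' + q' \<in> C" using *(1,2) by (simp add: C_def)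
    ultimately show ?thesis unfolding good_def by blast
  qed
  have good_sum: "good (\<Sum>i\<in>A. f i)" if "\<And>i. i \<in> A \<Longrightarrow> good (f i)" for f and A :: "'i set"
    using that by (induction A rule: infinite_finite_induct) (auto intro: good_0 good_add)
  have good_J: "good p" if "good p'" "p - p' \<in> J" for p p'
  proof -
    obtain q where q: "q \<in> C" "\<forall>\<mu> \<in> keys q. standard n m \<mu>" "p' - q \<in> J"
      using \<open>good p'\<close> unfolding good_def by blast
    have "p - q \<in> J" using J_add[OF \<open>p - p' \<in> J\<close> q(3)] by simp
    then show ?thesis using q unfolding good_def by blast
  qed
  let ?V = "jvars m (gens n)"
  have GABx: "GA \<in> gens n" "GB \<in> gens n" "\<And>i j. i < n \<Longrightarrow> j < n \<Longrightarrow> GX i j \<in> gens n" by (auto simp: gens_def)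
  have sC: "single \<mu> c \<in> C" if "keys \<mu> \<subseteq> ?V" for \<mu> c
    using that by (simp add: C_def mem_mpoly_alg)
  define r where "r = measures [\<lambda>\<mu>. nat \<lfloor>wt x_degree \<mu>\<rfloor>,
      \<lambda>\<mu>. card {\<nu> \<in> same_degrees n \<mu>. wt (x_weight n) \<mu> < wt (x_weight n) \<nu>}]"
  have "wf r" unfolding r_def by (rule wf_measures)
  then have mono: "\<forall>c. keys \<mu> \<subseteq> ?V \<longrightarrow> good (single \<mu> c)" for \<mu>
  proof (induction \<mu> rule: wf_induct_rule)
    case (less \<mu>)
    have IH: "good (single \<nu> c)" if "(\<nu>, \<mu>) \<in> r" "keys \<nu> \<subseteq> ?V" for \<nu> c
      using less.IH that by blast
    show ?case
    proof (intro allI impI)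
      fix c assume k\<mu>: "keys \<mu> \<subseteq> ?V"
      show "good (single \<mu> c)"
      proof (cases "standard n m \<mu>")
        case True
        have "\<nu> = \<mu>" if "\<nu> \<in> keys (single \<mu> c)" for \<nu>
          using that by (cases "c = 0") simp_all
        then have "\<forall>\<nu> \<in> keys (single \<mu> c). standard n m \<nu>"
          using True by blast
        then have "q \<in> C \<Longrightarrow> q = single \<mu> c \<Longrightarrow> good q" for q
          using J0 unfolding good_def by (intro bexI[of _ q]) simp_all
        from this[OF sC[OF k\<mu>] refl] show ?thesis .
      next
        case False
        then obtain s where s: "enat s \<le> m"
          and le: "\<And>i. i < n \<Longrightarrow> lookup \<mu> ((s + i) div n, GX i ((s + i) mod n)) \<noteq> 0"
          unfolding standard_def by auto
        define M where "M = main_mono n GX s"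
        define \<mu>' where "\<mu>' = \<mu> - M"
        have \<mu>: "\<mu> = M + \<mu>'"
          unfolding \<mu>'_def M_def
          by (rule poly_mapping_eqI) (use lookup_main_mono_le[OF le] in \<open>simp add: lookup_add lookup_minus\<close>)
        have k': "keys \<mu>' \<subseteq> ?V"
        proof
          fix v assume "v \<in> keys \<mu>'"
          then have "v \<in> keys \<mu>" by (simp add: \<mu> in_keys_iff lookup_add)
          then show "v \<in> ?V" using k\<mu> by blast
        qed
        let ?t = "(main_perm n s, main_levels n s)"
        let ?T = "det_terms n s - {?t}"
        define e :: complex where "e = signof (main_perm n s)"
        \<comment> \<open>The sign \<open>e\<close> is its own inverse, so the relation times
          \<open>c * e\<close> and \<open>\<mu>'\<close> has coefficient \<open>c\<close> at
          \<open>\<mu>\<close>.\<close>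
        have ee: "e * e = 1" by (simp add: e_def sign_def)
        define AB where "AB = (\<Sum>i\<le>s. single (single (i, GA) (1 :: nat) +
            single (s - i, GB) 1) (1 :: complex))"
        define R where "R = (\<Sum>t\<in>?T. single (det_mono n GX t) (signof (fst t) :: complex))"
        have "jetc s (gen_rel n) = single M e + R - AB"
          unfolding gen_rel_def jetc_simps jetc_det jetc_mult
          by (subst sum.remove[OF _ main_term_mem[OF n]])
             (simp_all add: det_mono_main M_def e_def R_def AB_def pvar_def mult_single)
        moreover have "single \<mu>' (c * e) \<in> C"
          by (rule sC[OF k'])
        ultimately have "(single M e + R - AB) * single \<mu>' (c * e) \<in> J"
          using J_mult[OF rel[OF s]] by simp
        moreover have "(single M e + R - AB) * single \<mu>' (c * e) =
            single \<mu> c - (AB * single \<mu>' (c * e) + R * single \<mu>' (- (c * e)))"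
        proof -
          have "single M e * single \<mu>' (c * e) = single \<mu> c"
            using ee by (simp add: mult_single \<mu> mult.left_commute[of e])
          then show ?thesis by (simp add: algebra_simps single_uminus)
        qed
        ultimately have J: "single \<mu> c -
            (AB * single \<mu>' (c * e) + R * single \<mu>' (- (c * e))) \<in> J"
          by simp
        have xM: "wt x_degree \<mu> = real n + wt x_degree \<mu>'"
          by (simp add: \<mu> wt_add M_def wt_main_mono x_degree_def)
        have x': "0 \<le> wt x_degree \<mu>'"
          by (rule wt_nonneg) (simp add: x_degree_def split: inv_gen.split)
        have "good (AB * single \<mu>' (c * e))"
          unfolding AB_def sum_distrib_right mult_single
        proof (rule good_sum, rule IH)
          fix i assume "i \<in> {..s}"
          let ?\<nu> = "single (i, GA) 1 + single (s - i, GB) 1 + \<mu>'"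
          have "enat i \<le> m" "enat (s - i) \<le> m" using s \<open>i \<in> {..s}\<close> enat_le_mono by auto
          then show "keys ?\<nu> \<subseteq> ?V"
            using k' GABx by (auto dest!: subsetD[OF Poly_Mapping.keys_add] split: if_splits)
          have "wt x_degree ?\<nu> = wt x_degree \<mu>'" by (simp add: wt_add x_degree_def)
          then have "nat \<lfloor>wt x_degree ?\<nu>\<rfloor> < nat \<lfloor>wt x_degree \<mu>\<rfloor>"
          proof -
            have "0 \<le> \<lfloor>wt x_degree \<mu>'\<rfloor>" using x' by simp
            moreover have "\<lfloor>wt x_degree \<mu>\<rfloor> = int n + \<lfloor>wt x_degree \<mu>'\<rfloor>" by (simp add: xM)
            ultimately show ?thesis unfolding \<open>wt x_degree ?\<nu> = wt x_degree \<mu>'\<close> using n by linarith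
          qed
          then show "(?\<nu>, \<mu>) \<in> r"
            by (simp add: r_def)
        qed
        moreover have "good (R * single \<mu>' (- (c * e)))"
          unfolding R_def sum_distrib_right mult_single
        proof (rule good_sum, rule IH)
          fix t assume t: "t \<in> ?T"
          let ?\<nu> = "det_mono n GX t + \<mu>'"
          have st: "fst t i < n" "enat (count (snd t) i) \<le> m" if "i < n" for i
          proof -
            have "fst t permutes {0..<n}" using t by (auto simp: det_terms_def)
            then show "fst t i < n" using that permutes_in_image[of "fst t" "{0..<n}" i] by simp
            have "count (snd t) i \<le> s"
              using det_terms_levels[of t n s] t that member_le_sum[of i "{0..<n}" "count (snd t)"] by auto
            then show "enat (count (snd t) i) \<le> m" using s enat_le_mono by blast
          qed
          have "keys (det_mono n GX t) \<subseteq> ?V"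
            unfolding det_mono_def using st GABx(3)
            by (intro order_trans[OF keys_sum_single]) auto
          then show "keys ?\<nu> \<subseteq> ?V"
            using k' by (auto dest!: subsetD[OF Poly_Mapping.keys_add])
          have wd: "wt x_degree ?\<nu> = wt x_degree \<mu>"
            by (simp add: xM wt_add wt_det_mono x_degree_def)
          have lev: "(\<Sum>i\<in>{0..<n}. real (count (snd t) i)) = real s" if "t \<in> det_terms n s" for t
            using arg_cong[OF det_terms_levels[OF that], of real] by simp
          have "wt (\<lambda>v. real (fst v)) (det_mono n GX t) = wt (\<lambda>v. real (fst v)) M"
            using lev[of t] lev[OF main_term_mem[OF n]] t
            by (simp add: M_def det_mono_main[symmetric] wt_det_mono)
          then have sd: "same_degrees n ?\<nu> = same_degrees n \<mu>"
            by (simp add: same_degrees_def \<mu> wt_add M_def wt_det_mono wt_main_mono)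
          have lt: "wt (x_weight n) \<mu> < wt (x_weight n) ?\<nu>"
            using det_terms_weight[OF n, of t s] t
            by (simp add: \<mu> wt_add M_def wt_det_mono wt_main_mono x_weight_def)
          \<comment> \<open>The monomial \<open>?\<nu>\<close> is counted among those heavier than
            \<open>\<mu>\<close> but not among those heavier than itself, so the second measure
            drops strictly.\<close>
          have "?\<nu> \<in> same_degrees n ?\<nu>"
            using \<open>keys ?\<nu> \<subseteq> ?V\<close> by (auto simp: same_degrees_def)
          then have "card {\<kappa> \<in> same_degrees n ?\<nu>. wt (x_weight n) ?\<nu> < wt (x_weight n) \<kappa>} <
              card {\<kappa> \<in> same_degrees n \<mu>. wt (x_weight n) \<mu> < wt (x_weight n) \<kappa>}"
            unfolding sd by (intro psubset_card_mono) (use lt finite_same_degrees[of n \<mu>] in auto)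
          then show "(?\<nu>, \<mu>) \<in> r"
            by (simp add: r_def wd)
        qed
        ultimately show ?thesis by (intro good_J[OF good_add J])
      qed
    qed
  qed
  have "good p"
    by (subst poly_mapping_sum_single[of p, symmetric], rule good_sum, rule mono[rule_format])
       (use p in \<open>auto simp: C_def mem_mpoly_alg\<close>)
  then show ?thesis unfolding good_def .
qed

section \<open>Leading monomials of the jets of the generators\<close>

definition gen_poly :: "nat \<Rightarrow> inv_gen \<Rightarrow> V_coord cpoly" where
  "gen_poly n g = (case g of
     GX i j \<Rightarrow> (\<Sum>k\<in>{0..<n}. pvar (Covect i k) * pvar (Vect k j))
   | GA \<Rightarrow> det (mat n n (\<lambda>(i, j). pvar (Vect i j)))
   | GB \<Rightarrow> det (mat n n (\<lambda>(i, j). pvar (Covect i j))))"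

definition gen_jet :: "nat \<Rightarrow> nat \<times> inv_gen \<Rightarrow> (nat \<times> V_coord) cpoly" where
  "gen_jet n v = jetc (fst v) (gen_poly n (snd v))"

text \<open>Covector variables carry \<open>det_weight\<close>, so that \<open>b_k\<close> leads
  with the product along diagonal \<open>k\<close>. Among the vector variables, the diagonal ones of
  level 0 are free, and the entry \<open>(0, 0)\<close> is free at every level, which makes the
  leading monomials of the \<open>a_k\<close> distinct. The value \<open>exp (real n) + 1\<close>
  exceeds every \<open>det_weight\<close> with indices below \<open>n\<close>, so a term with
  another vector variable is too heavy to lead a jet of an entry of \<open>x\<close>.\<close>

definition rep_weight :: "nat \<Rightarrow> nat \<times> V_coord \<Rightarrow> real" where
  "rep_weight n v = (case snd v of
     Covect i j \<Rightarrow> det_weight n (fst v) i j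
   | Vect i j \<Rightarrow> if i = j \<and> (fst v = 0 \<or> i = 0) then 0 else exp (real n) + 1)"

definition gen_lead :: "nat \<Rightarrow> nat \<times> inv_gen \<Rightarrow> (nat \<times> V_coord) \<Rightarrow>\<^sub>0 nat" where
  "gen_lead n v = (case snd v of
     GX i j \<Rightarrow> single (fst v, Covect i j) 1 + single (0, Vect j j) 1
   | GA \<Rightarrow> (\<Sum>i\<in>{0..<n}. single (if i = 0 then fst v else 0, Vect i i) 1)
   | GB \<Rightarrow> main_mono n Covect (fst v))"

lemma rep_weight_nonneg: "0 \<le> rep_weight n v"
  by (auto simp: rep_weight_def det_weight_def add_nonneg_nonneg split: V_coord.split)

lemma jetc_sum: "jetc k (\<Sum>i\<in>A. f i) = (\<Sum>i\<in>A. jetc k (f i))"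
  by (simp add: jetc_def ev.hom_sum fps_sum_nth)

text \<open>In the jet of the sum of \<open>Covect i l\<close> times \<open>Vect l j\<close>, the
  terms with \<open>l\<close> different from \<open>j\<close> are too heavy. For
  \<open>l = j\<close> the weight of the covector variable decreases strictly with its level, so the
  lightest term puts the whole level \<open>k\<close> on the covector; this argument also covers
  \<open>j = 0\<close>, where the vector variable is free at every level.\<close>

lemma lead_gen_jet_X:
  assumes "i < n" "j < n"
  shows "lead (rep_weight n) (gen_jet n (k, GX i j)) (gen_lead n (k, GX i j))"
proof -
  define \<mu> :: "nat \<times> nat \<Rightarrow> (nat \<times> V_coord) \<Rightarrow>\<^sub>0 nat" where
    "\<mu> t = single (snd t, Covect i (fst t)) 1 + single (k - snd t, Vect (fst t) j) 1" for t
  have w: "wt (rep_weight n) (\<mu> (l, p)) = det_weight n p i l + rep_weight n (k - p, Vect l j)" for l p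
    by (simp add: \<mu>_def wt_add rep_weight_def)
  have "det_weight n k i j \<le> exp (real n)"
  proof -
    have "real i - real j - real k * real n \<le> real n"
      using assms mult_nonneg_nonneg[of "real k" "real n"] by linarith
    then show ?thesis by (simp add: det_weight_def)
  qed
  then have 1: "det_weight n k i j < exp (real n) + 1" by simp
  have "lead (rep_weight n) (\<Sum>t\<in>{0..<n} \<times> {..k}. single (\<mu> t) 1) (\<mu> (j, k))"
  proof (rule lead_sum_single)
    fix t assume t: "t \<in> {0..<n} \<times> {..k}" "t \<noteq> (j, k)"
    obtain l p where lp: "t = (l, p)" by (cases t)
    have "det_weight n k i j < det_weight n p i l + rep_weight n (k - p, Vect l j)"
    proof (cases "l = j")
      case True
      then have "p < k" using t lp by auto
      then have "real p * real n < real k * real n" using assms by simp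
      then have "det_weight n k i j < det_weight n p i l" using True by (simp add: det_weight_def)
      then show ?thesis using rep_weight_nonneg[of n "(k - p, Vect l j)"] by simp
    next
      case False
      then have "rep_weight n (k - p, Vect l j) = exp (real n) + 1" by (simp add: rep_weight_def)
      moreover have "0 < det_weight n p i l" by (simp add: det_weight_def)
      ultimately show ?thesis using 1 by linarith
    qed
    then show "wt (rep_weight n) (\<mu> (j, k)) < wt (rep_weight n) (\<mu> t)"
      unfolding lp w by (simp add: rep_weight_def)
  qed (use assms in auto)
  moreover have "gen_jet n (k, GX i j) = (\<Sum>t\<in>{0..<n} \<times> {..k}. single (\<mu> t) 1)"
  proof -
    have "gen_jet n (k, GX i j) = (\<Sum>l\<in>{0..<n}. \<Sum>p\<le>k. single (\<mu> (l, p)) 1)"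
      by (simp add: gen_jet_def gen_poly_def jetc_sum jetc_mult)
         (simp add: \<mu>_def pvar_def mult_single)
    then show ?thesis unfolding sum.cartesian_product by (simp add: split_beta)
  qed
  ultimately show ?thesis by (simp add: gen_lead_def \<mu>_def)
qed

text \<open>A term of weight 0 must be the product of the diagonal with all of level
  \<open>k\<close> in row 0; every other term has positive weight.\<close>

lemma lead_gen_jet_A:
  assumes n: "n \<ge> 1"
  shows "lead (rep_weight n) (gen_jet n (k, GA)) (gen_lead n (k, GA))"
proof -
  let ?t = "(id, replicate_mset k 0) :: (nat \<Rightarrow> nat) \<times> nat multiset"
  have m: "det_mono n Vect ?t = gen_lead n (k, GA)"
    unfolding det_mono_def gen_lead_def by (auto intro!: sum.cong)
  have "lead (rep_weight n) (\<Sum>t\<in>det_terms n k. single (det_mono n Vect t) (signof (fst t)))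
      (det_mono n Vect ?t)"
  proof (rule lead_sum_single)
    show "?t \<in> det_terms n k"
    proof -
      have "set_mset (replicate_mset k (0 :: nat)) \<subseteq> {0..<n}" using n by (cases k) auto
      then show ?thesis by (simp add: det_terms_def multisets_of_size_def permutes_id)
    qed
    fix t assume t: "t \<in> det_terms n k" "t \<noteq> ?t"
    have t0: "wt (rep_weight n) (det_mono n Vect ?t) = 0"
      unfolding wt_det_mono by (rule sum.neutral) (simp add: rep_weight_def)
    have "\<exists>i\<in>{0..<n}. rep_weight n (count (snd t) i, Vect i (fst t i)) \<noteq> 0"
    proof (rule ccontr)
      assume "\<not> ?thesis"
      then have *: "fst t i = i \<and> (count (snd t) i = 0 \<or> i = 0)" if "i < n" for i
        using that add_pos_pos[OF exp_gt_zero, of 1 "real n"]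
        by (auto simp: rep_weight_def count_eq_zero_iff split: if_splits)
      have p: "fst t permutes {0..<n}" "set_mset (snd t) \<subseteq> {0..<n}" using t by (auto simp: det_terms_def multisets_of_size_def)
      have "fst t i = i" for i using * permutes_not_in[OF p(1), of i] by (cases "i < n") auto
      then have "fst t = id" by auto
      have c: "count (snd t) i = 0" if "i \<noteq> 0" for i
      proof (cases "i < n")
        case True
        then show ?thesis using *[OF True] that by simp
      next
        case False
        then have "i \<notin># snd t" using p(2) by auto
        then show ?thesis by (simp add: not_in_iff)
      qed
      have "(\<Sum>i\<in>{0..<n}. count (snd t) i) = count (snd t) 0"
        using n c by (subst sum.remove[of _ 0]) auto
      then have "count (snd t) 0 = k" using det_terms_levels[OF t(1)] by simp
      then have "snd t = replicate_mset k 0" using c by (auto simp: multiset_eq_iff)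
      then show False using t(2) \<open>fst t = id\<close> by (cases t) simp
    qed
    then obtain i where i: "i \<in> {0..<n}" "rep_weight n (count (snd t) i, Vect i (fst t i)) \<noteq> 0" by blast
    have "0 < wt (rep_weight n) (det_mono n Vect t)"
      unfolding wt_det_mono
      by (rule sum_pos2[OF _ i(1)]) (use i(2) rep_weight_nonneg in \<open>auto simp: less_le\<close>)
    then show "wt (rep_weight n) (det_mono n Vect ?t) < wt (rep_weight n) (det_mono n Vect t)"
      by (simp add: t0)
  qed auto
  then show ?thesis unfolding m by (simp add: gen_jet_def gen_poly_def jetc_det)
qed

lemma lead_gen_jet_B:
  assumes n: "n \<ge> 1"
  shows "lead (rep_weight n) (gen_jet n (k, GB)) (gen_lead n (k, GB))"
proof -
  let ?t = "(main_perm n k, main_levels n k)"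
  have "lead (rep_weight n) (\<Sum>t\<in>det_terms n k. single (det_mono n Covect t) (signof (fst t)))
      (det_mono n Covect ?t)"
  proof (rule lead_sum_single[OF _ main_term_mem[OF n]])
    fix t assume t: "t \<in> det_terms n k" "t \<noteq> ?t"
    show "wt (rep_weight n) (det_mono n Covect ?t) < wt (rep_weight n) (det_mono n Covect t)"
      using det_terms_weight[OF n t] by (simp add: det_mono_main wt_main_mono wt_det_mono rep_weight_def)
  qed auto
  then show ?thesis by (simp add: gen_jet_def gen_poly_def jetc_det gen_lead_def det_mono_main)
qed

lemma lead_gen_jet:
  assumes "n \<ge> 1" "v \<in> UNIV \<times> gens n"
  shows "lead (rep_weight n) (gen_jet n v) (gen_lead n v)"
  using assms lead_gen_jet_X lead_gen_jet_A lead_gen_jet_B by (cases v) (auto simp: gens_def)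

text \<open>A covector variable occurs in the leading monomial of one jet of an entry of
  \<open>x\<close>, and in that of \<open>b_s\<close> for \<open>s\<close> the number of its
  diagonal. The condition \<open>i \<le> k * n + j\<close> excludes negative diagonals, which
  truncated subtraction would send to 0.\<close>

lemma gen_lead_Covect:
  assumes "i < n" "j < n" "v \<in> UNIV \<times> gens n"
  shows "lookup (gen_lead n v) (k, Covect i j) =
    (if v = (k, GX i j) then 1 else 0) + (if v = (k * n + j - i, GB) \<and> i \<le> k * n + j then 1 else 0)"
proof -
  obtain s g where v: "v = (s, g)" by (cases v)
  show ?thesis
  proof (cases g)
    case (GX i' j')
    then show ?thesis by (simp add: v gen_lead_def lookup_add lookup_single when_def)
  next
    case GA
    then show ?thesis by (simp add: v gen_lead_def lookup_sum lookup_single when_def)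
  next
    case GB
    have "(s + i) div n = k \<and> (s + i) mod n = j \<longleftrightarrow> s + i = k * n + j"
      using assms by (metis div_mult_mod_eq div_mult_self3 div_less mod_mult_self3 mod_less add_0_right not_less_zero)
    then have e: "(s + i) div n = k \<and> (s + i) mod n = j \<longleftrightarrow> s = k * n + j - i \<and> i \<le> k * n + j"
      by auto
    have "lookup (gen_lead n v) (k, Covect i j) =
        (\<Sum>l\<in>{0..<n}. if l = i then if (s + i) div n = k \<and> (s + i) mod n = j then 1 else 0 else 0)"
    proof -
      have "gen_lead n v = main_mono n Covect s" by (simp add: v GB gen_lead_def)
      then have "lookup (gen_lead n v) (k, Covect i j) =
          (\<Sum>l\<in>{0..<n}. if ((s + l) div n, Covect l ((s + l) mod n)) = (k, Covect i j) then 1 else 0)"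
        by (auto simp: main_mono_def lookup_sum lookup_single when_def intro!: sum.cong)
      also have "\<dots> = (\<Sum>l\<in>{0..<n}. if l = i then if (s + i) div n = k \<and> (s + i) mod n = j then 1 else 0 else 0)"
        by (rule sum.cong) auto
      finally show ?thesis .
    qed
    then show ?thesis using assms e by (simp add: v GB)
  qed
qed

text \<open>The entry \<open>(0, 0)\<close> serves to read off the exponents of the
  \<open>a_k\<close>; at level 0 the first column of \<open>x\<close> interferes.\<close>

lemma gen_lead_Vect:
  assumes "n \<ge> 1"
  shows "lookup (gen_lead n v) (k, Vect 0 0) =
    (if v = (k, GA) then 1 else 0) + (if k = 0 \<and> (\<exists>i. snd v = GX i 0) then 1 else 0)"
proof -
  obtain s g where v: "v = (s, g)" by (cases v)
  have "lookup (gen_lead n (s, GA)) (k, Vect 0 0) = (\<Sum>i\<in>{0..<n}. if i = 0 then if s = k then 1 else 0 else 0)"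
  proof -
    have "lookup (gen_lead n (s, GA)) (k, Vect 0 0) =
        (\<Sum>i\<in>{0..<n}. if (if i = 0 then s else 0, Vect i i) = (k, Vect 0 0) then 1 else 0)"
      by (simp add: gen_lead_def lookup_sum lookup_single when_def cong: if_cong)
    also have "\<dots> = (\<Sum>i\<in>{0..<n}. if i = 0 then if s = k then 1 else 0 else 0)"
      by (rule sum.cong) auto
    finally show ?thesis .
  qed
  then show ?thesis
    using assms by (cases g) (auto simp: v gen_lead_def main_mono_def lookup_add lookup_sum lookup_single when_def)
qed

section \<open>Linear independence of the standard monomials\<close>

definition gen_mono_lead :: "nat \<Rightarrow> (nat \<times> inv_gen \<Rightarrow>\<^sub>0 nat) \<Rightarrow> (nat \<times> V_coord) \<Rightarrow>\<^sub>0 nat" where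
  "gen_mono_lead n \<mu> = (\<Sum>v\<in>keys \<mu>. \<Sum>i<lookup \<mu> v. gen_lead n v)"

lemma lookup_gen_mono_lead:
  assumes "finite S" "keys \<mu> \<subseteq> S"
  shows "lookup (gen_mono_lead n \<mu>) y =
    (\<Sum>v\<in>S. lookup \<mu> v * lookup (gen_lead n v) y)"
  unfolding gen_mono_lead_def lookup_sum
  by (simp, rule sum.mono_neutral_left) (use assms in \<open>auto simp: in_keys_iff\<close>)

lemma lookup_gen_mono_lead_Covect:
  assumes "i < n" "j < n" "keys \<mu> \<subseteq> UNIV \<times> gens n"
  shows "lookup (gen_mono_lead n \<mu>) (k, Covect i j) = lookup \<mu> (k, GX i j) +
    (if i \<le> k * n + j then lookup \<mu> (k * n + j - i, GB) else 0)"
proof -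
  let ?l = "lookup \<mu>" and ?s = "(k * n + j - i, GB)"
  have "lookup (gen_mono_lead n \<mu>) (k, Covect i j) =
      (\<Sum>v\<in>keys \<mu>. (if v = (k, GX i j) then ?l v else 0) +
        (if v = ?s then if i \<le> k * n + j then ?l v else 0 else 0))"
    unfolding lookup_gen_mono_lead[OF finite_keys subset_refl]
  proof (rule sum.cong)
    fix v assume "v \<in> keys \<mu>"
    then have "v \<in> UNIV \<times> gens n" using assms by blast
    from gen_lead_Covect[OF assms(1,2) this, of k]
    show "?l v * lookup (gen_lead n v) (k, Covect i j) =
        (if v = (k, GX i j) then ?l v else 0) + (if v = ?s then if i \<le> k * n + j then ?l v else 0 else 0)"
      by simp
  qed simp
  then show ?thesis by (simp add: sum.distrib in_keys_iff)
qed

text \<open>The exponents can be recovered one after the other. Each covector exponent on diagonal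
  \<open>s\<close> is the exponent of \<open>b_s\<close> plus that of one variable of
  \<open>M_s\<close>; by standardness one of the latter is zero, so the exponent of
  \<open>b_s\<close> is the minimum along the diagonal. Subtraction gives the exponents of the jets
  of \<open>x\<close>, and then the entry \<open>(0, 0)\<close> of the vectors gives those of the
  \<open>a_k\<close>.\<close>

lemma gen_mono_lead_inj:
  assumes n: "n \<ge> 1" and st: "standard n m \<mu>" "standard n m \<nu>"
    and k: "keys \<mu> \<subseteq> jvars m (gens n)" "keys \<nu> \<subseteq> jvars m (gens n)"
    and eq: "gen_mono_lead n \<mu> = gen_mono_lead n \<nu>"
  shows "\<mu> = \<nu>"
proof -
  have k': "keys \<mu> \<subseteq> UNIV \<times> gens n" "keys \<nu> \<subseteq> UNIV \<times> gens n" using k by auto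
  have le: "lookup \<nu> (s, GB) \<le> lookup \<mu> (s, GB)"
    if "enat s \<le> m" "standard n m \<mu>" "keys \<mu> \<subseteq> UNIV \<times> gens n" "keys \<nu> \<subseteq> UNIV \<times> gens n"
      "gen_mono_lead n \<mu> = gen_mono_lead n \<nu>" for s \<mu> \<nu>
  proof -
    obtain i where i: "i < n" "lookup \<mu> ((s + i) div n, GX i ((s + i) mod n)) = 0"
      using \<open>standard n m \<mu>\<close> \<open>enat s \<le> m\<close> unfolding standard_def by blast
    have "(s + i) mod n < n" using n by simp
    note L = lookup_gen_mono_lead_Covect[OF i(1) this, where k = "(s + i) div n"]
    show ?thesis using L[OF that(3)] L[OF that(4)] i(2) that(5) by simp
  qed
  have B: "lookup \<mu> (s, GB) = lookup \<nu> (s, GB)" for s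
  proof (cases "enat s \<le> m")
    case True
    then show ?thesis using le[OF True st(1) k' eq] le[OF True st(2) k'(2,1) eq[symmetric]] by simp
  next
    case False
    then have "(s, GB) \<notin> keys \<mu>" "(s, GB) \<notin> keys \<nu>" using k by auto
    then show ?thesis by (simp add: in_keys_iff)
  qed
  have X: "lookup \<mu> (k, GX i j) = lookup \<nu> (k, GX i j)" for k i j
  proof (cases "i < n \<and> j < n")
    case True
    then have "i < n" "j < n" by auto
    note L = lookup_gen_mono_lead_Covect[OF this]
    show ?thesis using L[OF k'(1), of k] L[OF k'(2), of k] eq B by (simp split: if_splits)
  next
    case False
    then have "(k, GX i j) \<notin> keys \<mu>" "(k, GX i j) \<notin> keys \<nu>"
      using k by (auto simp: gens_def)
    then show ?thesis by (simp add: in_keys_iff)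
  qed
  let ?S = "keys \<mu> \<union> keys \<nu>"
  have V: "lookup (gen_mono_lead n \<kappa>) (k, Vect 0 0) = lookup \<kappa> (k, GA) +
      (\<Sum>v\<in>?S. if k = 0 \<and> (\<exists>i. snd v = GX i 0) then lookup \<kappa> v else 0)"
    if "keys \<kappa> \<subseteq> ?S" for \<kappa> k
  proof -
    have "lookup (gen_mono_lead n \<kappa>) (k, Vect 0 0) =
        (\<Sum>v\<in>?S. (if v = (k, GA) then lookup \<kappa> v else 0) +
          (if k = 0 \<and> (\<exists>i. snd v = GX i 0) then lookup \<kappa> v else 0))"
      by (subst lookup_gen_mono_lead[OF _ that]) (auto simp: gen_lead_Vect[OF n] intro!: sum.cong)
    moreover have "lookup \<kappa> (k, GA) = 0" if "(k, GA) \<notin> ?S"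
      using that \<open>keys \<kappa> \<subseteq> ?S\<close> by (auto simp: in_keys_iff)
    ultimately show ?thesis by (simp add: sum.distrib)
  qed
  have "(\<Sum>v\<in>?S. if k = 0 \<and> (\<exists>i. snd v = GX i 0) then lookup \<mu> v else 0) =
      (\<Sum>v\<in>?S. if k = 0 \<and> (\<exists>i. snd v = GX i 0) then lookup \<nu> v else 0)" for k :: nat
  proof (rule sum.cong)
    fix v assume "v \<in> ?S"
    show "(if k = 0 \<and> (\<exists>i. snd v = GX i 0) then lookup \<mu> v else 0) =
      (if k = 0 \<and> (\<exists>i. snd v = GX i 0) then lookup \<nu> v else 0)"
      using X by (cases v) auto
  qed simp
  then have A: "lookup \<mu> (k, GA) = lookup \<nu> (k, GA)" for k
    using V[of \<mu> k] V[of \<nu> k] eq by simp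
  show ?thesis
  proof (rule poly_mapping_eqI)
    fix v show "lookup \<mu> v = lookup \<nu> v"
    proof (cases v)
      case (Pair k g)
      then show ?thesis using A B X by (cases g) auto
    qed
  qed
qed

lemma standard_independent:
  assumes n: "n \<ge> 1" and q: "q \<in> polys (jvars m (gens n))"
    and st: "\<And>\<mu>. \<mu> \<in> keys q \<Longrightarrow> standard n m \<mu>" and 0: "ev (gen_jet n) q = 0"
  shows "q = 0"
proof -
  let ?p = "\<lambda>\<mu>. \<Prod>v\<in>keys \<mu>. gen_jet n v ^ lookup \<mu> v"
  have k: "keys \<mu> \<subseteq> jvars m (gens n)" if "\<mu> \<in> keys q" for \<mu>
    using q that by (auto simp: mem_mpoly_alg)
  have "lookup q \<mu> = 0" if "\<mu> \<in> keys q" for \<mu>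
  proof (rule lead_independent[where A = "keys q" and p = ?p and \<mu> = "gen_mono_lead n"])
    show "lead (rep_weight n) (?p \<mu>) (gen_mono_lead n \<mu>)" if "\<mu> \<in> keys q" for \<mu>
      unfolding gen_mono_lead_def using k[OF that]
      by (intro lead_prod lead_power lead_gen_jet[OF n]) auto
    show "inj_on (gen_mono_lead n) (keys q)"
      using gen_mono_lead_inj[OF n st st k k] by (auto intro!: inj_onI)
    show "(\<Sum>\<mu>\<in>keys q. pconst (lookup q \<mu>) * ?p \<mu>) = 0"
      using 0 unfolding ev_altdef by simp
  qed (use that in auto)
  then show ?thesis by (metis in_keys_iff lookup_zero poly_mapping_eqI)
qed

instance V_coord :: countable by countable_datatype

text \<open>Any linear order on the coordinates will do. It makes the monomials a linearly ordered
  monoid, by which the polynomials become an integral domain: factors can be cancelled and fractions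
  formed.\<close>

instantiation V_coord :: linorder
begin
definition less_eq_V_coord :: "V_coord \<Rightarrow> V_coord \<Rightarrow> bool" where
  "less_eq_V_coord x y \<longleftrightarrow> to_nat x \<le> to_nat y"
definition less_V_coord :: "V_coord \<Rightarrow> V_coord \<Rightarrow> bool" where
  "less_V_coord x y \<longleftrightarrow> to_nat x < to_nat y"
instance
  by standard (auto simp: less_eq_V_coord_def less_V_coord_def)
end


section \<open>Invariance under arcs in the group\<close>

definition arc_eval :: "'r fps mat \<times> 'r fps mat \<Rightarrow> (nat \<times> V_coord) cpoly \<Rightarrow> 'r :: complex_algebra" where
  "arc_eval w = ev (\<lambda>(k, c). fps_nth (coord w c) k)"

interpretation arc_eval: calg_hom "arc_eval w" for w
  unfolding arc_eval_def by (rule ev.calg_hom_axioms)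

lemma arc_eval_jetc: "arc_eval w (jetc k f) = fps_nth (ev (coord w) f) k"
  by (simp add: arc_eval_def ev_jetc fps_nth_inverse)

definition mat_pairs :: "nat \<Rightarrow> ('a mat \<times> 'a mat) set" where
  "mat_pairs n = carrier_mat n n \<times> carrier_mat n n"

text \<open>A priori weaker than membership in \<open>O_Vm_inv\<close>, since only complex arcs of
  the group are tested. For polynomials in jets of level at most \<open>m\<close> the two agree in
  the end, because such arc-invariants already lie in the image of \<open>p_star\<close>.\<close>

definition arc_inv :: "nat \<Rightarrow> (nat \<times> V_coord) cpoly \<Rightarrow> bool" where
  "arc_inv n h \<longleftrightarrow> (\<forall>g \<in> carrier_mat n n. \<forall>w \<in> mat_pairs n. det g = 1 \<longrightarrow>
     arc_eval (SL_act g w) h = (arc_eval w h :: complex))"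

lemma mat_index_eq: "A \<in> carrier_mat n n \<Longrightarrow> mat n n (($$) A) = A"
  by (rule eq_matI) auto

lemma ev_det_pvar: "ev \<phi> (det (mat n n (\<lambda>(i, j). pvar (x i j)))) = det (mat n n (\<lambda>(i, j). \<phi> (x i j)))"
proof -
  have "map_mat (ev \<phi>) (mat n n (\<lambda>(i, j). pvar (x i j))) = mat n n (\<lambda>(i, j). \<phi> (x i j))"
    by (rule eq_matI) auto
  then show ?thesis by (metis ev.hom_det)
qed

lemma ev_gen_poly:
  assumes "v \<in> carrier_mat n n" "\<xi> \<in> carrier_mat n n"
  shows "i < n \<Longrightarrow> j < n \<Longrightarrow> ev (coord (v, \<xi>)) (gen_poly n (GX i j)) = (\<xi> * v) $$ (i, j)"
    and "ev (coord (v, \<xi>)) (gen_poly n GA) = det v"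
    and "ev (coord (v, \<xi>)) (gen_poly n GB) = det \<xi>"
  using assms
  by (auto simp: gen_poly_def ev.hom_sum ev.hom_mult scalar_prod_def ev_det_pvar mat_index_eq intro!: sum.cong)

lemma ev_gen_poly_rel: "ev (gen_poly n) (gen_rel n) = 0"
proof -
  let ?v = "mat n n (\<lambda>(i, j). pvar (Vect i j)) :: V_coord cpoly mat"
  let ?\<xi> = "mat n n (\<lambda>(i, j). pvar (Covect i j)) :: V_coord cpoly mat"
  have "mat n n (\<lambda>(i, j). gen_poly n (GX i j)) = ?\<xi> * ?v"
    by (rule eq_matI) (auto simp: gen_poly_def scalar_prod_def intro!: sum.cong)
  moreover have "det (?\<xi> * ?v) = det ?\<xi> * det ?v" by (rule det_mult[of _ n]) simp_all
  ultimately show ?thesis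
    by (simp add: gen_rel_def ev.hom_minus ev.hom_mult ev_det_pvar) (simp add: gen_poly_def mult.commute)
qed

lemma ev_gen_jet_jetc: "ev (gen_jet n) (jetc k f) = jetc k (ev (gen_poly n) f)"
proof -
  have "Abs_fps (\<lambda>k. gen_jet n (k, g)) = ev arc_var (gen_poly n g)" for g
    by (simp add: gen_jet_def jetc_def fps_nth_inverse)
  then show ?thesis unfolding ev_jetc by (simp add: jetc_def ev_ev)
qed

lemma gen_poly_closed: "g \<in> gens n \<Longrightarrow> gen_poly n g \<in> polys (V_coords n)"
proof -
  have "pvar (Vect i j) \<in> polys (V_coords n)" "pvar (Covect i j) \<in> polys (V_coords n)"
    if "i < n" "j < n" for i j
    using that by (auto intro!: mpoly_closed_pvar simp: V_coords_def)
  then show "g \<in> gens n \<Longrightarrow> gen_poly n g \<in> polys (V_coords n)"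
    by (auto simp: gens_def gen_poly_def intro!: mpoly_closed_sum mpoly_closed_det[of _ n])
qed

lemma gen_jet_closed: "v \<in> jvars m (gens n) \<Longrightarrow> gen_jet n v \<in> polys (jvars m (V_coords n))"
  unfolding gen_jet_def by (rule jetc_closed) (auto intro: gen_poly_closed)

text \<open>
  The functions on arcs which become polynomials in the jets of the invariants after multiplication
  by a power of the order zero coefficient of the determinant \<open>u\<close>.
\<close>

context
  fixes n :: nat and m :: enat and u :: inv_gen
  assumes u: "u \<in> gens n"
begin

definition inv_value :: "complex fps mat \<times> complex fps mat \<Rightarrow> (nat \<times> inv_gen) cpoly \<Rightarrow> complex" where
  "inv_value w Q = arc_eval w (ev (gen_jet n) Q)"

definition inv_dom :: "(complex fps mat \<times> complex fps mat) set" where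
  "inv_dom = {w \<in> mat_pairs n. inv_value w (pvar (0, u)) \<noteq> 0}"

definition inv_rational :: "(complex fps mat \<times> complex fps mat \<Rightarrow> complex) \<Rightarrow> bool" where
  "inv_rational c \<longleftrightarrow> (\<exists>N. \<exists>Q \<in> polys (jvars m (gens n)). \<forall>w \<in> inv_dom.
     c w * inv_value w (pvar (0, u)) ^ N = inv_value w Q)"

interpretation inv_value: calg_hom "inv_value w" for w
  unfolding inv_value_def by (rule calg_hom_comp[OF ev.calg_hom_axioms arc_eval.calg_hom_axioms])

lemma inv_value_pvar: "inv_value w (pvar (k, g)) = fps_nth (ev (coord w) (gen_poly n g)) k"
  by (simp add: inv_value_def gen_jet_def arc_eval_jetc)

lemma u0_closed: "pvar (0, u) \<in> polys (jvars m (gens n))"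
  using u by (simp add: zero_enat_def[symmetric])

lemma u0_power_closed: "pvar (0, u) ^ N \<in> polys (jvars m (gens n))"
  by (induction N) (use u0_closed in auto)

lemma inv_rationalI:
  "Q \<in> polys (jvars m (gens n)) \<Longrightarrow>
    (\<And>w. w \<in> inv_dom \<Longrightarrow> c w * inv_value w (pvar (0, u)) ^ N = inv_value w Q) \<Longrightarrow> inv_rational c"
  unfolding inv_rational_def by blast

lemma inv_rational_const: "inv_rational (\<lambda>_. c)"
  by (rule inv_rationalI[of "pconst c" _ 0]) (use inv_value.hom_scalar[of _ c] in simp_all)

lemma inv_rational_gen: "enat k \<le> m \<Longrightarrow> g \<in> gens n \<Longrightarrow> inv_rational (\<lambda>w. inv_value w (pvar (k, g)))"
  by (rule inv_rationalI[of "pvar (k, g)" _ 0]) simp_all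

lemma inv_rational_inverse: "inv_rational (\<lambda>w. inverse (inv_value w (pvar (0, u))))"
  by (rule inv_rationalI[of 1 _ 1]) (simp_all add: inv_dom_def)

lemma inv_rational_add:
  assumes "inv_rational c" "inv_rational d" shows "inv_rational (\<lambda>w. c w + d w)"
proof -
  obtain N Q M R where *: "Q \<in> polys (jvars m (gens n))" "R \<in> polys (jvars m (gens n))"
    "\<forall>w \<in> inv_dom. c w * inv_value w (pvar (0, u)) ^ N = inv_value w Q"
    "\<forall>w \<in> inv_dom. d w * inv_value w (pvar (0, u)) ^ M = inv_value w R"
    using assms unfolding inv_rational_def by blast
  show ?thesis
  proof (rule inv_rationalI)
    show "Q * pvar (0, u) ^ M + R * pvar (0, u) ^ N \<in> polys (jvars m (gens n))"
      using * u0_power_closed by auto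
    show "(c w + d w) * inv_value w (pvar (0, u)) ^ (N + M) = inv_value w (Q * pvar (0, u) ^ M + R * pvar (0, u) ^ N)"
      if "w \<in> inv_dom" for w
    proof -
      let ?y = "inv_value w (pvar (0, u))"
      have "(c w + d w) * ?y ^ (N + M) = c w * ?y ^ N * ?y ^ M + d w * ?y ^ M * ?y ^ N"
        by (simp add: algebra_simps power_add)
      then show ?thesis using *(3,4) that
        by (simp add: inv_value.hom_add inv_value.hom_mult inv_value.hom_power)
    qed
  qed
qed

lemma inv_rational_mult:
  assumes "inv_rational c" "inv_rational d" shows "inv_rational (\<lambda>w. c w * d w)"
proof -
  obtain N Q M R where *: "Q \<in> polys (jvars m (gens n))" "R \<in> polys (jvars m (gens n))"
    "\<forall>w \<in> inv_dom. c w * inv_value w (pvar (0, u)) ^ N = inv_value w Q"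
    "\<forall>w \<in> inv_dom. d w * inv_value w (pvar (0, u)) ^ M = inv_value w R"
    using assms unfolding inv_rational_def by blast
  show ?thesis
  proof (rule inv_rationalI)
    show "Q * R \<in> polys (jvars m (gens n))" using * by auto
    show "c w * d w * inv_value w (pvar (0, u)) ^ (N + M) = inv_value w (Q * R)" if "w \<in> inv_dom" for w
    proof -
      let ?y = "inv_value w (pvar (0, u))"
      have "c w * d w * ?y ^ (N + M) = (c w * ?y ^ N) * (d w * ?y ^ M)"
        by (simp add: algebra_simps power_add)
      then show ?thesis using *(3,4) that by (simp add: inv_value.hom_mult)
    qed
  qed
qed

lemma inv_rational_sum:
  "(\<And>i. i \<in> A \<Longrightarrow> inv_rational (c i)) \<Longrightarrow> inv_rational (\<lambda>w. \<Sum>i\<in>A. c i w)"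
  by (induction A rule: infinite_finite_induct) (auto intro: inv_rational_add inv_rational_const)

lemma inv_rational_cong:
  "inv_rational c \<Longrightarrow> (\<And>w. w \<in> inv_dom \<Longrightarrow> c w = d w) \<Longrightarrow> inv_rational d"
  unfolding inv_rational_def by (metis (no_types, lifting))

definition inv_rational_arc :: "(complex fps mat \<times> complex fps mat \<Rightarrow> complex fps) \<Rightarrow> bool" where
  "inv_rational_arc F \<longleftrightarrow> (\<forall>k. enat k \<le> m \<longrightarrow> inv_rational (\<lambda>w. fps_nth (F w) k))"

lemma inv_rational_arc_const [simp]: "inv_rational_arc (\<lambda>_. F)"
  unfolding inv_rational_arc_def using inv_rational_const by blast

lemma inv_rational_arc_gen: "g \<in> gens n \<Longrightarrow> inv_rational_arc (\<lambda>w. ev (coord w) (gen_poly n g))"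
  unfolding inv_rational_arc_def using inv_rational_gen by (simp add: inv_value_pvar)

lemma inv_rational_arc_mult:
  assumes "inv_rational_arc F" "inv_rational_arc G" shows "inv_rational_arc (\<lambda>w. F w * G w)"
  unfolding inv_rational_arc_def fps_mult_nth
proof (intro allI impI inv_rational_sum inv_rational_mult)
  fix k i assume "enat k \<le> m" "i \<in> {0..k}"
  then have "enat i \<le> m" "enat (k - i) \<le> m" using enat_le_mono[of k m] by auto
  then show "inv_rational (\<lambda>w. fps_nth (F w) i)" "inv_rational (\<lambda>w. fps_nth (G w) (k - i))"
    using assms by (auto simp: inv_rational_arc_def)
qed

text \<open>The recursion for the coefficients of the inverse of a power series divides only by the
  constant term, here \<open>u\<close> at level 0. Coefficients of order at most \<open>m\<close>
  involve only jets of order at most \<open>m\<close>.\<close>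

lemma inv_rational_arc_inverse: "inv_rational_arc (\<lambda>w. inverse (ev (coord w) (gen_poly n u)))"
  unfolding inv_rational_arc_def
proof (intro allI impI)
  let ?F = "\<lambda>w. ev (coord w) (gen_poly n u)"
  fix k assume "enat k \<le> m"
  then show "inv_rational (\<lambda>w. fps_nth (inverse (?F w)) k)"
  proof (induction k rule: less_induct)
    case (less k)
    have r: "inv_rational (\<lambda>w. fps_nth (?F w) (Suc i))" if "i < k" for i
      using inv_rational_arc_gen[OF u] less.prems that enat_le_mono[of k m "Suc i"]
      unfolding inv_rational_arc_def by auto
    have "inv_rational (\<lambda>w. inverse (inv_value w (pvar (0, u))) *
        ((if k = 0 then 1 else 0) + (- 1) * (\<Sum>i<k. fps_nth (?F w) (Suc i) * fps_nth (inverse (?F w)) (k - Suc i))))"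
      using less r enat_le_mono[OF less.prems]
      by (intro inv_rational_mult inv_rational_add inv_rational_sum inv_rational_const inv_rational_inverse) auto
    then show ?case
    proof (rule inv_rational_cong)
      fix w assume "w \<in> inv_dom"
      then have nz: "fps_nth (?F w) 0 \<noteq> 0" by (simp add: inv_dom_def inv_value_pvar)
      then have "inverse (?F w) * ?F w = 1" by (rule inverse_mult_eq_1)
      then have "(if k = 0 then 1 else 0) = fps_nth (?F w * inverse (?F w)) k"
        by (simp add: mult.commute)
      also have "\<dots> = (\<Sum>i<Suc k. fps_nth (?F w) i * fps_nth (inverse (?F w)) (k - i))"
        by (simp add: fps_mult_nth atLeast0AtMost lessThan_Suc_atMost)
      also have "\<dots> = fps_nth (?F w) 0 * fps_nth (inverse (?F w)) k +
          (\<Sum>i<k. fps_nth (?F w) (Suc i) * fps_nth (inverse (?F w)) (k - Suc i))"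
        by (subst sum.lessThan_Suc_shift) simp
      finally show "inverse (inv_value w (pvar (0, u))) * ((if k = 0 then 1 else 0) +
          (- 1) * (\<Sum>i<k. fps_nth (?F w) (Suc i) * fps_nth (inverse (?F w)) (k - Suc i))) =
          fps_nth (inverse (?F w)) k"
        using nz by (simp add: inv_value_pvar field_simps)
    qed
  qed
qed

lemma inv_rational_arc_eval:
  assumes "h \<in> polys (jvars m (V_coords n))"
    and c: "\<And>c. c \<in> V_coords n \<Longrightarrow> inv_rational_arc (\<lambda>w. coord (f w) c)"
  shows "inv_rational (\<lambda>w. arc_eval (f w) h)"
  using assms(1)
proof (induction h rule: mpoly_alg_induct)
  case (const a)
  have "arc_eval w (pconst a) = a" for w :: "complex fps mat \<times> complex fps mat"
    using arc_eval.hom_scalar[of w a] by simp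
  then show ?case using inv_rational_const[of a] by simp
next
  case (var v)
  then show ?case using c[of "snd v"] by (auto simp: arc_eval_def inv_rational_arc_def)
next
  case (add p q)
  then show ?case by (simp add: arc_eval.hom_add inv_rational_add)
next
  case (mult p q)
  then show ?case by (simp add: arc_eval.hom_mult inv_rational_mult)
qed

text \<open>\<open>f\<close> moves \<open>w\<close> within its orbit to a point whose coordinates
  are rational in the invariants with powers of \<open>u\<close> at level 0 as denominators. Since
  \<open>h\<close> has the same value at \<open>w\<close> and at \<open>f w\<close>, it is rational
  in the same sense.\<close>

lemma slice:
  assumes h: "h \<in> polys (jvars m (V_coords n))" "arc_inv n h"
    and c: "\<And>c. c \<in> V_coords n \<Longrightarrow> inv_rational_arc (\<lambda>w. coord (f w) c)"
    and f: "\<And>w. w \<in> inv_dom \<Longrightarrow> \<exists>g \<in> carrier_mat n n. det g = 1 \<and> f w = SL_act g w"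
  shows "\<exists>N. \<exists>Q \<in> polys (jvars m (gens n)). h * gen_jet n (0, u) ^ N = ev (gen_jet n) Q"
proof -
  have eq: "arc_eval (f w) h = arc_eval w h" if w: "w \<in> inv_dom" for w
  proof -
    obtain g where "g \<in> carrier_mat n n" "det g = 1" "f w = SL_act g w" using f[OF w] by blast
    then show ?thesis using h(2) w by (simp add: arc_inv_def inv_dom_def)
  qed
  have "inv_rational (\<lambda>w. arc_eval w h)"
    by (rule inv_rational_cong[OF inv_rational_arc_eval[OF h(1) c] eq])
  then obtain N Q where Q: "Q \<in> polys (jvars m (gens n))"
    "\<forall>w \<in> inv_dom. arc_eval w h * inv_value w (pvar (0, u)) ^ N = inv_value w Q"
    unfolding inv_rational_def by blast
  let ?u = "gen_jet n (0, u)"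
  have u': "?u \<in> polys (jvars m (V_coords n))"
    by (rule gen_jet_closed) (use u in \<open>simp add: zero_enat_def[symmetric]\<close>)
  have up: "?u ^ k \<in> polys (jvars m (V_coords n))" for k
    by (induction k) (use u' in auto)
  \<comment> \<open>The extra factor \<open>?u\<close> makes \<open>d\<close> vanish at the arcs
    outside \<open>inv_dom\<close> as well, so that \<open>d\<close> is zero as a
    polynomial.\<close>
  define d where "d = (h * ?u ^ N - ev (gen_jet n) Q) * ?u"
  have "ev (gen_jet n) Q \<in> polys (jvars m (V_coords n))"
    by (rule ev_closed[OF gen_jet_closed Q(1)])
  then have d: "d \<in> polys (jvars m (V_coords n))"
    unfolding d_def by (intro mpoly_closed(5) mpoly_closed_diff h(1) u' up)
  have "d = 0"
  proof (rule cpoly_eq_0I)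
    fix z :: "nat \<times> V_coord \<Rightarrow> complex"
    define w where "w = (mat n n (\<lambda>(i, j). Abs_fps (\<lambda>k. z (k, Vect i j))), mat n n (\<lambda>(i, j). Abs_fps (\<lambda>k. z (k, Covect i j))))"
    have w: "w \<in> mat_pairs n" by (simp add: w_def mat_pairs_def)
    have "arc_eval w d = 0"
    proof (cases "w \<in> inv_dom")
      case True
      then have "arc_eval w h * arc_eval w ?u ^ N = arc_eval w (ev (gen_jet n) Q)"
        using Q(2) by (simp add: inv_value_def)
      then show ?thesis
        by (simp add: d_def arc_eval.hom_mult arc_eval.hom_minus arc_eval.hom_power)
    next
      case False
      then have "arc_eval w ?u = 0" using w by (simp add: inv_dom_def inv_value_def)
      then show ?thesis by (simp add: d_def arc_eval.hom_mult)
    qed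
    moreover have "arc_eval w d = ev z d"
      unfolding arc_eval_def by (rule ev_cong[OF d]) (auto simp: V_coords_def w_def)
    ultimately show "ev z d = 0" by simp
  qed
  then have "h * ?u ^ Suc N = ev (gen_jet n) (Q * pvar (0, u))"
    by (simp add: d_def ev.hom_mult algebra_simps)
  then show ?thesis using Q(1) u0_closed by blast
qed

end

section \<open>Diagonal representatives of orbits over a ring\<close>

definition diag_matrix :: "nat \<Rightarrow> (nat \<Rightarrow> 'a :: comm_ring_1) \<Rightarrow> 'a mat" where
  "diag_matrix n c = mat n n (\<lambda>(i, j). if i = j then c i else 0)"

lemma diag_matrix_carrier [simp]: "diag_matrix n c \<in> carrier_mat n n"
  by (simp add: diag_matrix_def)

lemma diag_matrix_mult:
  assumes "M \<in> carrier_mat n n"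
  shows "diag_matrix n c * M = mat n n (\<lambda>(i, j). c i * M $$ (i, j))"
    and "M * diag_matrix n c = mat n n (\<lambda>(i, j). M $$ (i, j) * c j)"
proof -
  have "(\<Sum>k = 0..<n. (if i = k then c i else 0) * M $$ (k, j)) = c i * M $$ (i, j)" if "i < n" for i j
  proof -
    have "(\<Sum>k = 0..<n. (if i = k then c i else 0) * M $$ (k, j)) = (\<Sum>k = 0..<n. if i = k then c i * M $$ (k, j) else 0)"
      by (rule sum.cong) auto
    then show ?thesis using that by simp
  qed
  then show "diag_matrix n c * M = mat n n (\<lambda>(i, j). c i * M $$ (i, j))"
    using assms by (intro eq_matI) (auto simp: diag_matrix_def scalar_prod_def)
  have "(\<Sum>k = 0..<n. M $$ (i, k) * (if k = j then c k else 0)) = M $$ (i, j) * c j" if "j < n" for i j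
  proof -
    have "(\<Sum>k = 0..<n. M $$ (i, k) * (if k = j then c k else 0)) = (\<Sum>k = 0..<n. if k = j then M $$ (i, k) * c k else 0)"
      by (rule sum.cong) auto
    then show ?thesis using that by simp
  qed
  then show "M * diag_matrix n c = mat n n (\<lambda>(i, j). M $$ (i, j) * c j)"
    using assms by (intro eq_matI) (auto simp: diag_matrix_def scalar_prod_def)
qed

lemma det_diag_matrix: "det (diag_matrix n c) = (\<Prod>i\<in>{0..<n}. c i)"
proof -
  have "det (diag_matrix n c) = prod_list (diag_mat (diag_matrix n c))"
    by (rule det_upper_triangular[of _ n]) (auto simp: diag_matrix_def)
  also have "\<dots> = (\<Prod>i\<in>{0..<n}. c i)"
    by (simp add: prod_list_diag_prod diag_matrix_def)
  finally show ?thesis .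
qed

text \<open>The matrix \<open>g\<close> is \<open>D\<close> times the inverse of \<open>M\<close>,
  in the respective order, with that inverse written as \<open>b\<close> times the adjugate. Its
  determinant is 1 because \<open>det D = det M\<close> is a unit.\<close>

lemma unimodular_diagonalize:
  fixes M :: "'a :: comm_ring_1 mat"
  assumes n: "n \<ge> 1" and M: "M \<in> carrier_mat n n" and a: "det M * b = 1"
  defines "D \<equiv> diag_matrix n (\<lambda>i. if i = 0 then det M else 1)"
  shows "\<exists>g \<in> carrier_mat n n. det g = 1 \<and> g * M = D"
    and "\<exists>g \<in> carrier_mat n n. det g = 1 \<and> M * g = D"
proof -
  let ?c = "\<lambda>i :: nat. if i = 0 then det M else 1"
  let ?E = "diag_matrix n (\<lambda>i. b * ?c i)"
  note adj = adj_mat[OF M]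
  have bc: "b * ?c i * det M = ?c i" for i
  proof -
    have "b * ?c i * det M = ?c i * (det M * b)" by (simp only: mult_ac)
    then show ?thesis by (simp only: a mult_1_right)
  qed
  have "?E * (det M \<cdot>\<^sub>m 1\<^sub>m n) = D"
    by (subst diag_matrix_mult) (auto simp: D_def diag_matrix_def bc intro!: eq_matI)
  moreover have "(det M \<cdot>\<^sub>m 1\<^sub>m n) * ?E = D"
    by (subst diag_matrix_mult) (auto simp: D_def diag_matrix_def bc[unfolded mult.commute[of _ "det M"]] intro!: eq_matI)
  moreover have "(?E * adj_mat M) * M = ?E * (adj_mat M * M)"
    by (rule assoc_mult_mat[of _ n n _ n _ n]) (use M adj in auto)
  moreover have "M * (adj_mat M * ?E) = (M * adj_mat M) * ?E"
    by (rule assoc_mult_mat[of _ n n _ n _ n, symmetric]) (use M adj in auto)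
  ultimately have 1: "(?E * adj_mat M) * M = D" and 2: "M * (adj_mat M * ?E) = D"
    using adj by simp_all
  have gc: "?E * adj_mat M \<in> carrier_mat n n" "adj_mat M * ?E \<in> carrier_mat n n"
    by (rule mult_carrier_mat[OF diag_matrix_carrier adj(1)], rule mult_carrier_mat[OF adj(1) diag_matrix_carrier])
  have detD: "det D = det M"
    using n unfolding D_def det_diag_matrix by (subst prod.remove[of _ 0]) auto
  have u: "x = 1" if "x * det M = det M" for x :: 'a
  proof -
    have "x = x * det M * b" using a by (simp add: mult.assoc)
    then show ?thesis using that a by simp
  qed
  have "det (?E * adj_mat M) * det M = det M"
    using arg_cong[OF 1, of det] det_mult[OF gc(1) M] detD by simp
  then show "\<exists>g \<in> carrier_mat n n. det g = 1 \<and> g * M = D"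
    using 1 u gc(1) by (intro bexI[of _ "?E * adj_mat M"]) auto
  have "det (adj_mat M * ?E) * det M = det M"
    using arg_cong[OF 2, of det] det_mult[OF M gc(2)] detD by (simp add: mult.commute)
  then show "\<exists>g \<in> carrier_mat n n. det g = 1 \<and> M * g = D"
    using 2 u gc(2) by (intro bexI[of _ "adj_mat M * ?E"]) auto
qed

lemma adj_mat_unimodular:
  assumes "g \<in> carrier_mat n n" "det g = 1"
  shows "adj_mat g \<in> carrier_mat n n" "g * adj_mat g = 1\<^sub>m n" "adj_mat g * g = 1\<^sub>m n"
    "det (adj_mat g) = 1" "adj_mat (adj_mat g) = g"
proof -
  have one: "(1 :: 'a) \<cdot>\<^sub>m 1\<^sub>m n = 1\<^sub>m n" by (rule eq_matI) auto
  show c: "adj_mat g \<in> carrier_mat n n" and 1: "g * adj_mat g = 1\<^sub>m n" and 2: "adj_mat g * g = 1\<^sub>m n"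
    using adj_mat[OF assms(1)] assms(2) one by simp_all
  show d: "det (adj_mat g) = 1"
    using arg_cong[OF 1, of det] det_mult[OF assms(1) c] assms(2) by simp
  have c': "adj_mat (adj_mat g) \<in> carrier_mat n n" and 3: "adj_mat g * adj_mat (adj_mat g) = 1\<^sub>m n"
    using adj_mat[OF c] d one by simp_all
  have "adj_mat (adj_mat g) = (g * adj_mat g) * adj_mat (adj_mat g)" unfolding 1 using c' by simp
  also have "\<dots> = g * (adj_mat g * adj_mat (adj_mat g))" by (rule assoc_mult_mat[OF assms(1) c c'])
  finally show "adj_mat (adj_mat g) = g" unfolding 3 using assms(1) by simp
qed

lemma slice_A:
  assumes n: "n \<ge> 1" and h: "h \<in> polys (jvars m (V_coords n))" "arc_inv n h"
  shows "\<exists>N. \<exists>Q \<in> polys (jvars m (gens n)). h * gen_jet n (0, GA) ^ N = ev (gen_jet n) Q"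
proof -
  have u: "GA \<in> gens n" by (simp add: gens_def)
  let ?a = "\<lambda>w :: complex fps mat \<times> complex fps mat. ev (coord w) (gen_poly n GA)"
  \<comment> \<open>If \<open>g v = D = diag(a, 1, ..., 1)\<close>, then the covectors move to
    \<open>\<xi>\<close> times the inverse of \<open>g\<close>, which is \<open>x\<close> times the
    inverse of \<open>D\<close>. Both components are expressed by invariants and the inverse of
    \<open>a\<close>.\<close>
  define f :: "complex fps mat \<times> complex fps mat \<Rightarrow> complex fps mat \<times> complex fps mat" where
    "f w = (mat n n (\<lambda>(i, j). if i = j then if i = 0 then ?a w else 1 else 0),
      mat n n (\<lambda>(i, j). ev (coord w) (gen_poly n (GX i j)) * (if j = 0 then inverse (?a w) else 1)))" for w
  show ?thesis
  proof (rule slice[OF u h])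
    note r = inv_rational_arc_const[OF u] inv_rational_arc_gen[OF u] inv_rational_arc_mult[OF u]
      inv_rational_arc_inverse[OF u]
    fix c assume "c \<in> V_coords n"
    then consider i j where "i < n" "j < n" "c = Vect i j" | i j where "i < n" "j < n" "c = Covect i j"
      by (auto simp: V_coords_def)
    then show "inv_rational_arc n m GA (\<lambda>w. coord (f w) c)"
    proof cases
      case (1 i j)
      then show ?thesis using r(1) r(2)[OF u] by (cases "i = j"; cases "i = 0") (simp_all add: f_def)
    next
      case (2 i j)
      then have "GX i j \<in> gens n" by (auto simp: gens_def)
      then show ?thesis using 2 r(2) r(3)[OF r(2) r(4)] by (cases "j = 0") (simp_all add: f_def)
    qed
  next
    fix w assume w: "w \<in> inv_dom n GA"
    obtain v \<xi> where vx: "w = (v, \<xi>)" by (cases w)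
    have c: "v \<in> carrier_mat n n" "\<xi> \<in> carrier_mat n n" using w by (auto simp: inv_dom_def[OF u] mat_pairs_def vx)
    note e = ev_gen_poly[OF c]
    have a: "det v * inverse (det v) = 1"
      using w inverse_mult_eq_1[of "det v"] by (simp add: inv_dom_def[OF u] vx inv_value_pvar[OF u] e(2) mult.commute)
    let ?c = "\<lambda>i :: nat. if i = 0 then det v else 1"
    obtain g where g: "g \<in> carrier_mat n n" "det g = 1" "g * v = diag_matrix n ?c"
      using unimodular_diagonalize(1)[OF n c(1) a] by blast
    note ag = adj_mat_unimodular[OF g(1,2)]
    have "\<xi> * v = (\<xi> * adj_mat g) * diag_matrix n ?c"
    proof -
      have "(\<xi> * adj_mat g) * (g * v) = \<xi> * (adj_mat g * (g * v))"
        by (rule assoc_mult_mat[of _ n n _ n _ n]) (use c g ag in auto)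
      also have "adj_mat g * (g * v) = (adj_mat g * g) * v"
        by (rule assoc_mult_mat[of _ n n _ n _ n, symmetric]) (use c g ag in auto)
      finally show ?thesis using c by (simp add: ag g(3))
    qed
    also have "\<dots> = mat n n (\<lambda>(i, j). (\<xi> * adj_mat g) $$ (i, j) * ?c j)"
      by (rule diag_matrix_mult(2)) (use c ag in auto)
    finally have x: "(\<xi> * v) $$ (i, j) = (\<xi> * adj_mat g) $$ (i, j) * ?c j" if "i < n" "j < n" for i j
      using that by simp
    have "\<xi> * adj_mat g = snd (f w)"
      by (rule eq_matI) (use c ag a in \<open>auto simp: f_def vx e x mult.assoc simp del: index_mult_mat(1)\<close>)
    moreover have "g * v = fst (f w)"
      unfolding g(3) by (rule eq_matI) (auto simp: f_def vx e diag_matrix_def)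
    ultimately have "f w = SL_act g w" by (simp add: SL_act_def vx prod_eq_iff)
    then show "\<exists>g \<in> carrier_mat n n. det g = 1 \<and> f w = SL_act g w" using g by blast
  qed
qed

lemma slice_B:
  assumes n: "n \<ge> 1" and h: "h \<in> polys (jvars m (V_coords n))" "arc_inv n h"
  shows "\<exists>N. \<exists>Q \<in> polys (jvars m (gens n)). h * gen_jet n (0, GB) ^ N = ev (gen_jet n) Q"
proof -
  have u: "GB \<in> gens n" by (simp add: gens_def)
  let ?a = "\<lambda>w :: complex fps mat \<times> complex fps mat. ev (coord w) (gen_poly n GB)"
  \<comment> \<open>The mirror image: if \<open>\<xi> g = D\<close>, the inverse of \<open>g\<close>
    moves \<open>\<xi>\<close> to \<open>D\<close> and \<open>v\<close> to the inverse of
    \<open>D\<close> times \<open>x\<close>.\<close>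
  define f :: "complex fps mat \<times> complex fps mat \<Rightarrow> complex fps mat \<times> complex fps mat" where
    "f w = (mat n n (\<lambda>(i, j). (if i = 0 then inverse (?a w) else 1) * ev (coord w) (gen_poly n (GX i j))),
      mat n n (\<lambda>(i, j). if i = j then if i = 0 then ?a w else 1 else 0))" for w
  show ?thesis
  proof (rule slice[OF u h])
    note r = inv_rational_arc_const[OF u] inv_rational_arc_gen[OF u] inv_rational_arc_mult[OF u]
      inv_rational_arc_inverse[OF u]
    fix c assume "c \<in> V_coords n"
    then consider i j where "i < n" "j < n" "c = Vect i j" | i j where "i < n" "j < n" "c = Covect i j"
      by (auto simp: V_coords_def)
    then show "inv_rational_arc n m GB (\<lambda>w. coord (f w) c)"
    proof cases
      case (1 i j)
      then have "GX i j \<in> gens n" by (auto simp: gens_def)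
      then show ?thesis using 1 r(2) r(3)[OF r(4) r(2)] by (cases "i = 0") (simp_all add: f_def)
    next
      case (2 i j)
      then show ?thesis using r(1) r(2)[OF u] by (cases "i = j"; cases "i = 0") (simp_all add: f_def)
    qed
  next
    fix w assume w: "w \<in> inv_dom n GB"
    obtain v \<xi> where vx: "w = (v, \<xi>)" by (cases w)
    have c: "v \<in> carrier_mat n n" "\<xi> \<in> carrier_mat n n" using w by (auto simp: inv_dom_def[OF u] mat_pairs_def vx)
    note e = ev_gen_poly[OF c]
    have a: "det \<xi> * inverse (det \<xi>) = 1"
      using w inverse_mult_eq_1[of "det \<xi>"] by (simp add: inv_dom_def[OF u] vx inv_value_pvar[OF u] e(3) mult.commute)
    let ?c = "\<lambda>i :: nat. if i = 0 then det \<xi> else 1"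
    obtain g where g: "g \<in> carrier_mat n n" "det g = 1" "\<xi> * g = diag_matrix n ?c"
      using unimodular_diagonalize(2)[OF n c(2) a] by blast
    note ag = adj_mat_unimodular[OF g(1,2)]
    have "\<xi> * v = diag_matrix n ?c * (adj_mat g * v)"
    proof -
      have "(\<xi> * g) * (adj_mat g * v) = \<xi> * (g * (adj_mat g * v))"
        by (rule assoc_mult_mat[of _ n n _ n _ n]) (use c g ag in auto)
      also have "g * (adj_mat g * v) = (g * adj_mat g) * v"
        by (rule assoc_mult_mat[of _ n n _ n _ n, symmetric]) (use c g ag in auto)
      finally show ?thesis using c by (simp add: ag g(3))
    qed
    also have "\<dots> = mat n n (\<lambda>(i, j). ?c i * (adj_mat g * v) $$ (i, j))"
      by (rule diag_matrix_mult(1)) (use c ag in auto)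
    finally have x: "(\<xi> * v) $$ (i, j) = ?c i * (adj_mat g * v) $$ (i, j)" if "i < n" "j < n" for i j
      using that by simp
    have a': "inverse (det \<xi>) * (det \<xi> * y) = y" for y
      using a by (metis mult.assoc mult.commute mult_1)
    have "adj_mat g * v = fst (f w)"
      by (rule eq_matI) (use c ag a' in \<open>auto simp: f_def vx e x simp del: index_mult_mat(1)\<close>)
    moreover have "\<xi> * g = snd (f w)"
      unfolding g(3) by (rule eq_matI) (auto simp: f_def vx e diag_matrix_def)
    ultimately have "f w = SL_act (adj_mat g) w" by (simp add: SL_act_def vx prod_eq_iff ag)
    then show "\<exists>g \<in> carrier_mat n n. det g = 1 \<and> f w = SL_act g w" using ag by blast
  qed
qed

section \<open>The regular sequence \<open>a_0, b_0\<close>\<close>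

definition det_power :: "inv_gen \<Rightarrow> nat \<Rightarrow> (nat \<times> inv_gen) \<Rightarrow>\<^sub>0 nat" where
  "det_power u N = single (0, u) N"

lemma pvar_det_power: "pvar (0, u) ^ N = single (det_power u N) (1 :: complex)"
  by (simp add: det_power_def pvar_power)

lemma keys_single_mult:
  "keys (single \<nu> 1 * (p :: 'v cpoly)) \<subseteq> (+) \<nu> ` keys p"
  by (auto elim!: keys_multE)

text \<open>The \<open>M_s\<close> involve only jets of \<open>x\<close>, so multiplication by
  \<open>a_0\<close> or \<open>b_0\<close> preserves standardness. This is the form in which
  freeness over the polynomial ring in the \<open>a_k\<close> and \<open>b_k\<close> enters.\<close>

lemma standard_det_power:
  assumes "u = GA \<or> u = GB" "standard n m \<mu>" shows "standard n m (det_power u N + \<mu>)"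
  using assms by (auto simp: standard_def det_power_def lookup_add lookup_single when_def)

text \<open>Let the standard polynomials \<open>p\<close> and \<open>q\<close> represent
  \<open>a_0^N h\<close> and \<open>b_0^M h\<close>. Then \<open>a_0^N q\<close> and
  \<open>b_0^M p\<close> are standard with the same image, hence equal as formal polynomials, and
  \<open>a_0^N\<close> divides \<open>p\<close> monomial by monomial.\<close>

lemma arc_inv_imp_gen:
  assumes n: "n \<ge> 1" and h: "h \<in> polys (jvars m (V_coords n))" "arc_inv n h"
  shows "\<exists>Q \<in> polys (jvars m (gens n)). h = ev (gen_jet n) Q"
proof -
  let ?C = "polys (jvars m (gens n))"
  have j0: "jetc s 0 = 0" for s :: nat by (simp add: jetc_def)
  have span: "\<exists>q \<in> ?C. (\<forall>\<mu> \<in> keys q. standard n m \<mu>) \<and> ev (gen_jet n) Q = ev (gen_jet n) q"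
    if "Q \<in> ?C" for Q
  proof -
    have "\<exists>q \<in> ?C. (\<forall>\<mu> \<in> keys q. standard n m \<mu>) \<and> Q - q \<in> {p. ev (gen_jet n) p = 0}"
      by (rule standard_span[OF refl n _ _ _ _ that])
         (auto simp: ev.hom_add ev.hom_mult ev_gen_jet_jetc ev_gen_poly_rel j0)
    then show ?thesis by (auto simp: ev.hom_minus)
  qed
  obtain N Q where "Q \<in> ?C" "h * gen_jet n (0, GA) ^ N = ev (gen_jet n) Q"
    using slice_A[OF n h] by blast
  then obtain p where p: "p \<in> ?C" "\<forall>\<mu> \<in> keys p. standard n m \<mu>"
    "h * gen_jet n (0, GA) ^ N = ev (gen_jet n) p" using span[of Q] by auto
  obtain M R where "R \<in> ?C" "h * gen_jet n (0, GB) ^ M = ev (gen_jet n) R"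
    using slice_B[OF n h] by blast
  then obtain q where q: "q \<in> ?C" "\<forall>\<mu> \<in> keys q. standard n m \<mu>"
    "h * gen_jet n (0, GB) ^ M = ev (gen_jet n) q" using span[of R] by auto
  let ?a = "det_power GA N" and ?b = "det_power GB M"
  let ?\<alpha> = "single ?a 1 :: (nat \<times> inv_gen) cpoly" and ?\<beta> = "single ?b 1 :: (nat \<times> inv_gen) cpoly"
  have e: "ev (gen_jet n) ?\<alpha> = gen_jet n (0, GA) ^ N" "ev (gen_jet n) ?\<beta> = gen_jet n (0, GB) ^ M"
    by (simp_all add: pvar_det_power[symmetric] ev.hom_power)
  have "?\<alpha> * q - ?\<beta> * p = 0"
  proof (rule standard_independent[OF n])
    have "?\<alpha> \<in> ?C" "?\<beta> \<in> ?C"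
      by (auto simp: mem_mpoly_alg det_power_def gens_def zero_enat_def[symmetric])
    then show "?\<alpha> * q - ?\<beta> * p \<in> ?C" using p(1) q(1) by (intro mpoly_closed_diff mpoly_closed(5))
    show "ev (gen_jet n) (?\<alpha> * q - ?\<beta> * p) = 0"
      using p(3) q(3) by (simp add: ev.hom_minus ev.hom_mult e p(3)[symmetric] q(3)[symmetric] mult_ac)
    fix \<mu> assume "\<mu> \<in> keys (?\<alpha> * q - ?\<beta> * p)"
    then have "\<mu> \<in> keys (?\<alpha> * q) \<or> \<mu> \<in> keys (?\<beta> * p)"
      by (auto simp: in_keys_iff lookup_minus)
    then show "standard n m \<mu>"
      using p(2) q(2) keys_single_mult[of ?a q] keys_single_mult[of ?b p] standard_det_power by blast
  qed
  then have pq: "?\<alpha> * q = ?\<beta> * p" by simp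
  \<comment> \<open>All monomials of \<open>?\<alpha> * q\<close> contain \<open>a_0^N\<close>, and
    the factor \<open>?\<beta>\<close> does not contribute to the exponent of
    \<open>a_0\<close>.\<close>
  have le: "N \<le> lookup \<mu> (0, GA)" if "\<mu> \<in> keys p" for \<mu>
  proof -
    have "lookup (?\<beta> * p) (?b + \<mu>) = lookup p \<mu>"
      using lookup_single_mult[of ?b 1 p \<mu>] by simp
    then have "?b + \<mu> \<in> keys (?\<alpha> * q)" using that by (simp add: pq in_keys_iff)
    then obtain \<nu> where "?b + \<mu> = ?a + \<nu>" using keys_single_mult[of ?a q] by blast
    from arg_cong[OF this, of "\<lambda>\<mu>. lookup \<mu> (0, GA)"]
    show ?thesis by (simp add: det_power_def lookup_add lookup_single when_def)
  qed
  \<comment> \<open>\<open>r\<close> is the quotient of \<open>p\<close> by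
    \<open>a_0^N\<close>.\<close>
  define r where "r = (\<Sum>\<mu>\<in>keys p. single (\<mu> - ?a) (lookup p \<mu>))"
  have "?a + (\<mu> - ?a) = \<mu>" if "\<mu> \<in> keys p" for \<mu>
    using le[OF that] by (intro poly_mapping_eqI) (auto simp: det_power_def lookup_add lookup_minus lookup_single when_def)
  then have "?\<alpha> * r = (\<Sum>\<mu>\<in>keys p. single \<mu> (lookup p \<mu>))"
    unfolding r_def sum_distrib_left mult_single by (intro sum.cong) simp_all
  then have ar: "?\<alpha> * r = p" by (simp only: poly_mapping_sum_single)
  have "gen_jet n (0, GA) ^ N * h = gen_jet n (0, GA) ^ N * ev (gen_jet n) r"
    using p(3) by (simp add: ar[symmetric] ev.hom_mult e mult.commute)
  moreover have "gen_jet n (0, GA) \<noteq> 0"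
    using lead_gen_jet_A[OF n, of 0] by (auto simp: lead_def)
  ultimately have "h = ev (gen_jet n) r" by simp
  moreover have "r \<in> ?C"
  proof -
    have "keys (\<mu> - ?a) \<subseteq> jvars m (gens n)" if "\<mu> \<in> keys p" for \<mu>
    proof
      fix v assume "v \<in> keys (\<mu> - ?a)"
      then have "v \<in> keys \<mu>" by (simp add: in_keys_iff lookup_minus)
      then show "v \<in> jvars m (gens n)" using p(1) that by (auto simp: mem_mpoly_alg)
    qed
    then show ?thesis unfolding r_def by (intro mpoly_closed_sum) (simp add: mem_mpoly_alg)
  qed
  ultimately show ?thesis by blast
qed

section \<open>The isomorphism\<close>

lemma (in comm_ring_hom) map_mat_adj_mat:
  assumes "A \<in> carrier_mat n n" shows "map_mat hom (adj_mat A) = adj_mat (map_mat hom A)"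
proof (rule eq_matI)
  fix i j assume "i < dim_row (adj_mat (map_mat hom A))" "j < dim_col (adj_mat (map_mat hom A))"
  then have ij: "i < n" "j < n" using assms by (auto simp: adj_mat_def)
  have "map_mat hom (mat_delete A j i) = mat_delete (map_mat hom A) j i"
    by (rule eq_matI) (use assms ij in \<open>auto simp: mat_delete_def\<close>)
  then show "map_mat hom (adj_mat A) $$ (i, j) = adj_mat (map_mat hom A) $$ (i, j)"
    using assms ij
    by (simp add: adj_mat_def cofactor_def hom_distribs hom_det[symmetric] del: hom_det)
qed (use assms in \<open>auto simp: adj_mat_def\<close>)

lemma hom_coord_SL_act:
  assumes "calg_hom \<phi>" and g: "g \<in> carrier_mat n n" and c: "v \<in> carrier_mat n n" "\<xi> \<in> carrier_mat n n"
    and x: "x \<in> V_coords n"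
  shows "\<phi> (coord (SL_act g (v, \<xi>)) x) = coord (SL_act (map_mat \<phi> g) (map_mat \<phi> v, map_mat \<phi> \<xi>)) x"
proof -
  interpret calg_hom \<phi> by fact
  note a = adj_mat(1)[OF g]
  have "map_mat \<phi> (g * v) = map_mat \<phi> g * map_mat \<phi> v" by (rule mat_hom_mult[OF g c(1)])
  moreover have "map_mat \<phi> (\<xi> * adj_mat g) = map_mat \<phi> \<xi> * adj_mat (map_mat \<phi> g)"
    by (simp add: mat_hom_mult[OF c(2) a] map_mat_adj_mat[OF g])
  moreover have "\<phi> (coord (SL_act g (v, \<xi>)) x) = coord (map_mat \<phi> (g * v), map_mat \<phi> (\<xi> * adj_mat g)) x"
    using x g c a by (auto simp: SL_act_def V_coords_def)
  ultimately show ?thesis by (simp add: SL_act_def)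
qed

text \<open>Stated for every determinant, because the generic matrix has determinant 1 only modulo
  \<open>GV_ideal\<close>.\<close>

lemma SL_act_covect_mult_vect:
  assumes g: "g \<in> carrier_mat n n" and c: "v \<in> carrier_mat n n" "\<xi> \<in> carrier_mat n n"
  shows "(\<xi> * adj_mat g) * (g * v) = det g \<cdot>\<^sub>m (\<xi> * v)"
proof -
  note a = adj_mat[OF g]
  have "(\<xi> * adj_mat g) * (g * v) = \<xi> * (adj_mat g * (g * v))"
    by (rule assoc_mult_mat[of _ n n _ n _ n]) (use c g a in auto)
  also have "adj_mat g * (g * v) = (adj_mat g * g) * v"
    by (rule assoc_mult_mat[of _ n n _ n _ n, symmetric]) (use c g a in auto)
  also have "\<dots> = det g \<cdot>\<^sub>m v" using c by (simp add: a(3) mult_smult_assoc_mat[of _ n n _ n])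
  finally show ?thesis using c by (simp add: mult_smult_distrib[of _ n n _ n])
qed

lemma ev_gen_poly_SL_act:
  assumes g: "g \<in> carrier_mat n n" "det g = 1" and w: "w \<in> mat_pairs n" and x: "x \<in> gens n"
  shows "ev (coord (SL_act g w)) (gen_poly n x) = ev (coord w) (gen_poly n x)"
proof -
  obtain v \<xi> where vx: "w = (v, \<xi>)" by (cases w)
  have c: "v \<in> carrier_mat n n" "\<xi> \<in> carrier_mat n n" using w by (auto simp: vx mat_pairs_def)
  note ag = adj_mat_unimodular[OF g]
  have c': "g * v \<in> carrier_mat n n" "\<xi> * adj_mat g \<in> carrier_mat n n" using c g ag by auto
  have one: "1 \<cdot>\<^sub>m (\<xi> * v) = \<xi> * v" by (rule eq_matI) auto
  show ?thesis
    using x ev_gen_poly[OF c] ev_gen_poly[OF c'] SL_act_covect_mult_vect[OF g(1) c] one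
      det_mult[OF g(1) c(1)] det_mult[OF c(2) ag(1)] g(2) ag(4)
    by (auto simp: vx SL_act_def gens_def)
qed

lemma carrier_O_Z_iff:
  "f \<in> carrier (O_Z n) \<longleftrightarrow> f \<in> polys (V_coords n) \<and>
    (\<forall>g \<in> SL n. \<forall>w \<in> mat_pairs n. ev (coord (SL_act g w)) f = (ev (coord w) f :: complex))"
  by (simp add: O_Z_def O_V_def mat_pairs_def aeval_complex_alg)

lemma gen_poly_O_Z: "g \<in> gens n \<Longrightarrow> gen_poly n g \<in> carrier (O_Z n)"
  unfolding carrier_O_Z_iff using gen_poly_closed ev_gen_poly_SL_act by (auto simp: SL_def)

lemma calg_hom_fps_nth_0: "calg_hom (\<lambda>F. fps_nth F 0)"
  by (rule calg_homI) (simp_all add: of_scalar_fps_def)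

text \<open>The first fundamental theorem from the case \<open>m = 0\<close>: setting
  \<open>t = 0\<close> sends arcs in the group to \<open>SL n\<close>, so the level 0 jet of an
  invariant is arc-invariant.\<close>

lemma O_Z_generated:
  assumes n: "n \<ge> 1" and f: "f \<in> carrier (O_Z n)"
  shows "\<exists>P \<in> polys (gens n). f = ev (gen_poly n) P"
proof -
  have fV: "f \<in> polys (V_coords n)" using f by (simp add: carrier_O_Z_iff)
  note h0 = calg_hom_fps_nth_0
  have "arc_inv n (jetc 0 f)"
    unfolding arc_inv_def
  proof (intro ballI impI)
    fix g :: "complex fps mat" and w :: "complex fps mat \<times> complex fps mat"
    assume g: "g \<in> carrier_mat n n" "det g = 1" and w: "w \<in> mat_pairs n"
    obtain v \<xi> where vx: "w = (v, \<xi>)" by (cases w)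
    have c: "v \<in> carrier_mat n n" "\<xi> \<in> carrier_mat n n" using w by (auto simp: vx mat_pairs_def)
    let ?m = "map_mat (\<lambda>F :: complex fps. fps_nth F 0)"
    interpret h: calg_hom "\<lambda>F :: complex fps. fps_nth F 0" by (rule h0)
    have "?m g \<in> SL n" using g by (simp add: SL_def h.hom_det)
    moreover have "(?m v, ?m \<xi>) \<in> mat_pairs n" using c by (simp add: mat_pairs_def)
    ultimately have inv: "ev (coord (SL_act (?m g) (?m v, ?m \<xi>))) f = ev (coord (?m v, ?m \<xi>)) f"
      using f by (simp add: carrier_O_Z_iff)
    have "arc_eval (SL_act g w) (jetc 0 f) = ev (\<lambda>x. fps_nth (coord (SL_act g w) x) 0) f"
      unfolding arc_eval_jetc by (rule hom_ev[OF h0])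
    also have "\<dots> = ev (coord (SL_act (?m g) (?m v, ?m \<xi>))) f"
      by (rule ev_cong[OF fV]) (use hom_coord_SL_act[OF h0 g(1) c] in \<open>simp add: vx\<close>)
    also have "\<dots> = ev (\<lambda>x. fps_nth (coord w x) 0) f"
      unfolding inv by (rule ev_cong[OF fV]) (use c in \<open>auto simp: vx V_coords_def\<close>)
    also have "\<dots> = arc_eval w (jetc 0 f)"
      unfolding arc_eval_jetc by (rule hom_ev[OF h0, symmetric])
    finally show "arc_eval (SL_act g w) (jetc 0 f) = arc_eval w (jetc 0 f)" .
  qed
  then obtain Q where Q: "Q \<in> polys (jvars 0 (gens n))" "jetc 0 f = ev (gen_jet n) Q"
    using arc_inv_imp_gen[OF n jetc_closed[OF fV, of 0 0]] by (auto simp: zero_enat_def[symmetric])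
  \<comment> \<open>Restriction to the constant arcs: \<open>\<tau>\<close> is a left inverse of
    \<open>jetc 0\<close> and turns the expression in level 0 jets back into one in the
    generators.\<close>
  define \<tau> :: "(nat \<times> V_coord) cpoly \<Rightarrow> V_coord cpoly" where "\<tau> = ev (\<lambda>(k, c). if k = 0 then pvar c else 0)"
  have \<tau>: "\<tau> (jetc 0 p) = p" for p
    unfolding \<tau>_def ev_jetc by (simp add: hom_ev[OF h0])
  have "f = ev (\<lambda>v. \<tau> (gen_jet n v)) Q"
    using arg_cong[OF Q(2), of \<tau>] unfolding \<tau> by (simp add: \<tau>_def ev_ev)
  also have "\<dots> = ev (\<lambda>v. gen_poly n (snd v)) Q"
    by (rule ev_cong[OF Q(1)]) (auto simp: gen_jet_def \<tau> zero_enat_def)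
  also have "\<dots> = ev (gen_poly n) (ev (\<lambda>v. pvar (snd v)) Q)"
    by (simp add: ev_ev)
  finally have "f = ev (gen_poly n) (ev (\<lambda>v. pvar (snd v)) Q)" .
  moreover have "ev (\<lambda>v. pvar (snd v)) Q \<in> polys (gens n)"
    by (rule ev_closed[OF _ Q(1)]) auto
  ultimately show ?thesis by blast
qed

lemma aeval_O_Z:
  assumes "P \<in> polys (gens n)"
  shows "aeval (O_Z n) (gen_poly n) P = ev (gen_poly n) P"
proof (rule cpoly_alg_hom_eq_ev[OF _ _ assms])
  have \<phi>: "gen_poly n \<in> gens n \<rightarrow> carrier (O_Z n)" using gen_poly_O_Z by auto
  have "(\<lambda>f. f) \<in> alg_hom (O_Z n) type_alg"
    by (auto simp: alg_hom_def O_Z_def O_V_def intro!: ring_hom_memI)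
  from alg_hom_comp[OF aeval_alg_hom[OF algebra_O_Z \<phi>] this]
  show "aeval (O_Z n) (gen_poly n) \<in> alg_hom (mpoly_alg (gens n)) type_alg" .
  show "g \<in> gens n \<Longrightarrow> aeval (O_Z n) (gen_poly n) (pvar g) = gen_poly n g" for g
    by (rule aeval_pvar[OF algebra_O_Z \<phi>])
qed

section \<open>Coordinates on the jets of \<open>V\<close> and injectivity of
  \<open>p_star\<close>\<close>

definition V_jets :: "enat \<Rightarrow> nat \<Rightarrow> (nat \<times> V_coord cpoly) cpoly set \<Rightarrow> (nat \<times> V_coord) cpoly" where
  "V_jets m n = jet_eval m (O_V n) (ev arc_var)"

lemma V_jets:
  shows V_jets_alg_hom: "V_jets m n \<in> alg_hom (jet_alg m (O_V n)) type_alg"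
    and V_jets_gen: "\<And>k f. enat k \<le> m \<Longrightarrow> f \<in> carrier (O_V n) \<Longrightarrow> V_jets m n (jet_gen m (O_V n) k f) = jetc k f"
proof -
  have "ev arc_var \<in> alg_hom (O_V n) type_alg"
    unfolding O_V_def by (rule calg_hom_restrict[OF ev.calg_hom_axioms])
  note J = jet_eval[OF algebra_O_V this, where m = m, folded V_jets_def]
  show "V_jets m n \<in> alg_hom (jet_alg m (O_V n)) type_alg" by (rule J(1))
  show "V_jets m n (jet_gen m (O_V n) k f) = jetc k f" if "enat k \<le> m" "f \<in> carrier (O_V n)" for k f
    using J(2)[OF that] by (simp add: jetc_def)
qed

text \<open>\<open>V\<close> is an affine space, so \<open>\<O>(V_m)\<close> is the polynomial ring
  in the jets of the coordinates; \<open>V_jets\<close> and \<open>jet_pres\<close> are the two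
  directions of this identification.\<close>

lemma V_jets_surj_inj:
  assumes U: "U \<in> carrier (jet_alg m (O_V n))"
  shows "V_jets m n U \<in> polys (jvars m (V_coords n))"
    and "U = jet_pres m (O_V n) pvar (V_jets m n U)"
proof -
  have \<phi>: "pvar \<in> V_coords n \<rightarrow> carrier (O_V n)" by (simp add: O_V_def)
  have id: "aeval (O_V n) pvar f = f" if "f \<in> polys (V_coords n)" for f
    using that unfolding O_V_def by (subst aeval_mpoly_alg) auto
  have inv: "V_jets m n (jet_pres m (O_V n) pvar Q) = Q" if Q: "Q \<in> polys (jvars m (V_coords n))" for Q
  proof -
    have "V_jets m n (jet_pres m (O_V n) pvar Q) = ev pvar Q"
    proof (rule cpoly_alg_hom_eq_ev[OF _ _ Q])
      show "(\<lambda>Q. V_jets m n (jet_pres m (O_V n) pvar Q)) \<in> alg_hom (mpoly_alg (jvars m (V_coords n))) type_alg"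
        by (rule alg_hom_comp[OF jet_pres_alg_hom[OF algebra_O_V \<phi>] V_jets_alg_hom])
      fix v assume v: "v \<in> jvars m (V_coords n)"
      obtain k c where kc: "v = (k, c)" by (cases v)
      have "jet_pres m (O_V n) pvar (jetc k (pvar c)) = jet_gen m (O_V n) k (pvar c)"
        using v jet_pres_jetc[OF algebra_O_V \<phi>, of "pvar c" k m] id[of "pvar c"] by (simp add: kc)
      then show "V_jets m n (jet_pres m (O_V n) pvar (pvar v)) = pvar v"
        using v V_jets_gen[of k m "pvar c" n] by (simp add: kc O_V_def)
    qed
    then show ?thesis by simp
  qed
  obtain Q where Q: "Q \<in> polys (jvars m (V_coords n))" "U = jet_pres m (O_V n) pvar Q"
    using jet_pres_surj[OF algebra_O_V \<phi> _ U] id by (fastforce simp: O_V_def)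
  then show "V_jets m n U \<in> polys (jvars m (V_coords n))"
    "U = jet_pres m (O_V n) pvar (V_jets m n U)" by (simp_all add: inv)
qed

lemma V_jets_p_star:
  assumes Q: "Q \<in> polys (jvars m (gens n))"
  shows "V_jets m n (p_star m n (jet_pres m (O_Z n) (gen_poly n) Q)) = ev (gen_jet n) Q"
proof (rule cpoly_alg_hom_eq_ev[OF _ _ Q])
  have \<phi>: "gen_poly n \<in> gens n \<rightarrow> carrier (O_Z n)" using gen_poly_O_Z by auto
  show "(\<lambda>Q. V_jets m n (p_star m n (jet_pres m (O_Z n) (gen_poly n) Q))) \<in> alg_hom (mpoly_alg (jvars m (gens n))) type_alg"
    by (rule alg_hom_comp[OF alg_hom_comp[OF jet_pres_alg_hom[OF algebra_O_Z \<phi>] p_star(1)] V_jets_alg_hom])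
  fix v assume v: "v \<in> jvars m (gens n)"
  obtain k g where kg: "v = (k, g)" by (cases v)
  have g: "g \<in> gens n" "enat k \<le> m" using v by (auto simp: kg)
  have "jet_pres m (O_Z n) (gen_poly n) (jetc k (pvar g)) = jet_gen m (O_Z n) k (gen_poly n g)"
    using g jet_pres_jetc[OF algebra_O_Z \<phi>, of "pvar g" k m] aeval_O_Z[of "pvar g" n] by simp
  then show "V_jets m n (p_star m n (jet_pres m (O_Z n) (gen_poly n) (pvar v))) = gen_jet n v"
    using g p_star(2)[OF g(2) gen_poly_O_Z[OF g(1)]] V_jets_gen[OF g(2), of "gen_poly n g" n] gen_poly_closed[OF g(1)]
    by (simp add: kg gen_jet_def O_V_def)
qed

lemma alg_hom_zero:
  assumes "h \<in> alg_hom A B" "C_algebra A" "C_algebra B" shows "h \<zero>\<^bsub>A\<^esub> = \<zero>\<^bsub>B\<^esub>"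
proof -
  interpret A: algebra C_field A by fact
  interpret B: algebra C_field B by fact
  interpret h: ring_hom_cring A B h
    by (rule ring_hom_cringI2) (use assms A.M_cring B.M_cring in \<open>auto simp: alg_hom_def\<close>)
  show ?thesis by simp
qed

lemma O_Z_jets_presentation:
  assumes n: "n \<ge> 1" and U: "U \<in> carrier (jet_alg m (O_Z n))"
  shows "\<exists>Q \<in> polys (jvars m (gens n)). U = jet_pres m (O_Z n) (gen_poly n) Q"
  by (rule jet_pres_surj[OF algebra_O_Z _ _ U])
     (use gen_poly_O_Z O_Z_generated[OF n] aeval_O_Z in auto)

text \<open>The jets of \<open>gen_rel\<close> vanish in the jet algebra of \<open>Z\<close>, so
  there \<open>Q\<close> has the same class as a standard \<open>q\<close>. The image of
  \<open>q\<close> in \<open>\<O>(V_m)\<close> is that of \<open>Q\<close>, hence zero, and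
  independence of the standard monomials gives \<open>q = 0\<close>.\<close>

lemma O_Z_jets_relations:
  assumes n: "n \<ge> 1" and Q: "Q \<in> polys (jvars m (gens n))" and 0: "ev (gen_jet n) Q = 0"
  shows "jet_pres m (O_Z n) (gen_poly n) Q = \<zero>\<^bsub>jet_alg m (O_Z n)\<^esub>"
proof -
  let ?C = "polys (jvars m (gens n))" and ?J = "jet_alg m (O_Z n)"
  let ?\<Psi> = "jet_pres m (O_Z n) (gen_poly n)"
  have \<phi>: "gen_poly n \<in> gens n \<rightarrow> carrier (O_Z n)" using gen_poly_O_Z by auto
  note \<Psi> = jet_pres_alg_hom[OF algebra_O_Z \<phi>, of m]
  interpret Z: algebra C_field "O_Z n" by (rule algebra_O_Z)
  interpret J: algebra C_field ?J by (rule algebra_jet[OF algebra_O_Z])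
  note add = ring_hom_add[OF alg_homD(1)[OF \<Psi>]] and mult = ring_hom_mult[OF alg_homD(1)[OF \<Psi>]]
    and cl = ring_hom_closed[OF alg_homD(1)[OF \<Psi>]]
  have z: "?\<Psi> 0 = \<zero>\<^bsub>?J\<^esub>"
    using alg_hom_zero[OF \<Psi> algebra_mpoly algebra_jet[OF algebra_O_Z]] by simp
  have relC: "gen_rel n \<in> polys (gens n)"
    unfolding gen_rel_def
    by (intro mpoly_closed_diff mpoly_closed(5) mpoly_closed_det[of _ n]) (auto simp: gens_def)
  have "\<exists>q \<in> ?C. (\<forall>\<mu> \<in> keys q. standard n m \<mu>) \<and> Q - q \<in> {p \<in> ?C. ?\<Psi> p = \<zero>\<^bsub>?J\<^esub>}"
  proof (rule standard_span[OF refl n _ _ _ _ Q])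
    show "jetc s (gen_rel n) \<in> {p \<in> ?C. ?\<Psi> p = \<zero>\<^bsub>?J\<^esub>}" if s: "enat s \<le> m" for s
    proof -
      have "aeval (O_Z n) (gen_poly n) (gen_rel n) = 0"
        by (simp add: aeval_O_Z[OF relC] ev_gen_poly_rel)
      also have "\<dots> = \<zero>\<^bsub>O_Z n\<^esub>" by (simp add: O_Z_def O_V_def)
      finally have "?\<Psi> (jetc s (gen_rel n)) = jet_gen m (O_Z n) s \<zero>\<^bsub>O_Z n\<^esub>"
        using jet_pres_jetc[OF algebra_O_Z \<phi> relC s] by simp
      also have "\<dots> = jet_gen m (O_Z n) s (0 \<odot>\<^bsub>O_Z n\<^esub> \<zero>\<^bsub>O_Z n\<^esub>)"
        using Z.smult_r_null[of 0] by simp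
      also have "\<dots> = \<zero>\<^bsub>?J\<^esub>"
        using jet_gen_props(4)[OF algebra_O_Z s Z.zero_closed, of 0] J.smult_l_null
          jet_gen_props(1)[OF algebra_O_Z s Z.zero_closed] by simp
      finally show ?thesis using jetc_closed[OF relC s] by simp
    qed
  qed (use z add mult cl in auto)
  then obtain q where q: "q \<in> ?C" "\<forall>\<mu> \<in> keys q. standard n m \<mu>" "?\<Psi> (Q - q) = \<zero>\<^bsub>?J\<^esub>" "Q - q \<in> ?C"
    by blast
  have "ev (gen_jet n) (Q - q) = V_jets m n (p_star m n \<zero>\<^bsub>?J\<^esub>)"
    using V_jets_p_star[OF q(4)] q(3) by simp
  also have "\<dots> = 0"
    using alg_hom_zero[OF alg_hom_comp[OF p_star(1) V_jets_alg_hom] algebra_jet[OF algebra_O_Z] algebra_type_alg] by simp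
  finally have "ev (gen_jet n) q = 0" using 0 by (simp add: ev.hom_minus)
  then have "q = 0" using standard_independent[OF n q(1)] q(2) by blast
  then show ?thesis using q(3) by simp
qed

lemma V_jets_p_star_inj:
  assumes n: "n \<ge> 1" and U: "U \<in> carrier (jet_alg m (O_Z n))" "W \<in> carrier (jet_alg m (O_Z n))"
    and eq: "V_jets m n (p_star m n U) = V_jets m n (p_star m n W)"
  shows "U = W"
proof -
  let ?C = "polys (jvars m (gens n))" and ?J = "jet_alg m (O_Z n)"
  let ?\<Psi> = "jet_pres m (O_Z n) (gen_poly n)"
  have \<phi>: "gen_poly n \<in> gens n \<rightarrow> carrier (O_Z n)" using gen_poly_O_Z by auto
  note \<Psi> = jet_pres_alg_hom[OF algebra_O_Z \<phi>, of m]
  interpret J: algebra C_field ?J by (rule algebra_jet[OF algebra_O_Z])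
  obtain P Q where PQ: "P \<in> ?C" "U = ?\<Psi> P" "Q \<in> ?C" "W = ?\<Psi> Q"
    using O_Z_jets_presentation[OF n U(1)] O_Z_jets_presentation[OF n U(2)] by blast
  have d: "P - Q \<in> ?C" using PQ by blast
  have "ev (gen_jet n) (P - Q) = 0"
    using eq V_jets_p_star[OF PQ(1)] V_jets_p_star[OF PQ(3)] by (simp add: PQ ev.hom_minus)
  then have "?\<Psi> (P - Q) = \<zero>\<^bsub>?J\<^esub>" by (rule O_Z_jets_relations[OF n d])
  moreover have "?\<Psi> P = ?\<Psi> (P - Q) \<oplus>\<^bsub>?J\<^esub> ?\<Psi> Q"
    using ring_hom_add[OF alg_homD(1)[OF \<Psi>] d PQ(3)] by simp
  ultimately show ?thesis using U PQ by simp
qed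

section \<open>From the comorphism of the action to invariance on arcs\<close>

lemma generic_mats:
  "generic_g n \<in> carrier_mat n n" "generic_w n \<in> mat_pairs n"
  by (simp_all add: generic_g_def generic_w_def mat_pairs_def)

lemma coord_SL_act_generic_closed:
  "c \<in> V_coords n \<Longrightarrow> coord (SL_act (generic_g n) (generic_w n)) c \<in> polys (GV_coords n)"
  "c \<in> V_coords n \<Longrightarrow> coord (generic_w n) c \<in> polys (GV_coords n)"
proof -
  note a = adj_mat(1)[OF generic_mats(1)[of n]]
  have c: "fst (generic_w n) \<in> carrier_mat n n" "snd (generic_w n) \<in> carrier_mat n n"
    using generic_mats(2)[of n] by (auto simp: mat_pairs_def)
  have "(generic_g n * fst (generic_w n)) $$ (i, j) \<in> polys (GV_coords n)"
    "(snd (generic_w n) * adj_mat (generic_g n)) $$ (i, j) \<in> polys (GV_coords n)"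
    if "i < n" "j < n" for i j
    using mpoly_closed_mat_mult[OF generic_mats(1) c(1) that] mpoly_closed_mat_mult[OF c(2) a that] generic_closed
    by auto
  then show "c \<in> V_coords n \<Longrightarrow> coord (SL_act (generic_g n) (generic_w n)) c \<in> polys (GV_coords n)"
    by (auto simp: V_coords_def SL_act_def)
  have "coord (fst (generic_w n), snd (generic_w n)) c \<in> polys (GV_coords n)" if "c \<in> V_coords n"
    using that generic_closed[of _ n] by (auto simp: V_coords_def simp del: prod.collapse)
  then show "c \<in> V_coords n \<Longrightarrow> coord (generic_w n) c \<in> polys (GV_coords n)"
    by simp
qed

lemma ev_generic_closed:
  assumes f: "f \<in> polys (V_coords n)"
  shows "ev (coord (SL_act (generic_g n) (generic_w n))) f \<in> polys (GV_coords n)"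
    and "ev (coord (generic_w n)) f \<in> polys (GV_coords n)"
  by (rule ev_closed[OF _ f], erule coord_SL_act_generic_closed)+

lemma star_eq_coset:
  assumes f: "f \<in> polys (V_coords n)"
  shows "act_star n f = GV_ideal n +>\<^bsub>mpoly_alg (GV_coords n)\<^esub> ev (coord (SL_act (generic_g n) (generic_w n))) f"
    and "proj_star n f = GV_ideal n +>\<^bsub>mpoly_alg (GV_coords n)\<^esub> ev (coord (generic_w n)) f"
  unfolding act_star_def proj_star_def
  by (rule arg_cong[where f = "(+>\<^bsub>mpoly_alg (GV_coords n)\<^esub>) (GV_ideal n)"],
      rule aeval_mpoly_alg[OF _ f], erule coord_SL_act_generic_closed)+

lemma GV_ideal_eq: "GV_ideal n = {x * (det (generic_g n) - 1) | x. x \<in> polys (GV_coords n)}"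
proof -
  interpret cring "mpoly_alg (GV_coords n)" by (rule cring_mpoly)
  have "det (generic_g n) \<in> polys (GV_coords n)"
    by (rule mpoly_closed_det[of _ n]) (auto intro: generic_closed generic_mats)
  then have "det (generic_g n) - 1 \<in> polys (GV_coords n)" by auto
  from cgenideal_eq_genideal[OF this] show ?thesis
    by (simp add: GV_ideal_def cgenideal_def)
qed

lemma act_star_eq_proj_star_gen:
  assumes x: "x \<in> gens n"
  shows "act_star n (gen_poly n x) = proj_star n (gen_poly n x)"
proof -
  let ?C = "polys (GV_coords n)"
  let ?g = "generic_g n" and ?w = "generic_w n"
  obtain v \<xi> where vx: "?w = (v, \<xi>)" by (cases ?w)
  note g = generic_mats(1)[of n]
  have c: "v \<in> carrier_mat n n" "\<xi> \<in> carrier_mat n n"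
    using generic_mats(2)[of n] by (auto simp: vx mat_pairs_def)
  note a = adj_mat[OF g]
  have c': "?g * v \<in> carrier_mat n n" "\<xi> * adj_mat ?g \<in> carrier_mat n n"
    using mult_carrier_mat[OF g c(1)] mult_carrier_mat[OF c(2) a(1)] .
  note p = gen_poly_closed[OF x]
  note cl = ev_generic_closed[OF p]
  have detC: "det M \<in> ?C" if "M \<in> carrier_mat n n" "\<And>i j. i < n \<Longrightarrow> j < n \<Longrightarrow> M $$ (i, j) \<in> ?C" for M
    using mpoly_closed_det that by blast
  have dC: "det ?g \<in> ?C" "det (adj_mat ?g) \<in> ?C" "det v \<in> ?C" "det \<xi> \<in> ?C"
    using detC[OF g generic_closed(1)] detC[OF a(1) generic_closed(4)] detC[OF c(1)] detC[OF c(2)]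
      generic_closed(2,3)[of _ n] by (auto simp: vx)
  have "\<exists>q \<in> ?C. ev (coord (SL_act ?g ?w)) (gen_poly n x) - ev (coord ?w) (gen_poly n x) = q * (det ?g - 1)"
  proof -
    consider i j where "i < n" "j < n" "x = GX i j" | "x = GA" | "x = GB" using x by (auto simp: gens_def)
    then show ?thesis
    proof cases
      case (1 i j)
      have "(\<xi> * v) $$ (i, j) \<in> ?C"
        using cl(2) 1 by (simp add: vx ev_gen_poly[OF c])
      moreover have "((\<xi> * adj_mat ?g) * (?g * v)) $$ (i, j) = det ?g * (\<xi> * v) $$ (i, j)"
        unfolding SL_act_covect_mult_vect[OF g c] using c 1 by simp
      ultimately show ?thesis
        using 1 ev_gen_poly(1)[OF c] ev_gen_poly(1)[OF c']
        by (intro bexI[of _ "(\<xi> * v) $$ (i, j)"]) (simp_all add: vx SL_act_def algebra_simps del: index_mult_mat(1))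
    next
      case 2
      then show ?thesis
        using dC ev_gen_poly(2)[OF c] ev_gen_poly(2)[OF c'] det_mult[OF g c(1)]
        by (intro bexI[of _ "det v"]) (simp_all add: vx SL_act_def algebra_simps)
    next
      case 3
      let ?d = "det ?g" and ?D = "det (adj_mat ?g)"
      \<comment> \<open>The generic determinant \<open>d\<close> is not invertible before passing to
        the quotient, so \<open>D - 1\<close> is exhibited as a multiple of \<open>d - 1\<close>
        without division: \<open>d^n - 1\<close> and \<open>(d - 1) D = d^n - D\<close> differ by
        \<open>D - 1\<close>.\<close>
      have "?d * ?D = ?d ^ n"
        using arg_cong[OF a(2), of det] det_mult[OF g a(1)] by (simp add: det_smult)
      moreover have "?d ^ n - 1 = (?d - 1) * (\<Sum>i<n. ?d ^ i)" by (rule power_diff_1_eq)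
      ultimately have D1: "?D - 1 = ((\<Sum>i<n. ?d ^ i) - ?D) * (?d - 1)"
        by (simp add: algebra_simps)
      have "det \<xi> * ?D - det \<xi> = det \<xi> * (?D - 1)" by (simp only: right_diff_distrib mult_1_right)
      then have e: "det \<xi> * ?D - det \<xi> = (det \<xi> * ((\<Sum>i<n. ?d ^ i) - ?D)) * (?d - 1)"
        by (simp only: D1 mult.assoc)
      have "?d ^ i \<in> ?C" for i by (induction i) (use dC in auto)
      then have "det \<xi> * ((\<Sum>i<n. ?d ^ i) - ?D) \<in> ?C"
        by (intro mpoly_closed(5) mpoly_closed_diff mpoly_closed_sum dC)
      then show ?thesis
        using 3 e ev_gen_poly(3)[OF c] ev_gen_poly(3)[OF c'] det_mult[OF c(2) a(1)]
        by (intro bexI[of _ "det \<xi> * ((\<Sum>i<n. ?d ^ i) - ?D)"]) (simp_all add: vx SL_act_def)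
    qed
  qed
  then have "ev (coord (SL_act ?g ?w)) (gen_poly n x) - ev (coord ?w) (gen_poly n x) \<in> GV_ideal n"
    unfolding GV_ideal_eq by blast
  moreover have "u \<ominus>\<^bsub>mpoly_alg (GV_coords n)\<^esub> w = u - w" if "w \<in> ?C" for u w
    using that by (simp add: a_minus_def)
  ultimately show ?thesis
    unfolding star_eq_coset[OF p]
    using coset_eqI[OF algebra_mpoly ideal_GV cl(1) cl(2)] cl by simp
qed

text \<open>Elements of \<open>O_Z\<close> are defined by invariance at complex points. The identity
  in \<open>O_GV\<close> is reached through the generators, where it is an explicit congruence
  modulo \<open>det g - 1\<close>; no reducedness of \<open>O_GV\<close> is required.\<close>

lemma act_star_eq_proj_star:
  assumes n: "n \<ge> 1" and f: "f \<in> carrier (O_Z n)" shows "act_star n f = proj_star n f"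
proof -
  obtain P where P: "P \<in> polys (gens n)" "f = ev (gen_poly n) P"
    using O_Z_generated[OF n f] by blast
  have e: "f = aeval (O_V n) (gen_poly n) P"
    unfolding P(2) O_V_def by (rule aeval_mpoly_alg[symmetric, OF gen_poly_closed P(1)])
  have \<phi>: "gen_poly n \<in> gens n \<rightarrow> carrier (O_V n)" using gen_poly_closed by (auto simp: O_V_def)
  note h = aeval_alg_hom[OF algebra_O_V \<phi>]
  let ?\<psi> = "\<lambda>x. proj_star n (gen_poly n x)"
  have \<psi>: "?\<psi> \<in> gens n \<rightarrow> carrier (O_GV n)"
    using ring_hom_closed[OF alg_homD(1)[OF star_hom(2)]] \<phi> by auto
  have v: "aeval (O_V n) (gen_poly n) (pvar x) = gen_poly n x" if "x \<in> gens n" for x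
    by (rule aeval_pvar[OF algebra_O_V \<phi> that])
  have "act_star n (aeval (O_V n) (gen_poly n) P) = aeval (O_GV n) ?\<psi> P"
    by (rule alg_hom_mpoly_unique[OF algebra_O_GV \<psi> alg_hom_comp[OF h star_hom(1)] _ P(1)])
       (simp add: v act_star_eq_proj_star_gen)
  also have "\<dots> = proj_star n (aeval (O_V n) (gen_poly n) P)"
    by (rule alg_hom_mpoly_unique[OF algebra_O_GV \<psi> alg_hom_comp[OF h star_hom(2)] _ P(1), symmetric])
       (simp add: v)
  finally show ?thesis using e by simp
qed

lemma p_star_invariant:
  assumes n: "n \<ge> 1" and U: "U \<in> carrier (jet_alg m (O_Z n))"
  shows "p_star m n U \<in> carrier (O_Vm_inv m n)"
proof -
  have "jet_map m (O_V n) (O_GV n) (act_star n) (p_star m n U) = jet_map m (O_V n) (O_GV n) (proj_star n) (p_star m n U)"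
  proof (rule jet_hom_eq[OF algebra_O_Z algebra_jet[OF algebra_O_GV] _ _ _ U])
    note J = jet_map[OF algebra_O_V algebra_O_GV]
    show "(\<lambda>U. jet_map m (O_V n) (O_GV n) (act_star n) (p_star m n U)) \<in> alg_hom (jet_alg m (O_Z n)) (jet_alg m (O_GV n))"
      by (rule alg_hom_comp[OF p_star(1) J(1)[OF star_hom(1)]])
    show "(\<lambda>U. jet_map m (O_V n) (O_GV n) (proj_star n) (p_star m n U)) \<in> alg_hom (jet_alg m (O_Z n)) (jet_alg m (O_GV n))"
      by (rule alg_hom_comp[OF p_star(1) J(1)[OF star_hom(2)]])
    fix k f assume k: "enat k \<le> m" and f: "f \<in> carrier (O_Z n)"
    then have "f \<in> carrier (O_V n)" by (simp add: carrier_O_Z_iff O_V_def)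
    then show "jet_map m (O_V n) (O_GV n) (act_star n) (p_star m n (jet_gen m (O_Z n) k f)) =
        jet_map m (O_V n) (O_GV n) (proj_star n) (p_star m n (jet_gen m (O_Z n) k f))"
      using k f by (simp add: p_star(2) J(2)[OF star_hom(1)] J(2)[OF star_hom(2)] act_star_eq_proj_star[OF n])
  qed
  moreover have "p_star m n U \<in> carrier (jet_alg m (O_V n))"
    using ring_hom_closed[OF alg_homD(1)[OF p_star(1)] U] .
  ultimately show ?thesis by (simp add: O_Vm_inv_def)
qed

definition GV_point :: "'a mat \<Rightarrow> 'a mat \<times> 'a mat \<Rightarrow> GV_coord \<Rightarrow> 'a" where
  "GV_point g w c = (case c of Grp i j \<Rightarrow> g $$ (i, j) | Rep x \<Rightarrow> coord w x)"

lemma map_mat_generic: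
  assumes "g \<in> carrier_mat n n" "w \<in> mat_pairs n"
  shows "map_mat (ev (GV_point g w)) (generic_g n) = g"
    "map_mat (ev (GV_point g w)) (fst (generic_w n)) = fst w"
    "map_mat (ev (GV_point g w)) (snd (generic_w n)) = snd w"
proof -
  obtain v \<xi> where vx: "w = (v, \<xi>)" by (cases w)
  show "map_mat (ev (GV_point g w)) (generic_g n) = g"
    "map_mat (ev (GV_point g w)) (fst (generic_w n)) = fst w"
    "map_mat (ev (GV_point g w)) (snd (generic_w n)) = snd w"
    using assms
    by (auto simp: vx generic_g_def generic_w_def GV_point_def mat_pairs_def intro!: eq_matI)
qed

text \<open>A pair of an arc \<open>g\<close> of determinant 1 and an arc \<open>w\<close> is a
  homomorphism \<open>L\<close> from \<open>O_GV\<close> to power series. The induced point of the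
  jets of \<open>O_GV\<close> evaluates the two pullbacks of \<open>F\<close> to the values at
  \<open>g w\<close> and at \<open>w\<close>.\<close>

lemma O_Vm_inv_arc_inv:
  assumes F: "F \<in> carrier (O_Vm_inv m n)" shows "arc_inv n (V_jets m n F)"
  unfolding arc_inv_def
proof (intro ballI impI)
  fix g :: "complex fps mat" and w :: "complex fps mat \<times> complex fps mat"
  assume g: "g \<in> carrier_mat n n" "det g = 1" and w: "w \<in> mat_pairs n"
  let ?e = "ev (GV_point g w)" and ?P = "mpoly_alg (GV_coords n)"
  note mm = map_mat_generic[OF g(1) w]
  have wd: "generic_w n = (fst (generic_w n), snd (generic_w n))" "w = (fst w, snd w)" by simp_all
  have c: "fst (generic_w n) \<in> carrier_mat n n" "snd (generic_w n) \<in> carrier_mat n n"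
    using generic_mats(2)[of n] by (auto simp: mat_pairs_def)
  have eh: "?e \<in> alg_hom ?P type_alg" by (rule calg_hom_restrict[OF ev.calg_hom_axioms])
  have "?e (det (generic_g n)) = 1"
    using ev.hom_det[of "GV_point g w" "generic_g n"] by (simp add: mm g)
  then have kill: "?e x = \<zero>\<^bsub>type_alg\<^esub>" if "x \<in> GV_ideal n" for x
    using that unfolding GV_ideal_eq by (auto simp: ev.hom_mult ev.hom_minus)
  define L where "L U = the_elem (?e ` U)" for U
  have L: "L \<in> alg_hom (O_GV n) type_alg"
    unfolding L_def O_GV_def by (rule lift_alg_hom[OF algebra_mpoly ideal_GV algebra_type_alg eh kill])
  have L_coset: "L (GV_ideal n +>\<^bsub>?P\<^esub> p) = ?e p" if "p \<in> carrier ?P" for p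
    unfolding L_def by (rule the_elem_coset[OF algebra_mpoly ideal_GV algebra_type_alg eh kill that])
  have act: "L (act_star n f) = ev (coord (SL_act g w)) f" if "f \<in> carrier (O_V n)" for f
  proof -
    have f: "f \<in> polys (V_coords n)" using that by (simp add: O_V_def)
    have "L (act_star n f) = ?e (ev (coord (SL_act (generic_g n) (generic_w n))) f)"
      unfolding star_eq_coset[OF f] by (rule L_coset[OF ev_generic_closed(1)[OF f]])
    also have "\<dots> = ev (\<lambda>c. ?e (coord (SL_act (generic_g n) (generic_w n)) c)) f"
      by (rule ev_ev)
    also have "\<dots> = ev (coord (SL_act g w)) f"
    proof (rule ev_cong[OF f])
      fix x assume x: "x \<in> V_coords n"
      show "?e (coord (SL_act (generic_g n) (generic_w n)) x) = coord (SL_act g w) x"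
        using hom_coord_SL_act[OF ev.calg_hom_axioms generic_mats(1) c x, of "GV_point g w"] by (simp add: mm)
    qed
    finally show ?thesis .
  qed
  have proj: "L (proj_star n f) = ev (coord w) f" if "f \<in> carrier (O_V n)" for f
  proof -
    have f: "f \<in> polys (V_coords n)" using that by (simp add: O_V_def)
    have "L (proj_star n f) = ?e (ev (coord (generic_w n)) f)"
      unfolding star_eq_coset[OF f] by (rule L_coset[OF ev_generic_closed(2)[OF f]])
    also have "\<dots> = ev (\<lambda>c. ?e (coord (generic_w n) c)) f" by (rule ev_ev)
    also have "\<dots> = ev (coord w) f"
      by (rule ev_cong[OF f]) (auto simp: V_coords_def generic_w_def GV_point_def)
    finally show ?thesis .
  qed
  note J = jet_map[OF algebra_O_V algebra_O_GV] and E = jet_eval[OF algebra_O_GV L]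
  let ?\<rho> = "jet_eval m (O_GV n) L"
  have FV: "F \<in> carrier (jet_alg m (O_V n))"
    and Feq: "jet_map m (O_V n) (O_GV n) (act_star n) F = jet_map m (O_V n) (O_GV n) (proj_star n) F"
    using F by (simp_all add: O_Vm_inv_def)
  have ah: "(\<lambda>F. arc_eval w (V_jets m n F)) \<in> alg_hom (jet_alg m (O_V n)) type_alg" for w :: "complex fps mat \<times> complex fps mat"
    using alg_hom_comp[OF V_jets_alg_hom] arc_eval.calg_hom_axioms alg_hom_type_alg_iff by blast
  have cl: "act_star n f \<in> carrier (O_GV n)" "proj_star n f \<in> carrier (O_GV n)" if "f \<in> carrier (O_V n)" for f
    using ring_hom_closed[OF alg_homD(1)[OF star_hom(1)] that] ring_hom_closed[OF alg_homD(1)[OF star_hom(2)] that] .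
  have "arc_eval (SL_act g w) (V_jets m n F) = ?\<rho> (jet_map m (O_V n) (O_GV n) (act_star n) F)"
    by (rule jet_hom_eq[OF algebra_O_V algebra_type_alg ah alg_hom_comp[OF J(1)[OF star_hom(1)] E(1)] _ FV])
       (simp add: V_jets_gen J(2)[OF star_hom(1)] E(2) cl act arc_eval_jetc)
  also have "\<dots> = ?\<rho> (jet_map m (O_V n) (O_GV n) (proj_star n) F)" by (simp only: Feq)
  also have "\<dots> = arc_eval w (V_jets m n F)"
    by (rule jet_hom_eq[OF algebra_O_V algebra_type_alg alg_hom_comp[OF J(1)[OF star_hom(2)] E(1)] ah _ FV])
       (simp add: V_jets_gen J(2)[OF star_hom(2)] E(2) cl proj arc_eval_jetc)
  finally show "arc_eval (SL_act g w) (V_jets m n F) = arc_eval w (V_jets m n F)" .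
qed

lemma p_star_alg_iso:
  assumes n: "n \<ge> 1"
  shows "p_star m n \<in> alg_iso (jet_alg m (O_Z n)) (O_Vm_inv m n)"
proof -
  have hom: "p_star m n \<in> alg_hom (jet_alg m (O_Z n)) (O_Vm_inv m n)"
    using p_star(1)[of m n] p_star_invariant[OF n]
    by (auto simp: alg_hom_def ring_hom_def O_Vm_inv_def)
  moreover have "bij_betw (p_star m n) (carrier (jet_alg m (O_Z n))) (carrier (O_Vm_inv m n))"
  proof (rule bij_betw_imageI)
    show "inj_on (p_star m n) (carrier (jet_alg m (O_Z n)))"
      using V_jets_p_star_inj[OF n] by (intro inj_onI) metis
    have "F \<in> p_star m n ` carrier (jet_alg m (O_Z n))" if F: "F \<in> carrier (O_Vm_inv m n)" for F
    proof -
      have FV: "F \<in> carrier (jet_alg m (O_V n))" using F by (simp add: O_Vm_inv_def)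
      obtain Q where Q: "Q \<in> polys (jvars m (gens n))" "V_jets m n F = ev (gen_jet n) Q"
        using arc_inv_imp_gen[OF n V_jets_surj_inj(1)[OF FV] O_Vm_inv_arc_inv[OF F]] by blast
      let ?U = "jet_pres m (O_Z n) (gen_poly n) Q"
      have \<phi>: "gen_poly n \<in> gens n \<rightarrow> carrier (O_Z n)" using gen_poly_O_Z by auto
      have U: "?U \<in> carrier (jet_alg m (O_Z n))"
        using ring_hom_closed[OF alg_homD(1)[OF jet_pres_alg_hom[OF algebra_O_Z \<phi>]] Q(1)] .
      have "p_star m n ?U \<in> carrier (jet_alg m (O_V n))"
        using p_star_invariant[OF n U] by (simp add: O_Vm_inv_def)
      then have "p_star m n ?U = F"
        using V_jets_surj_inj(2)[OF FV] V_jets_surj_inj(2)[of "p_star m n ?U" m n] V_jets_p_star[OF Q(1)] Q(2) by simp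
      then show ?thesis using U by blast
    qed
    then show "p_star m n ` carrier (jet_alg m (O_Z n)) = carrier (O_Vm_inv m n)"
      using p_star_invariant[OF n] by blast
  qed
  ultimately show ?thesis by (simp add: alg_iso_def)
qed

section \<open>Polynomial algebras are integrally closed\<close>

lemma var_prime_pos [simp]: "0 < var_prime v"
  by (rule prime_gt_0_nat[OF prime_var_prime])

text \<open>The sign makes the lightest monomial the one with the largest number, so that cancelling
  leading monomials descends in \<open>mono_num\<close>.\<close>

definition num_weight :: "'v :: countable \<Rightarrow> real" where
  "num_weight v = - ln (real (var_prime v))"

lemma wt_num_weight: "wt num_weight \<mu> = - ln (real (mono_num \<mu>))"
proof -
  have pos: "0 < real (var_prime v)" for v :: 'a
    using prime_gt_0_nat[OF prime_var_prime[of v]] by simp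
  have "ln (real (mono_num \<mu>)) = (\<Sum>v\<in>keys \<mu>. ln (real (var_prime v) ^ lookup \<mu> v))"
    unfolding mono_num_def of_nat_prod of_nat_power
    by (rule ln_prod) (use pos in auto)
  then show ?thesis
    using pos by (simp add: wt_def num_weight_def ln_realpow sum_negf)
qed

lemma mono_num_pos: "0 < mono_num \<mu>"
  unfolding mono_num_def by (intro prod_pos) simp

lemma wt_num_weight_less_iff: "wt num_weight \<mu> < wt num_weight \<nu> \<longleftrightarrow> mono_num \<nu> < mono_num \<mu>"
  using mono_num_pos[of \<mu>] mono_num_pos[of \<nu>] by (simp add: wt_num_weight)

lemma lead_exists:
  fixes p :: "'v :: countable cpoly"
  assumes "p \<noteq> 0" shows "\<exists>\<mu>. lead num_weight p \<mu>"
proof -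
  have "finite (keys p)" "keys p \<noteq> {}" using assms by auto
  then obtain \<mu> where "is_arg_min (wt num_weight) (\<lambda>\<nu>. \<nu> \<in> keys p) \<mu>"
    using ex_is_arg_min_if_finite by blast
  then have \<mu>: "\<mu> \<in> keys p" "\<And>\<nu>. \<nu> \<in> keys p \<Longrightarrow> wt num_weight \<mu> \<le> wt num_weight \<nu>"
    by (auto simp: is_arg_min_linorder)
  have "wt num_weight \<mu> < wt num_weight \<nu>" if "\<nu> \<in> keys p" "\<nu> \<noteq> \<mu>" for \<nu>
    using \<mu>(2)[OF that(1)] that(2) wt_num_weight_less_iff[of \<mu> \<nu>] wt_num_weight_less_iff[of \<nu> \<mu>]
      inj_mono_num[of \<mu> \<nu>] by (cases "mono_num \<nu> < mono_num \<mu>"; cases "mono_num \<mu> < mono_num \<nu>") auto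
  then show ?thesis using \<mu>(1) by (auto simp: lead_def in_keys_iff)
qed

lemma lead_unique:
  assumes "lead w p \<mu>" "lead w p \<nu>" shows "\<mu> = \<nu>"
proof (rule ccontr)
  assume "\<mu> \<noteq> \<nu>"
  then have "wt w \<mu> < wt w \<nu>" and "wt w \<nu> < wt w \<mu>"
    using assms by (auto simp: lead_def in_keys_iff)
  then show False by simp
qed

lemma lead_nonzero: "lead w p \<mu> \<Longrightarrow> p \<noteq> 0"
  by (auto simp: lead_def)

text \<open>
  Comparing leading exponents in \<open>h^k dvd c * f^k\<close> for large \<open>k\<close> shows that the leading monomial of
  \<open>h\<close> divides that of \<open>f\<close>; subtracting a multiple of \<open>h\<close> from \<open>f\<close> preserves the hypothesis.
\<close>

lemma almost_integral_dvd:
  fixes f h c :: "'v :: {countable, linorder} cpoly"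
  assumes c: "c \<noteq> 0" and h: "h \<noteq> 0" "h \<in> polys I"
    and f: "f \<in> polys I" and dvd: "\<And>k. h ^ k dvd c * f ^ k"
  shows "\<exists>x \<in> polys I. f = h * x"
proof -
  obtain \<kappa> \<eta> where \<kappa>: "lead num_weight c \<kappa>" and \<eta>: "lead num_weight h \<eta>"
    using lead_exists c h by blast
  have main: "\<exists>x \<in> polys I. f = h * x"
    if "lead num_weight f \<phi>" "f \<in> polys I" "\<And>k. h ^ k dvd c * f ^ k" for f \<phi>
    using that
  proof (induction "mono_num \<phi>" arbitrary: f \<phi> rule: less_induct)
    case less
    note \<phi> = less.prems(1)
    have "lookup \<eta> v \<le> lookup \<phi> v" for v
    proof (rule ccontr)
      assume "\<not> ?thesis"
      then have l: "Suc (lookup \<phi> v) \<le> lookup \<eta> v" by simp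
      \<comment> \<open>If the exponent of \<open>v\<close> in \<open>\<eta>\<close> exceeded that
        in \<open>\<phi>\<close>, comparing exponents in \<open>c * f ^ k = h ^ k * r\<close> would
        give \<open>k \<le> lookup \<kappa> v\<close>; this \<open>k\<close> is the first to
        contradict it.\<close>
      define k where "k = Suc (lookup \<kappa> v)"
      obtain r where r: "c * f ^ k = h ^ k * r" using less.prems(3)[of k] by (auto simp: dvd_def)
      have cf: "lead num_weight (c * f ^ k) (\<kappa> + (\<Sum>i<k. \<phi>))" by (rule lead_mult[OF \<kappa> lead_power[OF \<phi>]])
      then have "r \<noteq> 0" using r lead_nonzero by fastforce
      then obtain \<rho> where \<rho>: "lead num_weight r \<rho>" using lead_exists by blast
      have "lead num_weight (h ^ k * r) ((\<Sum>i<k. \<eta>) + \<rho>)" by (rule lead_mult[OF lead_power[OF \<eta>] \<rho>])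
      then have "\<kappa> + (\<Sum>i<k. \<phi>) = (\<Sum>i<k. \<eta>) + \<rho>" using lead_unique cf r by metis
      from arg_cong[OF this, of "\<lambda>\<mu>. lookup \<mu> v"]
      have "lookup \<kappa> v + k * lookup \<phi> v = k * lookup \<eta> v + lookup \<rho> v"
        by (simp add: lookup_add lookup_sum)
      moreover have "k * Suc (lookup \<phi> v) \<le> k * lookup \<eta> v"
        using l by (rule mult_le_mono2)
      ultimately show False by (simp add: k_def)
    qed
    then have \<delta>: "\<phi> = \<eta> + (\<phi> - \<eta>)"
      by (intro poly_mapping_eqI) (simp add: lookup_add lookup_minus)
    define t :: "'v cpoly" where
      "t = single (\<phi> - \<eta>) (lookup f \<phi> / lookup h \<eta>)"
    have nz: "lookup h \<eta> \<noteq> 0" "lookup f \<phi> \<noteq> 0" using \<eta> \<phi> by (auto simp: lead_def)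
    have t: "t \<in> polys I"
    proof -
      have "keys (\<phi> - \<eta>) \<subseteq> keys \<phi>" by (auto simp: in_keys_iff lookup_minus)
      moreover have "keys \<phi> \<subseteq> I"
        using less.prems(2) nz by (simp add: mem_mpoly_alg in_keys_iff)
      ultimately show ?thesis by (auto simp: t_def mem_mpoly_alg)
    qed
    have ht: "lead num_weight (h * t) \<phi>"
      using lead_mult[OF \<eta> lead_single[of "lookup f \<phi> / lookup h \<eta>" num_weight "\<phi> - \<eta>"]] nz \<delta>
      by (simp add: t_def)
    have lht: "lookup (h * t) \<phi> = lookup f \<phi>"
      using lookup_single_mult[of "\<phi> - \<eta>" "lookup f \<phi> / lookup h \<eta>" h \<eta>] nz \<delta>
      by (simp add: t_def mult.commute add.commute)
    define f' where "f' = f - h * t"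
    have f': "f' \<in> polys I" unfolding f'_def by (intro mpoly_closed_diff mpoly_closed(5) less.prems(2) h t)
    show ?case
    proof (cases "f' = 0")
      case True
      then show ?thesis using t by (auto simp: f'_def)
    next
      case False
      then obtain \<psi> where \<psi>: "lead num_weight f' \<psi>" using lead_exists by blast
      have "\<psi> \<noteq> \<phi>" using \<psi> lht by (auto simp: lead_def f'_def lookup_minus)
      moreover have "\<psi> \<in> keys f \<or> \<psi> \<in> keys (h * t)"
        using \<psi> by (auto simp: lead_def f'_def lookup_minus in_keys_iff)
      ultimately have "wt num_weight \<phi> < wt num_weight \<psi>"
        using \<phi> ht by (auto simp: lead_def)
      then have "mono_num \<psi> < mono_num \<phi>" by (simp add: wt_num_weight_less_iff)
      \<comment> \<open>In the binomial expansion the factor \<open>c * f ^ j\<close> contributes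
        \<open>h ^ j\<close> by hypothesis, and the power of \<open>h * t\<close> contributes the
        missing \<open>h ^ (k - j)\<close>.\<close>
      moreover have "h ^ k dvd c * f' ^ k" for k
      proof -
        have "c * f' ^ k = c * (f + h * (- t)) ^ k" by (simp add: f'_def)
        also have "\<dots> = (\<Sum>j\<le>k. (c * f ^ j) * (h ^ (k - j)) * (of_nat (k choose j) * (- t) ^ (k - j)))"
          unfolding binomial_ring sum_distrib_left power_mult_distrib by (intro sum.cong) (simp_all only: mult_ac)
        finally have e: "c * f' ^ k = (\<Sum>j\<le>k. (c * f ^ j) * (h ^ (k - j)) * (of_nat (k choose j) * (- t) ^ (k - j)))" .
        show ?thesis
          unfolding e
        proof (rule dvd_sum)
          fix j assume "j \<in> {..k}"
          then have "h ^ k = h ^ j * h ^ (k - j)" by (simp add: power_add[symmetric])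
          then have "h ^ k dvd (c * f ^ j) * (h ^ (k - j))"
            using mult_dvd_mono[OF less.prems(3)[of j] dvd_refl[of "h ^ (k - j)"]] by simp
          then show "h ^ k dvd (c * f ^ j) * (h ^ (k - j)) * (of_nat (k choose j) * (- t) ^ (k - j))"
            by (rule dvd_mult2)
        qed
      qed
      ultimately obtain x where "x \<in> polys I" "f' = h * x"
        using less.hyps[OF _ \<psi> f'] by blast
      then show ?thesis using t by (intro bexI[of _ "x + t"]) (auto simp: f'_def algebra_simps)
    qed
  qed
  show ?thesis
  proof (cases "f = 0")
    case True
    then show ?thesis by (intro bexI[of _ 0]) auto
  next
    case False
    then show ?thesis using lead_exists main f dvd by blast
  qed
qed


section \<open>Normality by embedding into a field\<close>

text \<open>A condition on a subset of one ambient field, which allows a ring and all its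
  localizations to be compared there without quotient constructions.\<close>

definition integrally_closed_in_fractions :: "'f :: field set \<Rightarrow> bool" where
  "integrally_closed_in_fractions R \<longleftrightarrow> (\<forall>a \<in> R. \<forall>b \<in> R. \<forall>(d :: nat) c. b \<noteq> 0 \<longrightarrow> (\<forall>i < d. c i \<in> R) \<longrightarrow>
     (a / b) ^ d + (\<Sum>i<d. c i * (a / b) ^ i) = 0 \<longrightarrow> a / b \<in> R)"

text \<open>Let \<open>q\<close> be the product of the denominators of the coefficients in the
  equation of \<open>x = y / z\<close>. Then \<open>q * x\<close> is integral over \<open>R\<close>
  with coefficients \<open>c i * q ^ (d - i)\<close>, hence in \<open>R\<close>, and
  \<open>q\<close> lies in \<open>T\<close>.\<close>

lemma integrally_closed_fractions:
  fixes R T :: "'f :: field set"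
  assumes R: "\<And>a b. a \<in> R \<Longrightarrow> b \<in> R \<Longrightarrow> a * b \<in> R" and T: "T \<subseteq> R" "1 \<in> T" "0 \<notin> T"
    "\<And>s t. s \<in> T \<Longrightarrow> t \<in> T \<Longrightarrow> s * t \<in> T" and int: "integrally_closed_in_fractions R"
  shows "integrally_closed_in_fractions {a / s | a s. a \<in> R \<and> s \<in> T}" (is "integrally_closed_in_fractions ?Q")
  unfolding integrally_closed_in_fractions_def
proof (intro ballI allI impI)
  fix y z :: 'f and d :: nat and c :: "nat \<Rightarrow> 'f"
  assume "y \<in> ?Q" "z \<in> ?Q" and z0: "z \<noteq> 0" and c: "\<forall>i<d. c i \<in> ?Q"
    and eq: "(y / z) ^ d + (\<Sum>i<d. c i * (y / z) ^ i) = 0"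
  then obtain a s b t where yz: "y = a / s" "a \<in> R" "s \<in> T" "z = b / t" "b \<in> R" "t \<in> T" by blast
  have "\<forall>i. \<exists>e r. i < d \<longrightarrow> c i = e / r \<and> e \<in> R \<and> r \<in> T" using c by blast
  then obtain e r where er: "\<And>i. i < d \<Longrightarrow> c i = e i / r i \<and> e i \<in> R \<and> r i \<in> T" by metis
  have prodT: "(\<And>i. i \<in> A \<Longrightarrow> r i \<in> T) \<Longrightarrow> prod r A \<in> T" for A
    by (induction A rule: infinite_finite_induct) (auto intro: T)
  define q where "q = prod r {..<d}"
  have q: "q \<in> T" unfolding q_def by (rule prodT) (use er in auto)
  have powR: "q ^ k \<in> R" for k
    by (induction k) (use q T R in auto)
  have q0: "q \<noteq> 0" using q T by blast
  define x where "x = y / z"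
  let ?c = "\<lambda>i. c i * q ^ (d - i)"
  \<comment> \<open>As \<open>i < d\<close>, at least one factor \<open>q\<close> is present, and it
    absorbs the denominator \<open>r i\<close>.\<close>
  have cR: "?c i \<in> R" if i: "i < d" for i
  proof -
    have "q = r i * prod r ({..<d} - {i})" unfolding q_def using i by (subst prod.remove[of _ i]) auto
    moreover have "r i \<in> T" using er[OF i] by simp
    then have "r i \<noteq> 0" using T(3) by metis
    moreover have "q ^ (d - i) = q * q ^ (d - Suc i)" using i by (simp add: Suc_diff_Suc flip: power_Suc)
    ultimately have "?c i = e i * prod r ({..<d} - {i}) * q ^ (d - Suc i)" using er[OF i] by (simp add: field_simps)
    moreover have "prod r ({..<d} - {i}) \<in> R" using prodT[of "{..<d} - {i}"] er T by auto
    ultimately show ?thesis using er[OF i] powR R by simp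
  qed
  have qx: "q * x = (q * a * t) / (b * s)" using yz by (simp add: x_def field_simps)
  have "(q * x) ^ d + (\<Sum>i<d. ?c i * (q * x) ^ i) = q ^ d * (x ^ d + (\<Sum>i<d. c i * x ^ i))"
  proof -
    have "?c i * (q * x) ^ i = q ^ d * (c i * x ^ i)" if "i < d" for i
    proof -
      have "q ^ d = q ^ (d - i) * q ^ i" using that by (simp add: power_add[symmetric])
      then show ?thesis by (simp add: power_mult_distrib)
    qed
    then have "(\<Sum>i<d. ?c i * (q * x) ^ i) = (\<Sum>i<d. q ^ d * (c i * x ^ i))"
      by (intro sum.cong) auto
    then show ?thesis by (simp only: distrib_left sum_distrib_left power_mult_distrib)
  qed
  then have 0: "(q * x) ^ d + (\<Sum>i<d. ?c i * (q * x) ^ i) = 0" using eq by (simp add: x_def)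
  have "q * a * t \<in> R" "b * s \<in> R" "b * s \<noteq> 0" using q T R yz z0 by (auto simp: subset_iff)
  note int[unfolded integrally_closed_in_fractions_def, rule_format, OF this, of d ?c]
  from this[OF cR 0[unfolded qx]] have "q * x \<in> R" unfolding qx .
  then have "q * x / q \<in> ?Q" using q by blast
  then show "y / z \<in> ?Q" using q0 by (simp add: x_def)
qed

section \<open>Localizations as sets of fractions in a field\<close>

lemma field_ring_simps [simp]:
  "carrier (ring_of_type_algebra :: 'f :: field ring) = UNIV" "a \<otimes>\<^bsub>ring_of_type_algebra\<^esub> b = (a * b :: 'f)"
  "\<one>\<^bsub>ring_of_type_algebra\<^esub> = (1 :: 'f)" "\<zero>\<^bsub>ring_of_type_algebra\<^esub> = (0 :: 'f)" "a \<oplus>\<^bsub>ring_of_type_algebra\<^esub> b = (a + b :: 'f)"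
  by (simp_all add: ring_of_type_algebra_def)

lemma finsum_field_ring [simp]:
  "(\<Oplus>\<^bsub>ring_of_type_algebra\<^esub>i\<in>S. f i :: 'f :: field) = (\<Sum>i\<in>S. f i)"
proof (induction S rule: infinite_finite_induct)
  case (insert x F)
  interpret cring "ring_of_type_algebra :: 'f ring" by (rule cring_from_type_algebra)
  show ?case using insert by simp
qed (simp_all add: finsum_def finprod_def)

lemma pow_field_ring [simp]: "x [^]\<^bsub>ring_of_type_algebra\<^esub> (k :: nat) = (x ^ k :: 'f :: field)"
proof -
  interpret cring "ring_of_type_algebra :: 'f ring" by (rule cring_from_type_algebra)
  show ?thesis by (induction k) (simp_all add: mult.commute)
qed

context
  fixes A :: "('a, 'm) ring_scheme" (structure) and S :: "'a set" and j :: "'a \<Rightarrow> 'f :: field"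
  assumes A: "cring A" and S: "S \<subseteq> carrier A" "\<one> \<in> S" "\<forall>s \<in> S. \<forall>t \<in> S. s \<otimes> t \<in> S"
    and j: "j \<in> ring_hom A ring_of_type_algebra" and inj: "inj_on j (carrier A)"
    and nonzero: "\<forall>s \<in> S. j s \<noteq> 0"
begin

interpretation cring A by (rule A)

lemmas mult_set = S(1,2) S(3)[rule_format] and nz = nonzero[rule_format]

definition loc_embed :: "('a \<times> 'a) set \<Rightarrow> 'f" where
  "loc_embed U = the_elem ((\<lambda>(a, s). j a / j s) ` U)"

lemma embed_simps:
  "a \<in> carrier A \<Longrightarrow> b \<in> carrier A \<Longrightarrow> j (a \<oplus> b) = j a + j b"
  "a \<in> carrier A \<Longrightarrow> b \<in> carrier A \<Longrightarrow> j (a \<otimes> b) = j a * j b" "j \<one> = 1"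
  using ring_hom_add[OF j] ring_hom_mult[OF j] ring_hom_one[OF j] by simp_all

lemma loc_embed_frac:
  assumes "a \<in> carrier A" "s \<in> S" shows "loc_embed (loc_frac A S a s) = j a / j s"
proof -
  have eq: "j b / j t = j a / j s" if "(b, t) \<in> loc_frac A S a s" for b t
  proof -
    obtain u where u: "b \<in> carrier A" "t \<in> S" "u \<in> S" "u \<otimes> (a \<otimes> t) = u \<otimes> (b \<otimes> s)"
      using \<open>(b, t) \<in> loc_frac A S a s\<close> by (auto simp: loc_frac_def loc_rel_def)
    have "j (u \<otimes> (a \<otimes> t)) = j (u \<otimes> (b \<otimes> s))" by (simp only: u(4))
    then have "j u * (j a * j t) = j u * (j b * j s)"
      using u(1-3) S(1) assms by (simp add: embed_simps subset_iff)
    then show ?thesis using nz u assms by (simp add: field_simps)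
  qed
  have mem: "(a, s) \<in> loc_frac A S a s"
    using equiv_class_self[OF equiv_loc_rel[OF A mult_set]] assms by (simp add: loc_frac_def)
  have "(\<lambda>(a, s). j a / j s) ` loc_frac A S a s = {j a / j s}"
  proof (intro equalityI subsetI)
    fix y assume "y \<in> (\<lambda>(a, s). j a / j s) ` loc_frac A S a s"
    then obtain b t where bt: "(b, t) \<in> loc_frac A S a s" "y = j b / j t" by auto
    then show "y \<in> {j a / j s}" using eq[OF bt(1)] by simp
  next
    fix y assume "y \<in> {j a / j s}"
    then show "y \<in> (\<lambda>(a, s). j a / j s) ` loc_frac A S a s"
      using imageI[OF mem, of "\<lambda>(a, s). j a / j s"] by simp
  qed
  then show ?thesis by (simp add: loc_embed_def)
qed

lemma loc_cases:
  assumes "x \<in> carrier (localization A S)"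
  obtains a s where "a \<in> carrier A" "s \<in> S" "x = loc_frac A S a s"
  using assms localization_elem[OF A mult_set, of x] by auto

lemma loc_frac_carrier: "a \<in> carrier A \<Longrightarrow> s \<in> S \<Longrightarrow> loc_frac A S a s \<in> carrier (localization A S)"
  using localization_elem[OF A mult_set] by auto

lemma loc_embed_hom: "loc_embed \<in> ring_hom (localization A S) ring_of_type_algebra"
proof (rule ring_hom_memI)
  fix x y assume x: "x \<in> carrier (localization A S)" and y: "y \<in> carrier (localization A S)"
  obtain a s where xs: "a \<in> carrier A" "s \<in> S" "x = loc_frac A S a s" using loc_cases[OF x] .
  obtain b t where yt: "b \<in> carrier A" "t \<in> S" "y = loc_frac A S b t" using loc_cases[OF y] .
  note xy = xs yt
  have C: "s \<in> carrier A" "t \<in> carrier A" using xy S by auto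
  show "loc_embed (x \<otimes>\<^bsub>localization A S\<^esub> y) = loc_embed x \<otimes>\<^bsub>ring_of_type_algebra\<^esub> loc_embed y"
    using xy C mult_set(3) by (simp add: loc_frac_simps[OF A mult_set] loc_embed_frac embed_simps)
  show "loc_embed (x \<oplus>\<^bsub>localization A S\<^esub> y) = loc_embed x \<oplus>\<^bsub>ring_of_type_algebra\<^esub> loc_embed y"
    using xy C mult_set(3) nz by (simp add: loc_frac_simps[OF A mult_set] loc_embed_frac embed_simps field_simps)
next
  show "loc_embed \<one>\<^bsub>localization A S\<^esub> = \<one>\<^bsub>ring_of_type_algebra\<^esub>"
    using S by (simp add: localization_def loc_embed_frac embed_simps)
qed simp

lemma loc_embed_inj: "inj_on loc_embed (carrier (localization A S))"
proof (rule inj_onI)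
  fix x y assume x: "x \<in> carrier (localization A S)" and y: "y \<in> carrier (localization A S)" and eq: "loc_embed x = loc_embed y"
  obtain a s where xs: "a \<in> carrier A" "s \<in> S" "x = loc_frac A S a s" using loc_cases[OF x] .
  obtain b t where yt: "b \<in> carrier A" "t \<in> S" "y = loc_frac A S b t" using loc_cases[OF y] .
  note xy = xs yt
  have C: "s \<in> carrier A" "t \<in> carrier A" using xy S by auto
  have "j (a \<otimes> t) = j (b \<otimes> s)"
    using eq xy C nz by (simp add: loc_embed_frac embed_simps field_simps)
  then have "a \<otimes> t = b \<otimes> s" using inj_onD[OF inj] xy C by simp
  then show "x = y" using xy S by (auto simp: loc_frac_eq_iff[OF A mult_set])
qed

end

lemma integrally_closed_domainI:
  fixes j :: "'a \<Rightarrow> 'f :: field"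
  assumes D: "cring D" and j: "j \<in> ring_hom D ring_of_type_algebra" and inj: "inj_on j (carrier D)"
    and int: "integrally_closed_in_fractions (j ` carrier D)"
  shows "integrally_closed_domain D"
proof -
  interpret D: cring D by (rule D)
  interpret F: cring "ring_of_type_algebra :: 'f ring" by (rule cring_from_type_algebra)
  interpret j: ring_hom_cring D "ring_of_type_algebra :: 'f ring" j
    by (rule ring_hom_cringI2[OF D F.cring_axioms j])
  have j0: "j a = 0 \<longleftrightarrow> a = \<zero>\<^bsub>D\<^esub>" if "a \<in> carrier D" for a
    using inj_onD[OF inj _ that D.zero_closed] j.hom_zero by auto
  have dom: "domain D"
  proof (rule domainI[OF D])
    show "\<one>\<^bsub>D\<^esub> \<noteq> \<zero>\<^bsub>D\<^esub>"
    proof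
      assume "\<one>\<^bsub>D\<^esub> = \<zero>\<^bsub>D\<^esub>"
      then have "j \<one>\<^bsub>D\<^esub> = j \<zero>\<^bsub>D\<^esub>" by (simp only:)
      then show False using j.hom_one j.hom_zero by simp
    qed
    fix a b assume "a \<otimes>\<^bsub>D\<^esub> b = \<zero>\<^bsub>D\<^esub>" and ab: "a \<in> carrier D" "b \<in> carrier D"
    then have "j a * j b = 0" using j.hom_mult[OF ab] j.hom_zero by simp
    then show "a = \<zero>\<^bsub>D\<^esub> \<or> b = \<zero>\<^bsub>D\<^esub>" using j0 ab by simp
  qed
  interpret D: domain D by (rule dom)
  define S where "S = carrier D - {\<zero>\<^bsub>D\<^esub>}"
  have S: "S \<subseteq> carrier D" "\<one>\<^bsub>D\<^esub> \<in> S" "\<And>s t. s \<in> S \<Longrightarrow> t \<in> S \<Longrightarrow> s \<otimes>\<^bsub>D\<^esub> t \<in> S"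
    by (auto simp: S_def D.integral_iff)
  have nz: "j s \<noteq> 0" if "s \<in> S" for s using that j0 by (auto simp: S_def)
  have emb: "cring D" "S \<subseteq> carrier D" "\<one>\<^bsub>D\<^esub> \<in> S" "\<forall>s \<in> S. \<forall>t \<in> S. s \<otimes>\<^bsub>D\<^esub> t \<in> S"
    "j \<in> ring_hom D ring_of_type_algebra" "inj_on j (carrier D)" "\<forall>s \<in> S. j s \<noteq> 0"
    using D S j inj nz by auto
  let ?K = "localization D S" and ?h = "loc_embed j"
  note H = loc_embed_hom[OF emb] and frac = loc_embed_frac[OF emb]
    and hinj = loc_embed_inj[OF emb]
  interpret K: cring ?K by (rule cring_localization[OF D S(1,2)]) (rule S(3))
  interpret h: ring_hom_cring ?K "ring_of_type_algebra :: 'f ring" ?h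
    by (rule ring_hom_cringI2[OF K.cring_axioms F.cring_axioms H])
  have "x \<in> (\<lambda>a. loc_frac D S a \<one>\<^bsub>D\<^esub>) ` carrier D"
    if x: "x \<in> carrier ?K" and xint: "integral_over D ?K (\<lambda>a. loc_frac D S a \<one>\<^bsub>D\<^esub>) x" for x
  proof -
    obtain a s where as: "a \<in> carrier D" "s \<in> S" "x = loc_frac D S a s"
      using loc_cases[OF emb x] .
    obtain d :: nat and c where c: "\<forall>i<d. c i \<in> carrier D"
      and eq: "x [^]\<^bsub>?K\<^esub> d \<oplus>\<^bsub>?K\<^esub> (\<Oplus>\<^bsub>?K\<^esub>i\<in>{..<d}. loc_frac D S (c i) \<one>\<^bsub>D\<^esub> \<otimes>\<^bsub>?K\<^esub> x [^]\<^bsub>?K\<^esub> i) = \<zero>\<^bsub>?K\<^esub>"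
      using xint unfolding integral_over_def by blast
    have ck: "loc_frac D S (c i) \<one>\<^bsub>D\<^esub> \<in> carrier ?K" if "i < d" for i
      using c that S(2) loc_frac_carrier[OF emb] by simp
    have pow: "?h (x [^]\<^bsub>?K\<^esub> k) = ?h x ^ k" for k :: nat
      by (induction k) (use x in \<open>simp_all add: mult.commute\<close>)
    have "?h (\<Oplus>\<^bsub>?K\<^esub>i\<in>{..<d}. loc_frac D S (c i) \<one>\<^bsub>D\<^esub> \<otimes>\<^bsub>?K\<^esub> x [^]\<^bsub>?K\<^esub> i) = (\<Sum>i<d. j (c i) * ?h x ^ i)"
    proof -
      have "?h (\<Oplus>\<^bsub>?K\<^esub>i\<in>{..<d}. loc_frac D S (c i) \<one>\<^bsub>D\<^esub> \<otimes>\<^bsub>?K\<^esub> x [^]\<^bsub>?K\<^esub> i) =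
          (\<Sum>i<d. ?h (loc_frac D S (c i) \<one>\<^bsub>D\<^esub> \<otimes>\<^bsub>?K\<^esub> x [^]\<^bsub>?K\<^esub> i))"
        by (subst h.hom_finsum) (use ck x in \<open>auto simp: comp_def\<close>)
      also have "\<dots> = (\<Sum>i<d. j (c i) * ?h x ^ i)"
        by (rule sum.cong) (use ck x c S frac j.hom_one in \<open>auto simp: pow\<close>)
      finally show ?thesis .
    qed
    then have "?h x ^ d + (\<Sum>i<d. j (c i) * ?h x ^ i) = 0"
      using arg_cong[OF eq, of ?h] ck x h.hom_zero by (simp add: pow Pi_iff)
    moreover have hx: "?h x = j a / j s" using frac as by simp
    ultimately have eq': "(j a / j s) ^ d + (\<Sum>i<d. j (c i) * (j a / j s) ^ i) = 0" by simp
    have "j a \<in> j ` carrier D" "j s \<in> j ` carrier D" using as S(1) by auto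
    note int[unfolded integrally_closed_in_fractions_def, rule_format, OF this nz[OF as(2)], of d "\<lambda>i. j (c i)"]
    from this[OF _ eq'] c have "j a / j s \<in> j ` carrier D" by simp
    then obtain b where b: "b \<in> carrier D" "j a / j s = j b" by blast
    have "?h x = ?h (loc_frac D S b \<one>\<^bsub>D\<^esub>)" using b hx frac[OF b(1) S(2)] j.hom_one by simp
    moreover have "loc_frac D S b \<one>\<^bsub>D\<^esub> \<in> carrier ?K" using loc_frac_carrier[OF emb b(1) S(2)] .
    ultimately have "x = loc_frac D S b \<one>\<^bsub>D\<^esub>" using inj_onD[OF hinj] x by blast
    then show ?thesis using b by blast
  qed
  then show ?thesis using dom by (simp add: integrally_closed_domain_def Let_def S_def)
qed

text \<open>An embedding of \<open>A\<close> in a field identifies its localization at a prime with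
  a set of fractions in that field, to which \<open>integrally_closed_fractions\<close>
  applies.\<close>

lemma normal_ringI:
  fixes j :: "'a \<Rightarrow> 'f :: field"
  assumes A: "cring A" and j: "j \<in> ring_hom A ring_of_type_algebra" and inj: "inj_on j (carrier A)"
    and int: "integrally_closed_in_fractions (j ` carrier A)"
  shows "normal_ring A"
  unfolding normal_ring_def
proof (intro conjI A allI impI)
  fix P assume P: "primeideal P A"
  interpret A: cring A by (rule A)
  interpret P: primeideal P A by (rule P)
  interpret F: cring "ring_of_type_algebra :: 'f ring" by (rule cring_from_type_algebra)
  interpret j: ring_hom_cring A "ring_of_type_algebra :: 'f ring" j
    by (rule ring_hom_cringI2[OF A F.cring_axioms j])
  define S where "S = carrier A - P"
  have one: "\<one>\<^bsub>A\<^esub> \<notin> P" using P.one_imp_carrier P.I_notcarr by blast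
  have S: "S \<subseteq> carrier A" "\<one>\<^bsub>A\<^esub> \<in> S" "\<And>s t. s \<in> S \<Longrightarrow> t \<in> S \<Longrightarrow> s \<otimes>\<^bsub>A\<^esub> t \<in> S"
    using one P.I_prime by (auto simp: S_def)
  have nz: "j s \<noteq> 0" if "s \<in> S" for s
  proof
    assume "j s = 0"
    then have "s = \<zero>\<^bsub>A\<^esub>" using inj_onD[OF inj, of s "\<zero>\<^bsub>A\<^esub>"] that S(1) j.hom_zero by auto
    moreover have "\<zero>\<^bsub>A\<^esub> \<in> P" by (rule additive_subgroup.zero_closed[OF P.additive_subgroup_axioms])
    ultimately show False using that by (simp add: S_def)
  qed
  have emb: "cring A" "S \<subseteq> carrier A" "\<one>\<^bsub>A\<^esub> \<in> S" "\<forall>s \<in> S. \<forall>t \<in> S. s \<otimes>\<^bsub>A\<^esub> t \<in> S"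
    "j \<in> ring_hom A ring_of_type_algebra" "inj_on j (carrier A)" "\<forall>s \<in> S. j s \<noteq> 0"
    using A S j inj nz by auto
  note H = loc_embed_hom[OF emb] and frac = loc_embed_frac[OF emb]
    and hinj = loc_embed_inj[OF emb]
  have "loc_embed j ` carrier (localization A S) = {a / s | a s. a \<in> j ` carrier A \<and> s \<in> j ` S}"
  proof (intro equalityI subsetI)
    fix y assume "y \<in> loc_embed j ` carrier (localization A S)"
    then obtain x where x: "x \<in> carrier (localization A S)" "y = loc_embed j x" by (rule imageE)
    obtain a s where "a \<in> carrier A" "s \<in> S" "x = loc_frac A S a s"
      using loc_cases[OF emb x(1)] .
    then show "y \<in> {a / s | a s. a \<in> j ` carrier A \<and> s \<in> j ` S}" using frac x(2) by auto
  next
    fix y assume "y \<in> {a / s | a s. a \<in> j ` carrier A \<and> s \<in> j ` S}"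
    then obtain a s where as: "a \<in> carrier A" "s \<in> S" "y = j a / j s" by auto
    then have "y = loc_embed j (loc_frac A S a s)" using frac by simp
    then show "y \<in> loc_embed j ` carrier (localization A S)"
      using loc_frac_carrier[OF emb as(1,2)] by (rule image_eqI)
  qed
  moreover have "integrally_closed_in_fractions {a / s | a s. a \<in> j ` carrier A \<and> s \<in> j ` S}"
  proof (rule integrally_closed_fractions[OF _ _ _ _ _ int])
    show "1 \<in> j ` S" using S(2) j.hom_one by (metis field_ring_simps(3) image_eqI)
    show "a * b \<in> j ` carrier A" if ab: "a \<in> j ` carrier A" "b \<in> j ` carrier A" for a b
    proof -
      obtain x y where "x \<in> carrier A" "y \<in> carrier A" "a = j x" "b = j y" using ab by blast
      then have "a * b = j (x \<otimes>\<^bsub>A\<^esub> y)" "x \<otimes>\<^bsub>A\<^esub> y \<in> carrier A" by auto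
      then show ?thesis by blast
    qed
    show "a * b \<in> j ` S" if ab: "a \<in> j ` S" "b \<in> j ` S" for a b
    proof -
      obtain x y where xy: "x \<in> S" "y \<in> S" "a = j x" "b = j y" using ab by blast
      then have "a * b = j (x \<otimes>\<^bsub>A\<^esub> y)" using S(1) by (simp add: subset_iff)
      then show ?thesis using S(3) xy by blast
    qed
    show "0 \<notin> j ` S" using nz by auto
    show "j ` S \<subseteq> j ` carrier A" using S(1) by blast
  qed
  ultimately have "integrally_closed_in_fractions (loc_embed j ` carrier (localization A S))" by simp
  moreover have "cring (localization A S)" by (rule cring_localization[OF A S(1,2)]) (rule S(3))
  ultimately have "integrally_closed_domain (localization A S)" using integrally_closed_domainI H hinj by blast
  then
  show "integrally_closed_domain (localization A (carrier A - P))" by (simp add: S_def)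
qed

section \<open>Translates by group arcs and normality of the jets of \<open>Z\<close>\<close>

definition generic_arcs :: "nat \<Rightarrow> (nat \<times> V_coord) cpoly fps mat \<times> (nat \<times> V_coord) cpoly fps mat" where
  "generic_arcs n = (mat n n (\<lambda>(i, j). arc_var (Vect i j)), mat n n (\<lambda>(i, j). arc_var (Covect i j)))"

text \<open>\<open>translate g x\<close> is the polynomial \<open>w \<mapsto> x (g w)\<close>.\<close>

definition translate :: "nat \<Rightarrow> complex fps mat \<Rightarrow> (nat \<times> V_coord) cpoly \<Rightarrow> (nat \<times> V_coord) cpoly" where
  "translate n g = arc_eval (SL_act (map_mat (\<lambda>F. Abs_fps (\<lambda>k. pconst (fps_nth F k))) g) (generic_arcs n))"

definition arc_point :: "nat \<Rightarrow> (nat \<times> V_coord \<Rightarrow> complex) \<Rightarrow> complex fps mat \<times> complex fps mat" where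
  "arc_point n z = (mat n n (\<lambda>(i, j). Abs_fps (\<lambda>k. z (k, Vect i j))), mat n n (\<lambda>(i, j). Abs_fps (\<lambda>k. z (k, Covect i j))))"

lemma arc_point_mat_pairs: "arc_point n z \<in> mat_pairs n"
  by (simp add: arc_point_def mat_pairs_def)

lemma ev_arc_point:
  assumes "x \<in> polys (jvars m (V_coords n))"
  shows "ev z x = arc_eval (arc_point n z) x"
  unfolding arc_eval_def by (rule ev_cong[OF assms]) (auto simp: V_coords_def arc_point_def)

lemma arc_point_coord:
  assumes "w \<in> mat_pairs n" shows "arc_point n (\<lambda>(k, c). fps_nth (coord w c) k) = w"
proof -
  obtain v \<xi> where "w = (v, \<xi>)" by (cases w)
  then show ?thesis using assms by (auto simp: arc_point_def mat_pairs_def fps_nth_inverse intro!: eq_matI)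
qed

lemma ev_translate:
  assumes g: "g \<in> carrier_mat n n" and x: "x \<in> polys (jvars m (V_coords n))"
  shows "ev z (translate n g x) = arc_eval (SL_act g (arc_point n z)) x"
proof -
  let ?\<phi> = "\<lambda>F. Abs_fps (\<lambda>k. ev z (fps_nth F k))"
  let ?g = "map_mat (\<lambda>F. Abs_fps (\<lambda>k. pconst (fps_nth F k))) g"
  have G: "?g \<in> carrier_mat n n" using g by simp
  have gen: "fst (generic_arcs n) \<in> carrier_mat n n" "snd (generic_arcs n) \<in> carrier_mat n n"
    by (simp_all add: generic_arcs_def)
  have m: "map_mat ?\<phi> ?g = g" "map_mat ?\<phi> (fst (generic_arcs n)) = fst (arc_point n z)"
    "map_mat ?\<phi> (snd (generic_arcs n)) = snd (arc_point n z)"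
    by (rule eq_matI; use g in \<open>auto simp: generic_arcs_def arc_point_def arc_var_def fps_nth_inverse\<close>)+
  have "ev z (translate n g x) = ev (\<lambda>v. ev z (case v of (k, c) \<Rightarrow> fps_nth (coord (SL_act ?g (generic_arcs n)) c) k)) x"
    unfolding translate_def arc_eval_def ev_ev ..
  also have "\<dots> = arc_eval (SL_act g (arc_point n z)) x"
    unfolding arc_eval_def
  proof (rule ev_cong[OF x])
    fix v assume "v \<in> jvars m (V_coords n)"
    then obtain k c where v: "v = (k, c)" "c \<in> V_coords n" by auto
    from hom_coord_SL_act[OF calg_hom_fps_map[OF ev.calg_hom_axioms] G gen v(2), of z]
    have "Abs_fps (\<lambda>k. ev z (fps_nth (coord (SL_act ?g (generic_arcs n)) c) k)) = coord (SL_act g (arc_point n z)) c"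
      by (simp add: m)
    from arg_cong[OF this, of "\<lambda>F. fps_nth F k"]
    show "ev z (case v of (k, c) \<Rightarrow> fps_nth (coord (SL_act ?g (generic_arcs n)) c) k) =
        (case v of (k, c) \<Rightarrow> fps_nth (coord (SL_act g (arc_point n z)) c) k)"
      by (simp add: v)
  qed
  finally show ?thesis .
qed

text \<open>At each arc \<open>w\<close> the product of \<open>h(w)\<close> with
  \<open>x(g w) - x(w)\<close> vanishes. As \<open>h\<close> may have zeros, it is cancelled only
  after \<open>w \<mapsto> x (g w)\<close> has been made a polynomial by
  \<open>translate\<close>.\<close>

lemma arc_inv_quotient:
  assumes h: "h \<in> polys (jvars m (V_coords n))" "arc_inv n h" "h \<noteq> 0"
    and x: "x \<in> polys (jvars m (V_coords n))" and hx: "arc_inv n (h * x)"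
  shows "arc_inv n x"
  unfolding arc_inv_def
proof (intro ballI impI)
  fix g :: "complex fps mat" and w :: "complex fps mat \<times> complex fps mat"
  assume g: "g \<in> carrier_mat n n" "det g = 1" and w: "w \<in> mat_pairs n"
  have "h * (translate n g x - x) = 0"
  proof (rule cpoly_eq_0I)
    fix z :: "nat \<times> V_coord \<Rightarrow> complex"
    let ?w = "arc_point n z"
    note pt = arc_point_mat_pairs[of n z]
    have "arc_eval ?w h * arc_eval (SL_act g ?w) x = arc_eval (SL_act g ?w) (h * x)"
      using h(2) g pt by (simp add: arc_inv_def arc_eval.hom_mult)
    also have "\<dots> = arc_eval ?w h * arc_eval ?w x"
      using hx g pt by (simp add: arc_inv_def arc_eval.hom_mult)
    finally show "ev z (h * (translate n g x - x)) = 0"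
      by (simp add: ev.hom_mult ev.hom_minus ev_translate[OF g(1) x] ev_arc_point[OF x] ev_arc_point[OF h(1)]
          right_diff_distrib)
  qed
  then have "translate n g x = x" using h(3) by simp
  then show "arc_eval (SL_act g w) x = arc_eval w x"
    using ev_translate[OF g(1) x, of "\<lambda>(k, c). fps_nth (coord w c) k"]
      ev_arc_point[OF x, of "\<lambda>(k, c). fps_nth (coord w c) k"]
    by (simp add: arc_point_coord[OF w])
qed

text \<open>The image of the jet algebra in \<open>\<O>(V_m)\<close> consists of the arc-invariants.
  A fraction of two of them that is integral over the image is a polynomial by
  \<open>almost_integral_dvd\<close> and again invariant by \<open>arc_inv_quotient\<close>.\<close>

lemma normal_jet_O_Z:
  assumes n: "n \<ge> 1" shows "normal_ring (jet_alg m (O_Z n))"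
proof -
  let ?C = "polys (jvars m (V_coords n))"
  let ?e = "\<lambda>h :: (nat \<times> V_coord) cpoly. Fract h 1"
  let ?i = "\<lambda>U. V_jets m n (p_star m n U)"
  let ?J = "jet_alg m (O_Z n)"
  have e: "?e (p + q) = ?e p + ?e q" "?e (p * q) = ?e p * ?e q" "?e 1 = 1" "?e 0 = 0" "?e (- p) = - ?e p" for p q
    by (simp_all add: One_fract_def Zero_fract_def)
  have e_inj: "?e p = ?e q \<longleftrightarrow> p = q" for p q by (simp add: eq_fract)
  have e_pow: "?e (p ^ k) = ?e p ^ k" for p k by (induction k) (simp_all add: e del: mult_fract)
  interpret J: algebra C_field ?J by (rule algebra_jet[OF algebra_O_Z])
  have im: "?i ` carrier ?J = {h \<in> ?C. arc_inv n h}"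
  proof (intro equalityI subsetI)
    fix h assume "h \<in> ?i ` carrier ?J"
    then obtain U where U: "U \<in> carrier ?J" "h = ?i U" by (rule imageE)
    have F: "p_star m n U \<in> carrier (O_Vm_inv m n)" by (rule p_star_invariant[OF n U(1)])
    then have "p_star m n U \<in> carrier (jet_alg m (O_V n))" by (simp add: O_Vm_inv_def)
    then show "h \<in> {h \<in> ?C. arc_inv n h}"
      using V_jets_surj_inj(1) O_Vm_inv_arc_inv[OF F] U(2) by simp
  next
    fix h assume "h \<in> {h \<in> ?C. arc_inv n h}"
    then obtain Q where Q: "Q \<in> polys (jvars m (gens n))" "h = ev (gen_jet n) Q"
      using arc_inv_imp_gen[OF n, of h m] by auto
    have \<phi>: "gen_poly n \<in> gens n \<rightarrow> carrier (O_Z n)" using gen_poly_O_Z by auto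
    have "jet_pres m (O_Z n) (gen_poly n) Q \<in> carrier ?J"
      using ring_hom_closed[OF alg_homD(1)[OF jet_pres_alg_hom[OF algebra_O_Z \<phi>]] Q(1)] .
    moreover have "h = ?i (jet_pres m (O_Z n) (gen_poly n) Q)"
      using V_jets_p_star[OF Q(1)] Q(2) by simp
    ultimately show "h \<in> ?i ` carrier ?J" by (rule rev_image_eqI)
  qed
  have "?i \<in> ring_hom ?J type_alg"
    using alg_hom_comp[OF p_star(1) V_jets_alg_hom] by (rule alg_homD(1))
  then have hom: "(\<lambda>U. ?e (?i U)) \<in> ring_hom ?J ring_of_type_algebra"
    by (auto simp: ring_hom_def e simp del: add_fract mult_fract)
  have inj: "inj_on (\<lambda>U. ?e (?i U)) (carrier ?J)"
    by (rule inj_onI) (use V_jets_p_star_inj[OF n] e_inj in blast)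
  have "integrally_closed_in_fractions (?e ` ?i ` carrier ?J)"
    unfolding im integrally_closed_in_fractions_def
  proof (intro ballI allI impI)
    fix a b and d :: nat and c
    assume a: "a \<in> ?e ` {h \<in> ?C. arc_inv n h}" and b: "b \<in> ?e ` {h \<in> ?C. arc_inv n h}" and b0: "b \<noteq> 0"
      and c: "\<forall>i<d. c i \<in> ?e ` {h \<in> ?C. arc_inv n h}" and eq: "(a / b) ^ d + (\<Sum>i<d. c i * (a / b) ^ i) = 0"
    obtain f where f: "f \<in> ?C" "arc_inv n f" "a = ?e f" using a by auto
    obtain h where h: "h \<in> ?C" "arc_inv n h" "b = ?e h" using b by auto
    have h0: "h \<noteq> 0" using b0 h(3) e(4) by auto
    define y where "y = a / b"
    have yb: "b * y = a" using b0 by (simp add: y_def)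
    \<comment> \<open>One denominator serves for all powers of \<open>y\<close>: for
      \<open>k < d\<close> it is \<open>b ^ d\<close> directly, and from \<open>d\<close> on the
      integral equation reduces to smaller exponents.\<close>
    have almost: "\<exists>r. b ^ d * y ^ k = ?e r" for k
    proof (induction k rule: less_induct)
      case (less k)
      show ?case
      proof (cases "k < d")
        case True
        then have "b ^ d * y ^ k = b ^ (d - k) * (b * y) ^ k"
          by (simp add: power_mult_distrib flip: power_add mult.assoc)
        also have "\<dots> = b ^ (d - k) * a ^ k" by (simp only: yb)
        also have "\<dots> = ?e (h ^ (d - k) * f ^ k)" by (simp only: h(3) f(3) e e_pow)
        finally show ?thesis by blast
      next
        case False
        have "\<forall>i. \<exists>r. i < d \<longrightarrow> c i = ?e r" using c by blast
        then obtain s where s: "\<And>i. i < d \<Longrightarrow> c i = ?e (s i)" by metis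
        have "\<forall>i. \<exists>r. i < d \<longrightarrow> b ^ d * y ^ (k - d + i) = ?e r" using less False by auto
        then obtain r where r: "\<And>i. i < d \<Longrightarrow> b ^ d * y ^ (k - d + i) = ?e (r i)" by metis
        have esum: "(\<Sum>i\<in>A. ?e (p i)) = ?e (\<Sum>i\<in>A. p i)" for p and A :: "nat set"
          by (induction A rule: infinite_finite_induct) (simp_all add: e del: add_fract)
        have "y ^ d = - (\<Sum>i<d. c i * y ^ i)"
          using eq by (simp add: y_def eq_neg_iff_add_eq_0)
        moreover have "y ^ k = y ^ (k - d) * y ^ d" using False by (simp flip: power_add)
        ultimately have "b ^ d * y ^ k = - (\<Sum>i<d. c i * (b ^ d * y ^ (k - d + i)))"
          by (simp add: sum_distrib_left power_add mult_ac)
        also have "\<dots> = - (\<Sum>i<d. ?e (s i * r i))"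
          by (intro arg_cong[where f = uminus] sum.cong) (simp_all add: s r e del: mult_fract)
        also have "\<dots> = ?e (- (\<Sum>i<d. s i * r i))" by (simp only: esum e(5))
        finally show ?thesis by blast
      qed
    qed
    have "\<exists>x \<in> ?C. f = h * x"
    proof (rule almost_integral_dvd[OF _ h0 h(1) f(1)])
      show "h ^ d \<noteq> 0" using h0 by simp
      show "h ^ k dvd h ^ d * f ^ k" for k
      proof -
        obtain r where r: "b ^ d * y ^ k = ?e r" using almost by blast
        have "?e (h ^ d * f ^ k) = b ^ d * a ^ k" by (simp only: e e_pow f(3) h(3))
        also have "\<dots> = b ^ d * (b * y) ^ k" by (simp only: yb)
        also have "\<dots> = b ^ k * (b ^ d * y ^ k)" by (simp only: power_mult_distrib mult_ac)
        also have "\<dots> = b ^ k * ?e r" by (simp only: r)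
        also have "\<dots> = ?e (h ^ k * r)" by (simp only: e e_pow h(3))
        finally show ?thesis unfolding e_inj by simp
      qed
    qed
    then obtain x where x: "x \<in> ?C" "f = h * x" by blast
    have "arc_inv n x" using arc_inv_quotient[OF h(1,2) h0 x(1)] f(2) x(2) by simp
    moreover have "a / b = ?e x" using b0 by (simp add: f(3) h(3) x(2) e(2) del: mult_fract)
    ultimately show "a / b \<in> ?e ` {h \<in> ?C. arc_inv n h}" using x(1) by blast
  qed
  then have "integrally_closed_in_fractions ((\<lambda>U. ?e (?i U)) ` carrier ?J)" by (simp add: image_image)
  from normal_ringI[OF J.M_cring hom inj this] show ?thesis .
qed

theorem theorem4p8:
  fixes n :: nat and m :: enat
  assumes "n \<ge> 2"
  shows "normal_ring (jet_alg m (O_Z n)) \<and> p_star m n \<in> alg_iso (jet_alg m (O_Z n)) (O_Vm_inv m n)"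
  using assms normal_jet_O_Z[of n m] p_star_alg_iso[of n m] by simp

end
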